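(* Let $c\in\{1,0,-1\}$ and let $\Sigma^n\subset\mathbb Q^{n+1}_1(c)$ be a compact (immersed) spacelike capillary hypersurface supported on $\mathcal P_A$, with constant contact angle $\gamma>0$; that is, $\partial\Sigma\subset\mathcal P_A$ and $\overline g(\nu,N)=-\cosh\gamma$ along $\partial\Sigma$. Then for every constant vector $B\in\mathbb V$, $$\int_\Sigma\varphi_{A,B}\,d\Sigma=0,\qquad \varphi_{A,B}:=n\psi_{A,B}+H\,\overline g(\mathcal T_{A,B},\nu)-n\lambda_A\cosh\gamma\,\overline g(\mathcal K_{A,B},\nu).$$
   Context: Light-cone model. $\mathbb V=\mathbb R^{n+1,2}$ with inner product $\langle\cdot,\cdot\rangle_{\mathbb V}$ of signature $(n+1,2)$ ($n+1$ positive, $2$ negative directions). $c\in\{1,0,-1\}$ and $E_c\in\mathbb V$ is a fixed nonzero vector with $\langle E_c,E_c\rangle_{\mathbb V}=-c$. Then $$\mathbb Q^{n+1}_1(c)=\{\xi\in\mathbb V:\langle\xi,\xi\rangle_{\mathbb V}=0,\ \langle\xi,E_c\rangle_{\mathbb V}=1\},$$ with induced metric $\overline g$ and Levi-Civita connection $\overline\nabla$, is a Lorentzian space form of constant sectional curvature $c$. For constant $A,B\in\mathbb V$ define on $\mathbb Q^{n+1}_1(c)$ (at the point $\xi$): $s_A=\langle A,\xi\rangle_{\mathbb V}$, $m_A=\langle A,E_c\rangle_{\mathbb V}$, $\rho_A=m_A+cs_A$ (and similarly for $B$); $\mathcal X_A=\overline\nabla s_A=A-\rho_A\xi-s_AE_c$;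 $\mathcal K_{A,B}=\rho_A\mathcal X_B-\rho_B\mathcal X_A$; $\mathcal T_{A,B}=\langle A,B\rangle_{\mathbb V}\mathcal X_A-\langle A,A\rangle_{\mathbb V}\mathcal X_B+m_A(s_A\mathcal X_B-s_B\mathcal X_A)$; $\psi_{A,B}=\langle A,A\rangle_{\mathbb V}\rho_B-\langle A,B\rangle_{\mathbb V}\rho_A+m_A(s_B\rho_A-s_A\rho_B)$. Support. $A\in\mathbb V$ is a fixed vector with $\langle A,A\rangle_{\mathbb V}<0$, linearly independent of $E_c$; $\lambda_A=\sqrt{-\langle A,A\rangle_{\mathbb V}}$; $\mathcal P_A=\{\xi\in\mathbb Q^{n+1}_1(c):s_A(\xi)=0\}$, a spacelike hypersurface with unit timelike normal $N=-\lambda_A^{-1}\mathcal X_A$. Capillary hypersurface. $\Sigma$ is a compact $n$-manifold with boundary, spacelike immersed in $\mathbb Q^{n+1}_1(c)$ with boundary mapped into $\mathcal P_A$; $\nu$ is a unit timelike normal field on $\Sigma$ (in the same time cone as $N$ along $\partial\Sigma$); $h(X,Y)=\overline g(\overline\nabla_X\nu,Y)$ and $H=\operatorname{tr}h$. Capillary means that $H$ is constant and the contact angle $\gamma$ is constant. With $\mu$ the outward unit conormal of $\partial\Sigma$ in $\Sigma$, the side of the support is fixed so that $N=\cosh\gamma\,\nu-\sinh\gamma\,\mu$ along $\partial\Sigma$. Ambient functions and fields are restricted to $\Sigma$. *)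

theory Defs
  imports "HOL-Analysis.Analysis"
begin

section \<open>The light-cone model\<close>

text \<open>The space \<open>\<real>\<^sup>n\<^sup>+\<^sup>1\<^sup>,\<^sup>2\<close> with \<open>n = CARD('n)\<close>: the first factor carries the \<open>n + 1\<close> positive
  directions, the second one the two negative directions.\<close>

type_synonym 'n V = "((real ^ 'n) \<times> real) \<times> (real \<times> real)"

definition ip :: "'n::finite V \<Rightarrow> 'n V \<Rightarrow> real"  ("\<langle>_, _\<rangle>\<^sub>V")
  where "\<langle>x, y\<rangle>\<^sub>V = fst x \<bullet> fst y - snd x \<bullet> snd y"

text \<open>The sectional curvature \<open>c\<close> enters only through \<open>\<langle>E, E\<rangle>\<^sub>V = - c\<close>, which is assumed where
  these definitions are used.\<close>

definition space_form :: "'n::finite V \<Rightarrow> 'n V set"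
  where "space_form E = {\<xi>. \<langle>\<xi>, \<xi>\<rangle>\<^sub>V = 0 \<and> \<langle>\<xi>, E\<rangle>\<^sub>V = 1}"

definition tangent_space_form :: "'n::finite V \<Rightarrow> 'n V \<Rightarrow> 'n V set"
  where "tangent_space_form E \<xi> = {v. \<langle>v, \<xi>\<rangle>\<^sub>V = 0 \<and> \<langle>v, E\<rangle>\<^sub>V = 0}"

text \<open>The metric of the space form is the restriction of \<open>\<langle>_, _\<rangle>\<^sub>V\<close> to its tangent spaces. Hence
  its Levi-Civita connection is the flat derivative of \<open>V\<close> followed by the orthogonal projection
  onto the tangent space; see \<open>tangent_proj_orthogonal\<close> below.\<close>

definition tangent_proj :: "real \<Rightarrow> 'n::finite V \<Rightarrow> 'n V \<Rightarrow> 'n V \<Rightarrow> 'n V"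
  where "tangent_proj c E \<xi> w = w - (\<langle>w, E\<rangle>\<^sub>V + c * \<langle>w, \<xi>\<rangle>\<^sub>V) *\<^sub>R \<xi> - \<langle>w, \<xi>\<rangle>\<^sub>V *\<^sub>R E"

lemma ip_commute: "\<langle>x, y\<rangle>\<^sub>V = \<langle>y, x\<rangle>\<^sub>V"
  by (simp add: ip_def inner_commute)

lemma ip_diff_left: "\<langle>x - y, z\<rangle>\<^sub>V = \<langle>x, z\<rangle>\<^sub>V - \<langle>y, z\<rangle>\<^sub>V"
  by (simp add: ip_def inner_diff_left)

lemma ip_add_left: "\<langle>x + y, z\<rangle>\<^sub>V = \<langle>x, z\<rangle>\<^sub>V + \<langle>y, z\<rangle>\<^sub>V"
  by (simp add: ip_def inner_add_left)

lemma ip_scaleR_left: "\<langle>a *\<^sub>R x, z\<rangle>\<^sub>V = a * \<langle>x, z\<rangle>\<^sub>V"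
  by (simp add: ip_def right_diff_distrib)

lemma tangent_proj_tangent:
  assumes "\<xi> \<in> space_form E" "\<langle>E, E\<rangle>\<^sub>V = - c"
  shows "tangent_proj c E \<xi> w \<in> tangent_space_form E \<xi>"
  using assms ip_commute[of E \<xi>]
  by (simp add: tangent_proj_def tangent_space_form_def space_form_def ip_diff_left
      ip_add_left ip_scaleR_left algebra_simps)

lemma tangent_proj_orthogonal:
  assumes "v \<in> tangent_space_form E \<xi>"
  shows "\<langle>w - tangent_proj c E \<xi> w, v\<rangle>\<^sub>V = 0"
  using assms ip_commute[of E v] ip_commute[of \<xi> v]
  by (simp add: tangent_proj_def tangent_space_form_def ip_diff_left
      ip_add_left ip_scaleR_left)

text \<open>In the following, \<open>\<xi>\<close> is the point of the space form at which the function or field is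
  evaluated.\<close>

definition s_fun :: "'n::finite V \<Rightarrow> 'n V \<Rightarrow> real"
  where "s_fun A \<xi> = \<langle>A, \<xi>\<rangle>\<^sub>V"

definition m_const :: "'n::finite V \<Rightarrow> 'n V \<Rightarrow> real"
  where "m_const E A = \<langle>A, E\<rangle>\<^sub>V"

definition rho_fun :: "real \<Rightarrow> 'n::finite V \<Rightarrow> 'n V \<Rightarrow> 'n V \<Rightarrow> real"
  where "rho_fun c E A \<xi> = m_const E A + c * s_fun A \<xi>"

definition X_field :: "real \<Rightarrow> 'n::finite V \<Rightarrow> 'n V \<Rightarrow> 'n V \<Rightarrow> 'n V"
  where "X_field c E A \<xi> = A - rho_fun c E A \<xi> *\<^sub>R \<xi> - s_fun A \<xi> *\<^sub>R E"

definition K_field :: "real \<Rightarrow> 'n::finite V \<Rightarrow> 'n V \<Rightarrow> 'n V \<Rightarrow> 'n V \<Rightarrow> 'n V"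
  where "K_field c E A B \<xi> =
    rho_fun c E A \<xi> *\<^sub>R X_field c E B \<xi> - rho_fun c E B \<xi> *\<^sub>R X_field c E A \<xi>"

definition T_field :: "real \<Rightarrow> 'n::finite V \<Rightarrow> 'n V \<Rightarrow> 'n V \<Rightarrow> 'n V \<Rightarrow> 'n V"
  where "T_field c E A B \<xi> =
    \<langle>A, B\<rangle>\<^sub>V *\<^sub>R X_field c E A \<xi> - \<langle>A, A\<rangle>\<^sub>V *\<^sub>R X_field c E B \<xi>
    + m_const E A *\<^sub>R (s_fun A \<xi> *\<^sub>R X_field c E B \<xi> - s_fun B \<xi> *\<^sub>R X_field c E A \<xi>)"

definition psi_fun :: "real \<Rightarrow> 'n::finite V \<Rightarrow> 'n V \<Rightarrow> 'n V \<Rightarrow> 'n V \<Rightarrow> real"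
  where "psi_fun c E A B \<xi> =
    \<langle>A, A\<rangle>\<^sub>V * rho_fun c E B \<xi> - \<langle>A, B\<rangle>\<^sub>V * rho_fun c E A \<xi>
    + m_const E A * (s_fun B \<xi> * rho_fun c E A \<xi> - s_fun A \<xi> * rho_fun c E B \<xi>)"

definition lambda_const :: "'n::finite V \<Rightarrow> real"
  where "lambda_const A = sqrt (- \<langle>A, A\<rangle>\<^sub>V)"

definition support_hypersurface :: "'n::finite V \<Rightarrow> 'n V \<Rightarrow> 'n V set"
  where "support_hypersurface E A = {\<xi> \<in> space_form E. s_fun A \<xi> = 0}"

definition support_normal :: "real \<Rightarrow> 'n::finite V \<Rightarrow> 'n V \<Rightarrow> 'n V \<Rightarrow> 'n V"
  where "support_normal c E A \<xi> = - (inverse (lambda_const A) *\<^sub>R X_field c E A \<xi>)"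


section \<open>Smooth manifolds with boundary\<close>

fun C_k_on :: "nat \<Rightarrow> ('a::real_normed_vector \<Rightarrow> 'b::real_normed_vector) \<Rightarrow> 'a set \<Rightarrow> bool"
  where
    "C_k_on 0 f W \<longleftrightarrow> continuous_on W f"
  | "C_k_on (Suc r) f W \<longleftrightarrow> (\<forall>x\<in>W. f differentiable (at x)) \<and>
      (\<forall>v. C_k_on r (\<lambda>x. frechet_derivative f (at x) v) W)"

text \<open>Smoothness on a set that need not be open: local existence of a smooth extension.\<close>

definition smooth_on :: "'a set \<Rightarrow> ('a::real_normed_vector \<Rightarrow> 'b::real_normed_vector) \<Rightarrow> bool"
  where "smooth_on S f \<longleftrightarrow>
    (\<forall>x\<in>S. \<exists>W g. open W \<and> x \<in> W \<and> (\<forall>r. C_k_on r g W) \<and> (\<forall>y\<in>S \<inter> W. g y = f y))"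

text \<open>The model of an \<open>n\<close>-manifold with boundary is the half-space \<open>x\<^sub>k \<ge> 0\<close> of \<open>\<real>\<^sup>n\<close>, where \<open>k\<close>
  is an arbitrary coordinate. A chart is a pair of its domain and its coordinate map; interior
  charts are those whose image does not meet the hyperplane \<open>x\<^sub>k = 0\<close>.\<close>

definition half_space :: "'n \<Rightarrow> (real ^ 'n::finite) set"
  where "half_space k = {x. 0 \<le> x $ k}"

type_synonym ('m, 'n) chart = "'m set \<times> ('m \<Rightarrow> real ^ 'n)"

definition is_chart :: "'n::finite \<Rightarrow> 'm::topological_space set \<Rightarrow> ('m, 'n) chart \<Rightarrow> bool"
  where "is_chart k M = (\<lambda>(U, \<phi>).
    openin (top_of_set M) U \<and>
    openin (top_of_set (half_space k)) (\<phi> ` U) \<and>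
    homeomorphism U (\<phi> ` U) \<phi> (inv_into U \<phi>))"

definition smooth_atlas :: "'n::finite \<Rightarrow> 'm::topological_space set \<Rightarrow> ('m, 'n) chart set \<Rightarrow> bool"
  where "smooth_atlas k M \<A> \<longleftrightarrow>
    (\<forall>ch\<in>\<A>. is_chart k M ch) \<and>
    M = (\<Union>(U, \<phi>)\<in>\<A>. U) \<and>
    (\<forall>(U, \<phi>)\<in>\<A>. \<forall>(U', \<phi>')\<in>\<A>. smooth_on (\<phi> ` (U \<inter> U')) (\<phi>' \<circ> inv_into U \<phi>))"

definition manifold_boundary :: "'n::finite \<Rightarrow> ('m, 'n) chart set \<Rightarrow> 'm set"
  where "manifold_boundary k \<A> = {p. \<exists>(U, \<phi>)\<in>\<A>. p \<in> U \<and> \<phi> p $ k = 0}"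

definition smooth_map :: "('m, 'n::finite) chart set \<Rightarrow> ('m \<Rightarrow> 'b::real_normed_vector) \<Rightarrow> bool"
  where "smooth_map \<A> f \<longleftrightarrow> (\<forall>(U, \<phi>)\<in>\<A>. smooth_on (\<phi> ` U) (f \<circ> inv_into U \<phi>))"

text \<open>\<open>chart_deriv f ch p v\<close> is the differential of \<open>f\<close> at \<open>p\<close>, applied to the tangent vector with
  components \<open>v\<close> in the chart \<open>ch\<close>. The derivative within the chart image is also uniquely
  determined at boundary points, where that image contains a relative neighbourhood of the
  half-space.\<close>

definition chart_deriv ::
  "('m \<Rightarrow> 'b::real_normed_vector) \<Rightarrow> ('m, 'n::finite) chart \<Rightarrow> 'm \<Rightarrow> real ^ 'n \<Rightarrow> 'b"
  where "chart_deriv f = (\<lambda>(U, \<phi>) p.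
    frechet_derivative (f \<circ> inv_into U \<phi>) (at (\<phi> p) within \<phi> ` U))"


section \<open>Spacelike hypersurfaces of the space form\<close>

text \<open>Tangent vectors of the immersed hypersurface are represented by their images in \<open>V\<close>.
  Positivity of the induced metric makes the differential of \<open>F\<close> injective.\<close>

definition spacelike_immersion ::
  "'m set \<Rightarrow> ('m, 'n::finite) chart set \<Rightarrow> 'n V \<Rightarrow> ('m \<Rightarrow> 'n V) \<Rightarrow> bool"
  where "spacelike_immersion M \<A> E F \<longleftrightarrow>
    F ` M \<subseteq> space_form E \<and> smooth_map \<A> F \<and>
    (\<forall>ch\<in>\<A>. \<forall>p\<in>fst ch. \<forall>v. v \<noteq> 0 \<longrightarrow> 0 < \<langle>chart_deriv F ch p v, chart_deriv F ch p v\<rangle>\<^sub>V)"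

definition metric_matrix ::
  "('m \<Rightarrow> 'n::finite V) \<Rightarrow> ('m, 'n) chart \<Rightarrow> 'm \<Rightarrow> real ^ 'n ^ 'n"
  where "metric_matrix F ch p =
    (\<chi> i j. \<langle>chart_deriv F ch p (axis i 1), chart_deriv F ch p (axis j 1)\<rangle>\<^sub>V)"

text \<open>The unique Borel measure on \<open>M\<close> that has density \<open>sqrt (det g)\<close> in every chart.\<close>

definition volume_measure ::
  "'m::topological_space set \<Rightarrow> ('m, 'n::finite) chart set \<Rightarrow> ('m \<Rightarrow> 'n V) \<Rightarrow> 'm measure"
  where "volume_measure M \<A> F = (THE \<omega>.
    sets \<omega> = sets (restrict_space borel M) \<and>
    (\<forall>(U, \<phi>)\<in>\<A>. \<forall>S\<in>sets \<omega>. S \<subseteq> U \<longrightarrow>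
      emeasure \<omega> S =
        (\<integral>\<^sup>+ x\<in>\<phi> ` S. ennreal (sqrt (det (metric_matrix F (U, \<phi>) (inv_into U \<phi> x)))) \<partial>lborel)))"

definition unit_timelike_normal ::
  "'m set \<Rightarrow> ('m, 'n::finite) chart set \<Rightarrow> 'n V \<Rightarrow> ('m \<Rightarrow> 'n V) \<Rightarrow> ('m \<Rightarrow> 'n V) \<Rightarrow> bool"
  where "unit_timelike_normal M \<A> E F \<nu> \<longleftrightarrow>
    smooth_map \<A> \<nu> \<and>
    (\<forall>p\<in>M. \<nu> p \<in> tangent_space_form E (F p) \<and> \<langle>\<nu> p, \<nu> p\<rangle>\<^sub>V = - 1) \<and>
    (\<forall>ch\<in>\<A>. \<forall>p\<in>fst ch. \<forall>v. \<langle>\<nu> p, chart_deriv F ch p v\<rangle>\<^sub>V = 0)"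

text \<open>The components of \<open>h(X, Y)\<close>, the metric product of \<open>Y\<close> with the covariant derivative of \<open>\<nu>\<close>
  in direction \<open>X\<close>.\<close>

definition second_fundamental_matrix ::
  "real \<Rightarrow> 'n::finite V \<Rightarrow> ('m \<Rightarrow> 'n V) \<Rightarrow> ('m \<Rightarrow> 'n V) \<Rightarrow> ('m, 'n) chart \<Rightarrow> 'm \<Rightarrow> real ^ 'n ^ 'n"
  where "second_fundamental_matrix c E F \<nu> ch p =
    (\<chi> i j. \<langle>tangent_proj c E (F p) (chart_deriv \<nu> ch p (axis i 1)),
             chart_deriv F ch p (axis j 1)\<rangle>\<^sub>V)"

text \<open>The trace of \<open>h\<close> with respect to the induced metric, not divided by \<open>n\<close>; its value does not
  depend on the chart around \<open>p\<close>.\<close>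

definition mean_curvature ::
  "real \<Rightarrow> 'n::finite V \<Rightarrow> ('m \<Rightarrow> 'n V) \<Rightarrow> ('m \<Rightarrow> 'n V) \<Rightarrow> ('m, 'n) chart \<Rightarrow> 'm \<Rightarrow> real"
  where "mean_curvature c E F \<nu> ch p =
    trace (matrix_inv (metric_matrix F ch p) ** second_fundamental_matrix c E F \<nu> ch p)"

text \<open>In a chart, the boundary directions are those with \<open>w\<^sub>k = 0\<close> and the outward ones those with
  \<open>v\<^sub>k < 0\<close>.\<close>

definition outward_unit_conormal ::
  "'n::finite \<Rightarrow> ('m, 'n) chart set \<Rightarrow> ('m \<Rightarrow> 'n V) \<Rightarrow> ('m \<Rightarrow> 'n V) \<Rightarrow> bool"
  where "outward_unit_conormal k \<A> F \<mu> \<longleftrightarrow>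
    (\<forall>p\<in>manifold_boundary k \<A>. \<langle>\<mu> p, \<mu> p\<rangle>\<^sub>V = 1 \<and>
      (\<forall>ch\<in>\<A>. p \<in> fst ch \<longrightarrow>
        (\<exists>v. \<mu> p = chart_deriv F ch p v \<and> v $ k < 0) \<and>
        (\<forall>w. w $ k = 0 \<longrightarrow> \<langle>\<mu> p, chart_deriv F ch p w\<rangle>\<^sub>V = 0)))"

text \<open>The identity \<open>\<langle>\<nu>, N\<rangle>\<^sub>V = - cosh \<gamma> < 0\<close> also says that \<open>\<nu>\<close> and \<open>N\<close> lie in the same time cone.\<close>

definition capillary ::
  "real \<Rightarrow> 'n::finite V \<Rightarrow> 'n V \<Rightarrow> 'n \<Rightarrow> ('m, 'n) chart set \<Rightarrow>
    ('m \<Rightarrow> 'n V) \<Rightarrow> ('m \<Rightarrow> 'n V) \<Rightarrow> ('m \<Rightarrow> 'n V) \<Rightarrow> real \<Rightarrow> real \<Rightarrow> bool"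
  where "capillary c E A k \<A> F \<nu> \<mu> H \<gamma> \<longleftrightarrow>
    (\<forall>ch\<in>\<A>. \<forall>p\<in>fst ch. mean_curvature c E F \<nu> ch p = H) \<and>
    (\<forall>p\<in>manifold_boundary k \<A>.
      F p \<in> support_hypersurface E A \<and>
      \<langle>\<nu> p, support_normal c E A (F p)\<rangle>\<^sub>V = - cosh \<gamma> \<and>
      support_normal c E A (F p) = cosh \<gamma> *\<^sub>R \<nu> p - sinh \<gamma> *\<^sub>R \<mu> p)"

definition phi_fun ::
  "real \<Rightarrow> 'n::finite V \<Rightarrow> 'n V \<Rightarrow> 'n V \<Rightarrow> real \<Rightarrow> real \<Rightarrow> ('m \<Rightarrow> 'n V) \<Rightarrow> ('m \<Rightarrow> 'n V) \<Rightarrow> 'm \<Rightarrow> real"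
  where "phi_fun c E A B H \<gamma> F \<nu> p =
    real CARD('n) * psi_fun c E A B (F p)
    + H * \<langle>T_field c E A B (F p), \<nu> p\<rangle>\<^sub>V
    - real CARD('n) * lambda_const A * cosh \<gamma> * \<langle>K_field c E A B (F p), \<nu> p\<rangle>\<^sub>V"

end

theory Submission
  imports Defs
begin

text \<open>
  The integrand is the divergence of a vector field that is tangent to the hypersurface and, along
  the boundary, orthogonal to the conormal. With \<open>\<kappa> = \<lambda>\<^sub>A cosh \<gamma>\<close> this field is
  \<open>Y = T + \<langle>T, \<nu>\<rangle> \<nu> + \<kappa> (\<langle>X\<^sub>B, \<nu>\<rangle> X\<^sub>A - \<langle>X\<^sub>A, \<nu>\<rangle> X\<^sub>B)\<close>, where \<open>T = T\<^sub>A\<^sub>,\<^sub>B\<close>: the tangential part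
  of the field \<open>T\<close>, plus a combination of the tangential parts of \<open>X\<^sub>A\<close> and \<open>X\<^sub>B\<close> in which the normal
  components cancel.

  The divergence of \<open>Y\<close> comes out as follows. The field \<open>X\<^sub>A\<close> satisfies \<open>\<nabla>\<^sub>v X\<^sub>A = - \<rho>\<^sub>A v\<close>. Hence
  \<open>\<nabla>\<^sub>v T = \<psi> v\<close> up to a term that is skew in \<open>v\<close>, so that the tangential part of \<open>T\<close> has divergence
  \<open>n \<psi> + H \<langle>T, \<nu>\<rangle>\<close>. The gradient of \<open>\<langle>X\<^sub>B, \<nu>\<rangle>\<close> on the hypersurface is the shape operator applied
  to the tangential part of \<open>X\<^sub>B\<close>. As the shape operator is self-adjoint, those terms cancel in the
  divergence of the second part of \<open>Y\<close>, and so do the terms with \<open>H\<close>; what remains is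
  \<open>- n \<kappa> (\<rho>\<^sub>A \<langle>X\<^sub>B, \<nu>\<rangle> - \<rho>\<^sub>B \<langle>X\<^sub>A, \<nu>\<rangle>) = - n \<kappa> \<langle>K\<^sub>A\<^sub>,\<^sub>B, \<nu>\<rangle>\<close>. This is \<open>trace_flux_deriv\<close>. On the boundary
  \<open>s\<^sub>A = 0\<close> and \<open>X\<^sub>A = - \<lambda>\<^sub>A (cosh \<gamma> \<nu> - sinh \<gamma> \<mu>)\<close>, and \<open>\<langle>Y, \<mu>\<rangle> = 0\<close> reduces to
  \<open>cosh\<^sup>2 \<gamma> - sinh\<^sup>2 \<gamma> = 1\<close>; this is \<open>flux_field_boundary\<close>.

  What remains is the divergence theorem for a field with vanishing flux on a compact manifold with
  boundary. In a chart, \<open>sqrt (det g)\<close> times the divergence is the sum of the partial derivatives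
  of \<open>sqrt (det g) y\<^sub>i\<close>, where the \<open>y\<^sub>i\<close> are the components of \<open>Y\<close> (\<open>divergence_in_coordinates\<close>, on
  the basis of the derivative of the determinant and the symmetry of second derivatives). Vanishing
  flux says that the component transversal to the boundary is zero there, and so the integral over
  the half-space of each partial derivative vanishes when the field has compact support. This is
  proved without iterated integrals (\<open>integral_partial_derivative_half_space_eq_0\<close>): the integral of
  a difference quotient is zero by translation invariance, and dominated convergence applies.

  A partition of unity reduces the global statement to charts. Its functions are made from
  functions \<open>(max 0 (\<epsilon>\<^sup>2 - |F q - F p|\<^sup>2))\<^sup>2\<close> on \<open>V\<close> that are pulled back by the immersion and cut
  off inside a chart around \<open>p\<close> (\<open>bump_function\<close>). Their differential has the form
  \<open>v \<mapsto> e \<bullet> dF v\<close> with \<open>e\<close> in \<open>V\<close>, which is the same in every chart; therefore no derivative of a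
  change of charts enters here.

  The measure itself is only characterised by its values inside charts. That such a measure exists
  and is unique (\<open>volume_measure_unique_existence\<close>) rests on the change of variables formula, which
  is first transported from well-ordered to arbitrary finite index types.
\<close>

section \<open>Differentiable functions and determinants\<close>

definition C1_on :: "'a::real_normed_vector set \<Rightarrow> ('a \<Rightarrow> 'b::real_normed_vector) \<Rightarrow> bool"
  where "C1_on W f \<longleftrightarrow> (\<forall>x\<in>W. f differentiable (at x)) \<and>
    (\<forall>v. continuous_on W (\<lambda>x. frechet_derivative f (at x) v))"

lemma C1_on_has_derivative:
  "C1_on W f \<Longrightarrow> x \<in> W \<Longrightarrow> (f has_derivative frechet_derivative f (at x)) (at x)"
  by (simp add: C1_on_def frechet_derivative_works[symmetric])

lemma C1_onI:
  assumes "\<And>x. x \<in> W \<Longrightarrow> (f has_derivative f' x) (at x)"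
    and "\<And>v. continuous_on W (\<lambda>x. f' x v)"
  shows "C1_on W f"
proof -
  have "frechet_derivative f (at x) = f' x" if "x \<in> W" for x
    using frechet_derivative_at[OF assms(1)[OF that]] by simp
  then show ?thesis
    using assms by (auto simp: C1_on_def differentiable_def cong: continuous_on_cong_simp)
qed

lemma C1_on_continuous: "C1_on W f \<Longrightarrow> continuous_on W f"
  by (meson C1_on_has_derivative continuous_at_imp_continuous_on has_derivative_continuous)

lemma C1_on_subset: "C1_on W f \<Longrightarrow> U \<subseteq> W \<Longrightarrow> C1_on U f"
  by (auto simp: C1_on_def intro: continuous_on_subset)

lemma C1_on_const: "C1_on W (\<lambda>x. a)"
  by (rule C1_onI[where f'="\<lambda>x v. 0"]) auto

lemma C1_on_bounded_linear:
  assumes "bounded_linear L" "C1_on W f"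
  shows "C1_on W (\<lambda>x. L (f x))"
  by (rule C1_onI[where f'="\<lambda>x v. L (frechet_derivative f (at x) v)"])
    (use assms in \<open>auto intro!: bounded_linear.has_derivative[OF assms(1)] C1_on_has_derivative
      bounded_linear.continuous_on[OF assms(1)] simp: C1_on_def\<close>)

lemma C1_on_add: "C1_on W f \<Longrightarrow> C1_on W g \<Longrightarrow> C1_on W (\<lambda>x. f x + g x)"
  by (rule C1_onI[where f'="\<lambda>x v. frechet_derivative f (at x) v + frechet_derivative g (at x) v"])
    (auto intro!: has_derivative_add C1_on_has_derivative continuous_on_add simp: C1_on_def
      frechet_derivative_works[symmetric])

lemma C1_on_sum: "(\<And>i. i \<in> I \<Longrightarrow> C1_on W (f i)) \<Longrightarrow> C1_on W (\<lambda>x. \<Sum>i\<in>I. f i x)"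
  by (induction I rule: infinite_finite_induct) (auto intro: C1_on_const C1_on_add)

lemma C1_on_bilinear:
  assumes "bounded_bilinear pr" "C1_on W f" "C1_on W g"
  shows "C1_on W (\<lambda>x. pr (f x) (g x))"
proof (rule C1_onI)
  show "((\<lambda>x. pr (f x) (g x)) has_derivative
      (\<lambda>v. pr (f x) (frechet_derivative g (at x) v) + pr (frechet_derivative f (at x) v) (g x)))
      (at x)" if "x \<in> W" for x
    by (rule bounded_bilinear.FDERIV[OF assms(1)]) (use assms that in \<open>auto intro: C1_on_has_derivative\<close>)
  show "continuous_on W (\<lambda>x. pr (f x) (frechet_derivative g (at x) v)
      + pr (frechet_derivative f (at x) v) (g x))" for v
    using assms by (intro continuous_on_add bounded_bilinear.continuous_on[OF assms(1)])
      (auto intro: C1_on_continuous simp: C1_on_def)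
qed

lemmas C1_on_mult = C1_on_bilinear[OF bounded_bilinear_mult]
lemmas C1_on_scaleR = C1_on_bilinear[OF bounded_bilinear_scaleR]

lemma C1_on_uminus: "C1_on W f \<Longrightarrow> C1_on W (\<lambda>x. - f x)"
  by (rule C1_on_bounded_linear[OF bounded_linear_minus[OF bounded_linear_ident]])

lemma C1_on_diff: "C1_on W f \<Longrightarrow> C1_on W g \<Longrightarrow> C1_on W (\<lambda>x. f x - g x)"
  using C1_on_add[of W f "\<lambda>x. - g x"] C1_on_uminus[of W g] by simp

lemma C1_on_prod:
  fixes f :: "'i \<Rightarrow> 'a::real_normed_vector \<Rightarrow> real"
  shows "(\<And>i. i \<in> I \<Longrightarrow> C1_on W (f i)) \<Longrightarrow> C1_on W (\<lambda>x. \<Prod>i\<in>I. f i x)"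
  by (induction I rule: infinite_finite_induct) (auto intro: C1_on_const C1_on_mult)

lemma C1_on_compose_real:
  fixes f :: "'a::real_normed_vector \<Rightarrow> real" and h :: "real \<Rightarrow> real"
  assumes f: "C1_on W f" and h: "\<And>x. x \<in> W \<Longrightarrow> (h has_real_derivative h' (f x)) (at (f x))"
    and h': "continuous_on (f ` W) h'"
  shows "C1_on W (\<lambda>x. h (f x))"
proof (rule C1_onI)
  show "((\<lambda>x. h (f x)) has_derivative (\<lambda>v. h' (f x) * frechet_derivative f (at x) v)) (at x)"
    if "x \<in> W" for x
    using has_derivative_compose[OF C1_on_has_derivative[OF f that] h[OF that, unfolded has_field_derivative_def]] .
  show "continuous_on W (\<lambda>x. h' (f x) * frechet_derivative f (at x) v)" for v
    using f by (intro continuous_on_mult continuous_on_compose2[OF h' C1_on_continuous[OF f]])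
      (auto simp: C1_on_def)
qed

lemma C1_on_inverse:
  fixes f :: "'a::real_normed_vector \<Rightarrow> real"
  assumes "C1_on W f" "\<And>x. x \<in> W \<Longrightarrow> f x \<noteq> 0"
  shows "C1_on W (\<lambda>x. inverse (f x))"
  by (rule C1_on_compose_real[OF assms(1), where h'="\<lambda>y. - (inverse y * inverse y)"])
    (use assms(2) in \<open>auto intro!: continuous_intros DERIV_inverse'[OF DERIV_ident, simplified]
        simp: power2_eq_square intro: DERIV_cong[OF DERIV_inverse]\<close>)

lemma C1_on_sqrt:
  fixes f :: "'a::real_normed_vector \<Rightarrow> real"
  assumes "C1_on W f" "\<And>x. x \<in> W \<Longrightarrow> 0 < f x"
  shows "C1_on W (\<lambda>x. sqrt (f x))"
  by (rule C1_on_compose_real[OF assms(1), where h'="\<lambda>y. inverse (sqrt y) / 2"])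
    (use assms(2) in \<open>auto intro!: continuous_intros DERIV_real_sqrt simp: less_imp_neq[symmetric]\<close>)

lemma C1_on_det:
  fixes f :: "'a::real_normed_vector \<Rightarrow> real^'n^'n"
  assumes "\<And>i j. C1_on W (\<lambda>x. f x $ i $ j)"
  shows "C1_on W (\<lambda>x. det (f x))"
  unfolding det_def by (intro C1_on_sum C1_on_mult C1_on_const C1_on_prod assms)

text \<open>In the Leibniz expansion, a permutation other than the identity moves at least two indices. Each
  of its products therefore contains at least two off-diagonal factors, and the derivative removes only one.\<close>

lemma has_derivative_det_at_mat_1:
  fixes A :: "'a::real_normed_vector \<Rightarrow> real^'n^'n"
  assumes A: "\<And>i j. ((\<lambda>x. A x $ i $ j) has_derivative A' i j) (at x)" and "A x = mat 1"
  shows "((\<lambda>x. det (A x)) has_derivative (\<lambda>v. \<Sum>i\<in>UNIV. A' i i v)) (at x)"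
proof -
  let ?P = "{p. p permutes (UNIV::'n set)}"
  have Ax: "A x $ i $ j = (if i = j then 1 else 0)" for i j
    by (simp add: assms(2) mat_def)
  have "((\<lambda>x. det (A x)) has_derivative (\<lambda>v. \<Sum>p\<in>?P. of_int (sign p) *
      (\<Sum>i\<in>UNIV. A' i (p i) v * (\<Prod>j\<in>UNIV - {i}. A x $ j $ p j)))) (at x)"
    unfolding det_def
    by (intro has_derivative_sum has_derivative_mult_right has_derivative_prod A)
  also have "(\<lambda>v. \<Sum>p\<in>?P. of_int (sign p) *
      (\<Sum>i\<in>UNIV. A' i (p i) v * (\<Prod>j\<in>UNIV - {i}. A x $ j $ p j)))
    = (\<lambda>v. \<Sum>p\<in>?P. if p = id then \<Sum>i\<in>UNIV. A' i i v else 0)"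
  proof (intro ext sum.cong refl)
    fix v p assume p: "p \<in> ?P"
    show "of_int (sign p) * (\<Sum>i\<in>UNIV. A' i (p i) v * (\<Prod>j\<in>UNIV - {i}. A x $ j $ p j))
        = (if p = id then \<Sum>i\<in>UNIV. A' i i v else 0)"
    proof (cases "p = id")
      case True
      then show ?thesis by (simp add: Ax)
    next
      case False
      have "(\<Prod>j\<in>UNIV - {i}. A x $ j $ p j) = 0" for i
      proof -
        have "\<exists>j. j \<noteq> i \<and> p j \<noteq> j"
        proof (rule ccontr)
          assume *: "\<nexists>j. j \<noteq> i \<and> p j \<noteq> j"
          have "p i = i"
          proof (rule ccontr)
            assume "p i \<noteq> i"
            then have "p (p i) = p i" using * by auto
            then have "p i = i" using permutes_inj[of p UNIV] p by (auto dest: injD)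
            then show False using \<open>p i \<noteq> i\<close> by simp
          qed
          then have "p = id" using * by (auto simp: fun_eq_iff)
          then show False using False by simp
        qed
        then obtain j where "j \<noteq> i" "p j \<noteq> j" by blast
        then show ?thesis by (intro prod_zero) (auto simp: Ax intro!: bexI[of _ j])
      qed
      with False show ?thesis by (simp only: mult_zero_right sum.neutral_const if_False)
    qed
  qed
  also have "\<dots> = (\<lambda>v. \<Sum>i\<in>UNIV. A' i i v)"
    by (simp add: sum.delta permutes_id)
  finally show ?thesis .
qed

lemma matrix_inv_invertible:
  fixes A :: "real^'n^'n"
  assumes "invertible A"
  shows "A ** matrix_inv A = mat 1" "matrix_inv A ** A = mat 1"
  using someI_ex[OF assms[unfolded invertible_def]] by (simp_all add: matrix_inv_def)

text \<open>Jacobi's formula: multiplication by the inverse matrix reduces it to the identity matrix.\<close>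

lemma has_derivative_det:
  fixes A :: "'a::real_normed_vector \<Rightarrow> real^'n^'n"
  assumes A: "\<And>i j. ((\<lambda>x. A x $ i $ j) has_derivative A' i j) (at x)" and nz: "det (A x) \<noteq> 0"
  shows "((\<lambda>x. det (A x)) has_derivative
    (\<lambda>v. det (A x) * (\<Sum>i\<in>UNIV. \<Sum>j\<in>UNIV. matrix_inv (A x) $ i $ j * A' j i v))) (at x)"
proof -
  let ?B = "matrix_inv (A x)"
  have inv: "invertible (A x)" using nz by (simp add: invertible_det_nz)
  have BA: "?B ** A x = mat 1" "A x ** ?B = mat 1"
    using matrix_inv_invertible[OF inv] by blast+
  have "det (A x) * det ?B = 1"
    using BA(2) by (metis det_I det_mul)
  then have eq: "(\<lambda>y. det (A y)) = (\<lambda>y. det (A x) * det (?B ** A y))"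
    by (simp add: det_mul fun_eq_iff mult.assoc[symmetric])
  have "((\<lambda>y. det (?B ** A y)) has_derivative
      (\<lambda>v. \<Sum>i\<in>UNIV. \<Sum>j\<in>UNIV. ?B $ i $ j * A' j i v)) (at x)"
  proof (rule has_derivative_det_at_mat_1[where A'="\<lambda>i j v. \<Sum>k\<in>UNIV. ?B $ i $ k * A' k j v"])
    show "((\<lambda>y. (?B ** A y) $ i $ j) has_derivative (\<lambda>v. \<Sum>k\<in>UNIV. ?B $ i $ k * A' k j v)) (at x)"
      for i j
      by (simp add: matrix_matrix_mult_def) (intro has_derivative_sum has_derivative_mult_right A)
  qed (rule BA)
  from has_derivative_mult_right[OF this, of "det (A x)"] show ?thesis
    by (subst eq)
qed

text \<open>Two applications of the mean value theorem turn the second difference quotient into a value of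
  the mixed derivative at a nearby point. The quotient is symmetric in \<open>u\<close> and \<open>v\<close>; that is why
  the two mixed derivatives agree.\<close>

lemma second_difference_limit:
  fixes f :: "'a::real_normed_vector \<Rightarrow> real"
  assumes W: "open W" "x \<in> W"
    and f: "\<And>y. y \<in> W \<Longrightarrow> (f has_derivative f' y) (at y)"
    and fu: "\<And>y. y \<in> W \<Longrightarrow> ((\<lambda>z. f' z u) has_derivative fu y) (at y)"
    and cont: "continuous_on W (\<lambda>y. fu y v)"
  shows "((\<lambda>t. (f (x + t *\<^sub>R u + t *\<^sub>R v) - f (x + t *\<^sub>R u) - f (x + t *\<^sub>R v) + f x) / t\<^sup>2)
    \<longlongrightarrow> fu x v) (at_right 0)"
proof (rule tendstoI)
  fix e :: real assume e: "e > 0"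
  have "\<forall>\<^sub>F y in nhds x. y \<in> W \<and> dist (fu y v) (fu x v) < e"
  proof (rule eventually_conj)
    show "\<forall>\<^sub>F y in nhds x. y \<in> W" using W by (rule eventually_nhds_in_open)
    have "isCont (\<lambda>y. fu y v) x" using cont W by (simp add: continuous_on_eq_continuous_at)
    then have "((\<lambda>y. fu y v) \<longlongrightarrow> fu x v) (nhds x)" by (simp add: isCont_def tendsto_nhds_iff)
    then show "\<forall>\<^sub>F y in nhds x. dist (fu y v) (fu x v) < e" using e by (rule tendstoD)
  qed
  then obtain d where d: "d > 0" "\<And>y. dist y x < d \<Longrightarrow> y \<in> W \<and> dist (fu y v) (fu x v) < e"
    by (auto simp: eventually_nhds_metric)
  let ?b = "norm u + norm v + 1"
  have near: "x + s *\<^sub>R u + r *\<^sub>R v \<in> W \<and> dist (fu (x + s *\<^sub>R u + r *\<^sub>R v) v) (fu x v) < e"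
    if "0 \<le> s" "s \<le> t" "0 \<le> r" "r \<le> t" "t < d / ?b" for s r t
  proof -
    have "dist (x + s *\<^sub>R u + r *\<^sub>R v) x \<le> s * norm u + r * norm v"
      using norm_triangle_ineq[of "s *\<^sub>R u" "r *\<^sub>R v"] that by (simp add: dist_norm add.assoc)
    also have "\<dots> \<le> t * norm u + t * norm v"
      using that by (intro add_mono mult_right_mono) auto
    also have "\<dots> \<le> t * ?b" using that by (simp add: algebra_simps)
    also have "\<dots> < d"
    proof -
      have "0 < ?b" by (smt (verit) norm_ge_zero)
      then show ?thesis using that(5) by (simp add: pos_less_divide_eq)
    qed
    finally show ?thesis using d(2) by blast
  qed
  have "dist ((f (x + t *\<^sub>R u + t *\<^sub>R v) - f (x + t *\<^sub>R u) - f (x + t *\<^sub>R v) + f x) / t\<^sup>2) (fu x v) < e"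
    if t: "0 < t" "t < d / ?b" for t
  proof -
    let ?p = "\<lambda>s. f (x + s *\<^sub>R u + t *\<^sub>R v) - f (x + s *\<^sub>R u)"
    let ?p' = "\<lambda>s. f' (x + s *\<^sub>R u + t *\<^sub>R v) u - f' (x + s *\<^sub>R u) u"
    have lin: "f' y (k *\<^sub>R u) = k * f' y u" "fu y (k *\<^sub>R v) = k * fu y v" if "y \<in> W" for y k
      using f[OF that] fu[OF that]
      by (auto dest!: has_derivative_bounded_linear simp: bounded_linear.linear linear_cmul)
    have "(?p has_real_derivative ?p' s) (at s)" if "0 \<le> s" "s \<le> t" for s
    proof -
      have W1: "x + s *\<^sub>R u + t *\<^sub>R v \<in> W" and W2: "x + s *\<^sub>R u \<in> W"
        using near[of s t t] near[of s t 0] that t by auto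
      have "((\<lambda>s. x + s *\<^sub>R u + t *\<^sub>R v) has_derivative (\<lambda>k. k *\<^sub>R u)) (at s)"
        "((\<lambda>s. x + s *\<^sub>R u) has_derivative (\<lambda>k. k *\<^sub>R u)) (at s)"
        by (auto intro!: derivative_eq_intros)
      from has_derivative_diff[OF has_derivative_compose[OF this(1) f[OF W1]]
          has_derivative_compose[OF this(2) f[OF W2]]]
      moreover have "(\<lambda>k. f' (x + s *\<^sub>R u + t *\<^sub>R v) (k *\<^sub>R u) - f' (x + s *\<^sub>R u) (k *\<^sub>R u)) = (*) (?p' s)"
        by (simp only: lin[OF W1] lin[OF W2] fun_eq_iff real_scaleR_def)
          (simp add: algebra_simps)
      ultimately show ?thesis by (simp add: has_field_derivative_def)
    qed
    then obtain s where s: "0 < s" "s < t" "?p t - ?p 0 = (t - 0) * ?p' s"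
      using MVT2[of 0 t ?p ?p'] t by auto
    let ?q = "\<lambda>r. f' (x + s *\<^sub>R u + r *\<^sub>R v) u"
    have "(?q has_real_derivative fu (x + s *\<^sub>R u + r *\<^sub>R v) v) (at r)" if "0 \<le> r" "r \<le> t" for r
    proof -
      have W1: "x + s *\<^sub>R u + r *\<^sub>R v \<in> W"
        using near[of s t r] that t s by auto
      have "((\<lambda>r. x + s *\<^sub>R u + r *\<^sub>R v) has_derivative (\<lambda>k. k *\<^sub>R v)) (at r)"
        by (auto intro!: derivative_eq_intros)
      from has_derivative_compose[OF this fu[OF W1]]
      moreover have "(\<lambda>k. fu (x + s *\<^sub>R u + r *\<^sub>R v) (k *\<^sub>R v)) = (*) (fu (x + s *\<^sub>R u + r *\<^sub>R v) v)"
        by (simp only: lin[OF W1] fun_eq_iff) (simp add: mult.commute)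
      ultimately show ?thesis by (simp add: has_field_derivative_def)
    qed
    then obtain r where r: "0 < r" "r < t" "?q t - ?q 0 = (t - 0) * fu (x + s *\<^sub>R u + r *\<^sub>R v) v"
      using MVT2[of 0 t ?q "\<lambda>r. fu (x + s *\<^sub>R u + r *\<^sub>R v) v"] t by auto
    have "(f (x + t *\<^sub>R u + t *\<^sub>R v) - f (x + t *\<^sub>R u) - f (x + t *\<^sub>R v) + f x) / t\<^sup>2
        = fu (x + s *\<^sub>R u + r *\<^sub>R v) v"
      using s(3) r(3) t(1) by (simp add: power2_eq_square field_simps)
    then show ?thesis using near[of s t r] s r t by auto
  qed
  then show "\<forall>\<^sub>F t in at_right 0. dist ((f (x + t *\<^sub>R u + t *\<^sub>R v) - f (x + t *\<^sub>R u)
      - f (x + t *\<^sub>R v) + f x) / t\<^sup>2) (fu x v) < e"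
    using d(1) by (intro eventually_at_rightI[of 0 "d / ?b"]) (auto intro!: divide_pos_pos add_nonneg_pos)
qed

lemma second_derivative_symmetric_real:
  fixes f :: "'a::real_normed_vector \<Rightarrow> real"
  assumes W: "open W" "x \<in> W"
    and f: "\<And>y. y \<in> W \<Longrightarrow> (f has_derivative f' y) (at y)"
    and fu: "\<And>y. y \<in> W \<Longrightarrow> ((\<lambda>z. f' z u) has_derivative fu y) (at y)"
    and fv: "\<And>y. y \<in> W \<Longrightarrow> ((\<lambda>z. f' z v) has_derivative fv y) (at y)"
    and cont: "continuous_on W (\<lambda>y. fu y v)" "continuous_on W (\<lambda>y. fv y u)"
  shows "fu x v = fv x u"
proof (rule tendsto_unique)
  show "((\<lambda>t. (f (x + t *\<^sub>R u + t *\<^sub>R v) - f (x + t *\<^sub>R u) - f (x + t *\<^sub>R v) + f x) / t\<^sup>2)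
    \<longlongrightarrow> fu x v) (at_right 0)"
    by (rule second_difference_limit) (use assms in auto)
  have "((\<lambda>t. (f (x + t *\<^sub>R v + t *\<^sub>R u) - f (x + t *\<^sub>R v) - f (x + t *\<^sub>R u) + f x) / t\<^sup>2)
    \<longlongrightarrow> fv x u) (at_right 0)"
    by (rule second_difference_limit) (use assms in auto)
  then show "((\<lambda>t. (f (x + t *\<^sub>R u + t *\<^sub>R v) - f (x + t *\<^sub>R u) - f (x + t *\<^sub>R v) + f x) / t\<^sup>2)
    \<longlongrightarrow> fv x u) (at_right 0)"
    by (rule Lim_transform_eventually) (auto simp: algebra_simps)
qed simp

lemma second_derivative_symmetric:
  fixes f :: "'a::real_normed_vector \<Rightarrow> 'b::euclidean_space"
  assumes "open W" "x \<in> W" and f: "C1_on W f"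
    and C2: "\<And>w. C1_on W (\<lambda>y. frechet_derivative f (at y) w)"
  shows "frechet_derivative (\<lambda>y. frechet_derivative f (at y) u) (at x) v
    = frechet_derivative (\<lambda>y. frechet_derivative f (at y) v) (at x) u"
proof (rule euclidean_eqI)
  fix b :: 'b
  show "frechet_derivative (\<lambda>y. frechet_derivative f (at y) u) (at x) v \<bullet> b
    = frechet_derivative (\<lambda>y. frechet_derivative f (at y) v) (at x) u \<bullet> b"
    by (rule second_derivative_symmetric_real[where W=W and f="\<lambda>y. f y \<bullet> b"
          and f'="\<lambda>y w. frechet_derivative f (at y) w \<bullet> b"
          and fu="\<lambda>y w. frechet_derivative (\<lambda>y. frechet_derivative f (at y) u) (at y) w \<bullet> b"
          and fv="\<lambda>y w. frechet_derivative (\<lambda>y. frechet_derivative f (at y) v) (at y) w \<bullet> b"])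
      (use assms(1,2) C2 in \<open>auto intro!: has_derivative_inner_left C1_on_has_derivative[OF f]
        C1_on_has_derivative[OF C2] continuous_intros simp: C1_on_def\<close>)
qed


section \<open>Change of variables for nonnegative functions\<close>

lemma det_reindex:
  fixes A :: "real^'n^'n" and r :: "'m::finite \<Rightarrow> 'n::finite"
  assumes "bij r"
  shows "det (\<chi> i j. A $ r i $ r j) = det A"
proof -
  let ?P = "{p. p permutes (UNIV::'m set)}" and ?Q = "{p. p permutes (UNIV::'n set)}"
  have inj: "inj_on r UNIV" using assms by (simp add: bij_is_inj)
  have rr: "r (inv r x) = x" "inv r (r y) = y" for x y
    using assms by (simp_all add: bij_is_inj bij_is_surj surj_f_inv_f)
  have mp: "map_permutation UNIV r p = r \<circ> p \<circ> inv r" for p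
    using assms by (auto simp: map_permutation_def restrict_id_def bij_is_surj inj fun_eq_iff)
  have bij: "bij_betw (\<lambda>p. r \<circ> p \<circ> inv r) ?P ?Q"
  proof (rule bij_betwI[where g="\<lambda>q. inv r \<circ> q \<circ> r"])
    show "(\<lambda>p. r \<circ> p \<circ> inv r) \<in> ?P \<rightarrow> ?Q"
      using assms by (auto simp: permutes_univ bij_iff o_def) (metis rr)+
    show "(\<lambda>q. inv r \<circ> q \<circ> r) \<in> ?Q \<rightarrow> ?P"
      using assms by (auto simp: permutes_univ bij_iff o_def) (metis rr)+
  qed (auto simp: rr fun_eq_iff)
  have "det A = (\<Sum>p\<in>?P. of_int (sign (r \<circ> p \<circ> inv r)) *
      (\<Prod>i\<in>UNIV. A $ i $ (r \<circ> p \<circ> inv r) i))"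
    unfolding det_def by (rule sum.reindex_bij_betw[OF bij, symmetric])
  also have "\<dots> = (\<Sum>p\<in>?P. of_int (sign p) * (\<Prod>i\<in>UNIV. A $ r i $ r (p i)))"
  proof (rule sum.cong)
    fix p assume p: "p \<in> ?P"
    have "sign (r \<circ> p \<circ> inv r) = sign p"
      using sign_map_permutation[of r UNIV p] p inj by (simp add: mp)
    moreover have "(\<Prod>i\<in>UNIV. A $ i $ (r \<circ> p \<circ> inv r) i) = (\<Prod>i\<in>UNIV. A $ r i $ r (p i))"
      using prod.reindex_bij_betw[OF assms, of "\<lambda>i. A $ i $ (r \<circ> p \<circ> inv r) i"]
      by (simp add: rr)
    ultimately show "of_int (sign (r \<circ> p \<circ> inv r)) * (\<Prod>i\<in>UNIV. A $ i $ (r \<circ> p \<circ> inv r) i)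
        = of_int (sign p) * (\<Prod>i\<in>UNIV. A $ r i $ r (p i))" by simp
  qed simp
  finally show ?thesis by (simp add: det_def)
qed

text \<open>The change of variables formula rests on elimination with elementary matrices, which runs through
  the indices in a fixed order. This type provides, for any finite type, a well-ordered one of the
  same size.\<close>

typedef 'n ordered_index = "{..<CARD('n::finite)}"
  by (rule exI[of _ 0]) simp

instance ordered_index :: (finite) finite
proof
  show "finite (UNIV :: 'a ordered_index set)"
    by (rule finite_imageD[of Rep_ordered_index])
      (auto intro: finite_subset[of _ "{..<CARD('a)}"] Rep_ordered_index[simplified] inj_onI
        simp: Rep_ordered_index_inject)
qed

instantiation ordered_index :: (finite) wellorder
begin

definition less_eq_ordered_index :: "'a ordered_index \<Rightarrow> 'a ordered_index \<Rightarrow> bool"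
  where "less_eq_ordered_index a b \<longleftrightarrow> Rep_ordered_index a \<le> Rep_ordered_index b"

definition less_ordered_index :: "'a ordered_index \<Rightarrow> 'a ordered_index \<Rightarrow> bool"
  where "less_ordered_index a b \<longleftrightarrow> Rep_ordered_index a < Rep_ordered_index b"

instance
proof
  fix P :: "'a ordered_index \<Rightarrow> bool" and a
  assume step: "\<And>x. (\<And>y. y < x \<Longrightarrow> P y) \<Longrightarrow> P x"
  show "P a"
  proof (induction "Rep_ordered_index a" arbitrary: a rule: less_induct)
    case less
    show ?case by (rule step) (auto intro: less simp: less_ordered_index_def)
  qed
qed (auto simp: less_eq_ordered_index_def less_ordered_index_def Rep_ordered_index_inject)

end

lemma ordered_index_bij: "\<exists>r :: 'n::finite ordered_index \<Rightarrow> 'n. bij r"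
proof -
  interpret type_definition "Rep_ordered_index :: 'n ordered_index \<Rightarrow> nat" Abs_ordered_index
      "{..<CARD('n)}"
    by (rule type_definition_ordered_index)
  have "CARD('n ordered_index) = CARD('n)"
    by (simp add: card)
  then show ?thesis
    using finite_same_card_bij[of "UNIV :: 'n ordered_index set" "UNIV :: 'n set"] by auto
qed

text \<open>The image is exhausted by sets on which \<open>f\<close> and the norm are bounded; there \<open>f\<close> is integrable
  and the formula for absolutely integrable functions applies. Monotone convergence gives the
  general case, in which the integrals may be infinite. The function \<open>q\<close> stands for
  \<open>|det g'| f \<circ> g\<close>, so that its measurability is a hypothesis about \<open>q\<close> and not about \<open>g'\<close>.\<close>

lemma nn_integral_change_of_variables_wellorder:
  fixes g :: "(real, 'm::{finite,wellorder}) vec \<Rightarrow> (real, 'm) vec" and f q :: "(real, 'm) vec \<Rightarrow> real"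
  assumes S: "S \<in> sets borel" and gS: "g ` S \<in> sets borel"
    and der: "\<And>x. x \<in> S \<Longrightarrow> (g has_derivative g' x) (at x within S)"
    and inj: "inj_on g S"
    and f: "f \<in> borel_measurable (restrict_space borel (g ` S))"
    and q: "q \<in> borel_measurable (restrict_space borel S)"
    and nonneg: "\<And>y. y \<in> g ` S \<Longrightarrow> 0 \<le> f y"
    and eq: "\<And>x. x \<in> S \<Longrightarrow> q x = \<bar>det (matrix (g' x))\<bar> * f (g x)"
  shows "(\<integral>\<^sup>+x\<in>S. ennreal (q x) \<partial>lborel) = (\<integral>\<^sup>+y\<in>g ` S. ennreal (f y) \<partial>lborel)"
proof -
  have cg: "continuous_on S g"
    using der by (auto simp: continuous_on_eq_continuous_within intro: has_derivative_continuous)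
  then have mg: "g \<in> borel_measurable (restrict_space borel S)"
    by (rule borel_measurable_continuous_on_restrict)
  have mfg: "(\<lambda>x. f (g x)) \<in> borel_measurable (restrict_space borel S)"
  proof (rule measurable_compose[OF _ f])
    show "g \<in> restrict_space borel S \<rightarrow>\<^sub>M restrict_space borel (g ` S)"
      by (rule measurable_restrict_space2[OF _ mg]) (auto simp: space_restrict_space)
  qed
  define Sm where "Sm m = {x \<in> S. f (g x) \<le> real m \<and> norm (g x) \<le> real m}" for m :: nat
  define Tm where "Tm m = {y \<in> g ` S. f y \<le> real m \<and> norm y \<le> real m}" for m :: nat
  have gSm: "g ` Sm m = Tm m" for m by (auto simp: Sm_def Tm_def)
  have Sm: "Sm m \<in> sets borel" for m
  proof -
    have "{x \<in> space (restrict_space borel S). f (g x) \<le> real m \<and> norm (g x) \<le> real m}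
        \<in> sets (restrict_space borel S)"
      using mfg mg by measurable
    then show ?thesis
      using S by (simp add: Sm_def space_restrict_space sets_restrict_space_iff)
  qed
  have Tm: "Tm m \<in> sets borel" for m
  proof -
    have "{x \<in> space (restrict_space borel (g ` S)). f x \<le> real m \<and> norm x \<le> real m}
        \<in> sets (restrict_space borel (g ` S))"
      using f measurable_restrict_space1[OF measurable_ident_sets[OF refl], of borel "g ` S"]
      by measurable
    then show ?thesis
      using gS by (simp add: Tm_def space_restrict_space sets_restrict_space_iff)
  qed
  have piece: "(\<integral>\<^sup>+x\<in>Sm m. ennreal (q x) \<partial>lborel) = (\<integral>\<^sup>+y\<in>Tm m. ennreal (f y) \<partial>lborel)" for m
  proof -
    have bd: "bounded (Tm m)" by (auto simp: Tm_def bounded_iff)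
    have "f \<in> borel_measurable (restrict_space borel (Tm m))"
      by (rule measurable_restrict_mono[OF f]) (auto simp: Tm_def)
    then have set_borel: "(\<lambda>y. indicator (Tm m) y *\<^sub>R f y) \<in> borel_measurable lborel"
      using Tm[of m] by (simp add: borel_measurable_restrict_space_iff)
    have "integrable lborel (\<lambda>y. indicator (Tm m) y *\<^sub>R f y)"
    proof (rule integrableI_bounded_set[where A="Tm m" and B="real m"])
      show "emeasure lborel (Tm m) < \<infinity>"
        using emeasure_bounded_finite[OF bd] by (simp add: less_top)
    qed (use Tm nonneg set_borel in \<open>auto simp: Tm_def indicator_def split: if_splits\<close>)
    then have "integrable lebesgue (\<lambda>y. indicator (Tm m) y *\<^sub>R f y)"
      by (simp add: integrable_completion set_borel)
    then have ai: "f absolutely_integrable_on (Tm m)"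
      by (simp add: set_integrable_def)
    then have aiv: "(\<lambda>y. vec (f y) :: real^1) absolutely_integrable_on (g ` Sm m)"
      unfolding gSm by (simp add: absolutely_integrable_on_1_iff)
    have "(\<lambda>x. \<bar>det (matrix (g' x))\<bar> *\<^sub>R (vec (f (g x)) :: real^1)) absolutely_integrable_on (Sm m)
        \<and> integral (Sm m) (\<lambda>x. \<bar>det (matrix (g' x))\<bar> *\<^sub>R (vec (f (g x)) :: real^1)) = integral (g ` Sm m) (\<lambda>y. vec (f y))"
    proof (subst has_absolute_integral_change_of_variables)
      show "Sm m \<in> sets lebesgue" using Sm by simp
      show "(g has_derivative g' x) (at x within Sm m)" if "x \<in> Sm m" for x
        using that by (intro has_derivative_subset[OF der]) (auto simp: Sm_def)
      show "inj_on g (Sm m)" by (rule inj_on_subset[OF inj]) (auto simp: Sm_def)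
    qed (use aiv in simp)
    then have aiq: "(\<lambda>x. \<bar>det (matrix (g' x))\<bar> *\<^sub>R (vec (f (g x)) :: real^1)) absolutely_integrable_on (Sm m)"
      and iq: "integral (Sm m) (\<lambda>x. \<bar>det (matrix (g' x))\<bar> *\<^sub>R (vec (f (g x)) :: real^1)) = integral (Tm m) (\<lambda>y. vec (f y))"
      by (auto simp: gSm)
    have eqv: "\<bar>det (matrix (g' x))\<bar> *\<^sub>R (vec (f (g x)) :: real^1) = vec (q x)" if "x \<in> Sm m" for x
      using eq[of x] that by (simp add: Sm_def vec_eq_iff)
    have "(q has_integral integral (Tm m) f) (Sm m)"
    proof -
      have "((\<lambda>x. \<bar>det (matrix (g' x))\<bar> *\<^sub>R (vec (f (g x)) :: real^1)) has_integral
          integral (Tm m) (\<lambda>y. vec (f y))) (Sm m)"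
        using set_lebesgue_integral_eq_integral(1)[OF aiq] iq by (simp add: has_integral_integrable_integral)
      then have 1: "((\<lambda>x. vec (q x) :: real^1) has_integral integral (Tm m) (\<lambda>y. vec (f y))) (Sm m)"
        by (rule has_integral_eq[rotated]) (rule eqv)
      have "(f has_integral integral (Tm m) f) (Tm m)"
        using set_lebesgue_integral_eq_integral(1)[OF ai] by (simp add: integrable_integral)
      then have "((\<lambda>y. vec (f y) :: real^1) has_integral vec (integral (Tm m) f)) (Tm m)"
        by (simp add: has_integral_componentwise_iff[where 'b="real^1"] Basis_vec_def inner_axis)
      then have "integral (Tm m) (\<lambda>y. vec (f y) :: real^1) = vec (integral (Tm m) f)"
        by (rule integral_unique)
      with 1 show ?thesis
        by (simp add: has_integral_componentwise_iff[where 'b="real^1"] Basis_vec_def inner_axis)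
    qed
    then have "integral\<^sup>N lborel (\<lambda>x. indicator (Sm m) x * q x) = integral (Tm m) f"
      by (intro nn_integral_has_integral_lebesgue) (use eq nonneg in \<open>auto simp: Sm_def\<close>)
    moreover have "integral\<^sup>N lborel (\<lambda>x. indicator (Tm m) x * f x) = integral (Tm m) f"
      by (intro nn_integral_has_integral_lebesgue)
        (use nonneg set_lebesgue_integral_eq_integral(1)[OF ai] in \<open>auto simp: Tm_def integrable_integral\<close>)
    moreover have "ennreal (indicator A x * h x) = ennreal (h x) * indicator A x"
      for A and x :: "(real, 'm) vec" and h :: "(real, 'm) vec \<Rightarrow> real"
      by (auto simp: indicator_def)
    ultimately show ?thesis by simp
  qed
  have mono: "incseq Sm" "incseq Tm"
    by (auto simp: incseq_def Sm_def Tm_def intro: order_trans)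
  have U: "(\<Union>m. Sm m) = S" "(\<Union>m. Tm m) = g ` S"
  proof -
    have *: "\<exists>m::nat. a \<le> real m \<and> b \<le> real m" for a b
      using real_arch_simple[of "max a b"] by auto
    show "(\<Union>m. Sm m) = S" "(\<Union>m. Tm m) = g ` S"
      using * by (auto simp: Sm_def Tm_def)
  qed
  have lim: "(\<lambda>m. \<integral>\<^sup>+x\<in>Am m. ennreal (h x) \<partial>lborel) \<longlonglongrightarrow> (\<integral>\<^sup>+x\<in>(\<Union>m. Am m). ennreal (h x) \<partial>lborel)"
    if "incseq Am" "\<And>m. Am m \<in> sets borel" "h \<in> borel_measurable (restrict_space borel (\<Union>m. Am m))"
    for Am :: "nat \<Rightarrow> ((real, 'm) vec) set" and h :: "(real, 'm) vec \<Rightarrow> real"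
  proof -
    let ?h = "\<lambda>x. ennreal (h x) * indicator (\<Union>m. Am m) x"
    have UA: "(\<Union>m. Am m) \<in> sets borel" using that(2) by auto
    have "(\<lambda>x. indicator (\<Union>m. Am m) x *\<^sub>R h x) \<in> borel_measurable borel"
      using that(3) UA by (subst (asm) borel_measurable_restrict_space_iff) auto
    then have "(\<lambda>x. ennreal (indicator (\<Union>m. Am m) x *\<^sub>R h x)) \<in> borel_measurable borel" by simp
    also have "(\<lambda>x. ennreal (indicator (\<Union>m. Am m) x *\<^sub>R h x)) = ?h"
      by (auto simp: fun_eq_iff indicator_def)
    finally have mh: "?h \<in> borel_measurable lborel" by simp
    have em: "emeasure (density lborel ?h) A = (\<integral>\<^sup>+x\<in>A. ennreal (h x) \<partial>lborel)"
      if A: "A \<subseteq> (\<Union>m. Am m)" "A \<in> sets borel" for A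
      using A mh
      by (subst emeasure_density) (auto intro!: nn_integral_cong simp: indicator_def subset_iff)
    have "(\<lambda>m. emeasure (density lborel ?h) (Am m)) \<longlonglongrightarrow> emeasure (density lborel ?h) (\<Union>m. Am m)"
      by (rule Lim_emeasure_incseq) (use that in auto)
    then show ?thesis using that(2) UA by (subst (asm) (1 2) em) auto
  qed
  show ?thesis
    using LIMSEQ_unique[OF lim[OF mono(1) Sm, of q] lim[OF mono(2) Tm, of f, folded piece]]
    using f q by (simp add: U)
qed


lemma nn_integral_permute_coordinates:
  fixes r :: "'m::finite \<Rightarrow> 'n::finite" and h :: "(real, 'n) vec \<Rightarrow> ennreal"
  assumes r: "bij r" and h: "h \<in> borel_measurable borel"
  shows "(\<integral>\<^sup>+y. h y \<partial>lborel) = (\<integral>\<^sup>+x. h (\<chi> i. x $ inv r i) \<partial>lborel)"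
proof -
  let ?Q = "\<lambda>x :: (real, 'm) vec. (\<chi> i. x $ inv r i) :: (real, 'n) vec"
  have rr: "r (inv r x) = x" "inv r (r y) = y" for x y
    using r by (simp_all add: bij_is_inj bij_is_surj surj_f_inv_f)
  have Q: "?Q \<in> borel_measurable borel"
    by (intro borel_measurable_continuous_onI continuous_intros)
  have prod_axis: "(\<Prod>b\<in>Basis. (u - l) \<bullet> b) = (\<Prod>i\<in>UNIV. u $ i - l $ i)"
    for u l :: "(real, 'k::finite) vec"
  proof -
    have "bij_betw (\<lambda>i. axis i 1 :: (real, 'k) vec) UNIV Basis"
      by (auto simp: bij_betw_def inj_on_def axis_eq_axis Basis_vec_def)
    from prod.reindex_bij_betw[OF this, of "\<lambda>b. (u - l) \<bullet> b"] show ?thesis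
      by (simp add: inner_axis)
  qed
  have "lborel = distr lborel borel ?Q"
  proof (rule lborel_eqI)
    fix l u :: "(real, 'n) vec"
    assume "\<And>b. b \<in> Basis \<Longrightarrow> l \<bullet> b \<le> u \<bullet> b"
    then have le: "l $ i \<le> u $ i" for i
      by (metis axis_in_Basis_iff insertI1 Basis_real_def cart_eq_inner_axis)
    let ?P = "\<lambda>x :: (real, 'n) vec. (\<chi> i. x $ r i) :: (real, 'm) vec"
    have "?Q -` box l u = box (?P l) (?P u)"
      unfolding set_eq_iff vimage_eq mem_box_cart by (simp, metis rr)
    then have "emeasure (distr lborel borel ?Q) (box l u) = emeasure lborel (box (?P l) (?P u))"
      using Q by (subst emeasure_distr) auto
    also have "\<dots> = (\<Prod>b\<in>Basis. (?P u - ?P l) \<bullet> b)"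
      by (rule emeasure_lborel_box) (use le in \<open>auto simp: Basis_vec_def inner_axis\<close>)
    also have "\<dots> = (\<Prod>i\<in>UNIV. u $ r i - l $ r i)"
      by (subst prod_axis) simp
    also have "\<dots> = (\<Prod>i\<in>UNIV. u $ i - l $ i)"
      using prod.reindex_bij_betw[OF r, of "\<lambda>i. u $ i - l $ i"] by simp
    also have "\<dots> = (\<Prod>b\<in>Basis. (u - l) \<bullet> b)" by (rule arg_cong[where f=ennreal, OF prod_axis[symmetric]])
    finally show "emeasure (distr lborel borel ?Q) (box l u) = (\<Prod>b\<in>Basis. (u - l) \<bullet> b)" .
  qed simp
  then have "(\<integral>\<^sup>+y. h y \<partial>lborel) = (\<integral>\<^sup>+y. h y \<partial>distr lborel borel ?Q)" by simp
  also have "\<dots> = (\<integral>\<^sup>+x. h (?Q x) \<partial>lborel)"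
    using Q h by (subst nn_integral_distr) auto
  finally show ?thesis .
qed

proposition nn_integral_change_of_variables:
  fixes g :: "real^'n::finite \<Rightarrow> real^'n" and f q :: "real^'n \<Rightarrow> real"
  assumes S: "S \<in> sets borel" and gS: "g ` S \<in> sets borel"
    and der: "\<And>x. x \<in> S \<Longrightarrow> (g has_derivative g' x) (at x within S)"
    and inj: "inj_on g S"
    and f: "f \<in> borel_measurable (restrict_space borel (g ` S))"
    and q: "q \<in> borel_measurable (restrict_space borel S)"
    and nonneg: "\<And>y. y \<in> g ` S \<Longrightarrow> 0 \<le> f y"
    and eq: "\<And>x. x \<in> S \<Longrightarrow> q x = \<bar>det (matrix (g' x))\<bar> * f (g x)"
  shows "(\<integral>\<^sup>+x\<in>S. ennreal (q x) \<partial>lborel) = (\<integral>\<^sup>+y\<in>g ` S. ennreal (f y) \<partial>lborel)"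
proof -
  obtain r :: "'n ordered_index \<Rightarrow> 'n" where r: "bij r"
    using ordered_index_bij by blast
  have rr: "r (inv r x) = x" "inv r (r y) = y" for x y
    using r by (simp_all add: bij_is_inj bij_is_surj surj_f_inv_f)
  let ?Q = "\<lambda>x :: (real, 'n ordered_index) vec. (\<chi> i. x $ inv r i) :: (real, 'n) vec"
  let ?P = "\<lambda>x :: (real, 'n) vec. (\<chi> i. x $ r i) :: (real, 'n ordered_index) vec"
  have PQ: "?P (?Q x) = x" "?Q (?P y) = y" for x y
    by (simp_all add: vec_eq_iff rr)
  have P_image: "?P ` A = ?Q -` A" for A
    using PQ by (auto simp: image_iff) (metis PQ(1))
  have mQ: "?Q \<in> borel_measurable borel" and mP: "?P \<in> borel_measurable borel"
    by (intro borel_measurable_continuous_onI continuous_intros)+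
  have mPA: "?P ` A \<in> sets borel" if "A \<in> sets borel" for A
    using measurable_sets[OF mQ that] by (simp add: P_image)
  have linQ: "linear ?Q" and linP: "linear ?P"
    by (auto intro!: linearI simp: vec_eq_iff)
  have blQ: "bounded_linear ?Q" and blP: "bounded_linear ?P"
    using linQ linP by (auto simp: linear_conv_bounded_linear)
  have meas: "(\<lambda>y. h (?Q y)) \<in> borel_measurable (restrict_space borel (?P ` A))"
    if "h \<in> borel_measurable (restrict_space borel A)" for h :: "real^'n \<Rightarrow> real" and A
    by (rule measurable_compose[OF measurable_restrict_space2[OF _ measurable_restrict_space1[OF mQ]] that])
      (auto simp: space_restrict_space rr)
  have trans: "(\<integral>\<^sup>+x\<in>A. ennreal (h x) \<partial>lborel) = (\<integral>\<^sup>+x\<in>?P ` A. ennreal (h (?Q x)) \<partial>lborel)"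
    if A: "A \<in> sets borel" and h: "h \<in> borel_measurable (restrict_space borel A)"
    for h :: "real^'n \<Rightarrow> real" and A
  proof -
    have "(\<lambda>x. indicator A x *\<^sub>R h x) \<in> borel_measurable borel"
      using h A by (subst (asm) borel_measurable_restrict_space_iff) auto
    then have "(\<lambda>x. ennreal (indicator A x *\<^sub>R h x)) \<in> borel_measurable borel" by simp
    also have "(\<lambda>x. ennreal (indicator A x *\<^sub>R h x)) = (\<lambda>x. ennreal (h x) * indicator A x)"
      by (auto simp: fun_eq_iff indicator_def)
    finally show ?thesis
      by (subst nn_integral_permute_coordinates[OF r])
        (auto intro!: nn_integral_cong simp: P_image indicator_def rr)
  qed
  let ?g = "\<lambda>x. ?P (g (?Q x))" and ?g' = "\<lambda>x v. ?P (g' (?Q x) (?Q v))"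
  have image: "?g ` (?P ` S) = ?P ` (g ` S)"
    by (simp only: image_image PQ)
  have "(\<integral>\<^sup>+x\<in>?P ` S. ennreal (q (?Q x)) \<partial>lborel)
      = (\<integral>\<^sup>+y\<in>?g ` (?P ` S). ennreal (f (?Q y)) \<partial>lborel)"
  proof (rule nn_integral_change_of_variables_wellorder)
    show "?P ` S \<in> sets borel" "?g ` (?P ` S) \<in> sets borel"
      unfolding image by (intro mPA S gS)+
    show "inj_on ?g (?P ` S)"
    proof (rule inj_onI)
      fix x y assume "x \<in> ?P ` S" "y \<in> ?P ` S" and xy: "?g x = ?g y"
      then obtain a b where ab: "a \<in> S" "b \<in> S" "x = ?P a" "y = ?P b" by auto
      have "g a = g b" using arg_cong[OF xy, of ?Q] by (simp only: PQ ab)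
      then show "x = y" using inj ab by (auto dest: inj_onD)
    qed
    show "(\<lambda>y. f (?Q y)) \<in> borel_measurable (restrict_space borel (?g ` (?P ` S)))"
      unfolding image by (rule meas[OF f])
    show "(\<lambda>y. q (?Q y)) \<in> borel_measurable (restrict_space borel (?P ` S))"
      by (rule meas[OF q])
    show "0 \<le> f (?Q y)" if "y \<in> ?g ` (?P ` S)" for y
      using that nonneg unfolding image by (auto simp: rr)
    fix x assume "x \<in> ?P ` S"
    then obtain a where a: "a \<in> S" "x = ?P a" by auto
    have Qx: "?Q x = a" by (simp only: a PQ)
    have QPS: "?Q ` (?P ` S) = S" by (simp only: image_image PQ image_ident)
    have 1: "(?Q has_derivative ?Q) (at x within ?P ` S)"
      by (rule bounded_linear.has_derivative[OF blQ]) (rule has_derivative_ident)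
    have "((\<lambda>x. g (?Q x)) has_derivative (\<lambda>v. g' (?Q x) (?Q v))) (at x within ?P ` S)"
      by (rule has_derivative_in_compose[OF 1]) (simp only: QPS Qx der[OF a(1)])
    from bounded_linear.has_derivative[OF blP this]
    show "(?g has_derivative ?g' x) (at x within ?P ` S)" .
    have "matrix (?g' x) = (\<chi> i j. matrix (g' a) $ r i $ r j)"
    proof -
      have "?Q (axis j 1) = axis (r j) 1" for j
        by (auto simp: vec_eq_iff axis_def rr)
      then show ?thesis by (simp add: vec_eq_iff matrix_def Qx)
    qed
    then show "q (?Q x) = \<bar>det (matrix (?g' x))\<bar> * f (?Q (?g x))"
      by (simp only: det_reindex[OF r] Qx PQ eq[OF a(1)])
  qed
  then show ?thesis
    by (simp only: trans[OF S q] trans[OF gS f] image)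
qed


section \<open>Integrals of partial derivatives over a half-space\<close>

text \<open>By translation invariance all difference quotients of \<open>u\<close> in direction \<open>e\<close> have integral zero.
  The Lipschitz bound and the bounded support dominate them.\<close>

lemma integral_directional_derivative_eq_0:
  fixes u d :: "'a::euclidean_space \<Rightarrow> real" and e :: 'a
  assumes u: "u \<in> borel_measurable borel"
    and bd: "\<And>x. \<bar>u x\<bar> \<le> B"
    and supp: "\<And>x. u x \<noteq> 0 \<Longrightarrow> norm x \<le> R"
    and lip: "\<And>x t. 0 \<le> t \<Longrightarrow> \<bar>u (x + t *\<^sub>R e) - u x\<bar> \<le> L * t"
    and d: "d \<in> borel_measurable borel"
    and lim: "AE x in lborel. (\<lambda>m. real (Suc m) * (u (x + inverse (real (Suc m)) *\<^sub>R e) - u x)) \<longlonglongrightarrow> d x"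
  shows "has_bochner_integral lborel d 0"
proof -
  have iu: "integrable lborel u"
  proof (rule integrableI_bounded_set[where A="cball 0 R" and B=B])
    show "emeasure lborel (cball 0 R :: 'a set) < \<infinity>"
      using emeasure_bounded_finite[OF bounded_cball] by (simp add: less_top)
  qed (use u bd supp in auto)
  let ?w = "\<lambda>x::'a. L * indicator (cball 0 (R + norm e)) x :: real"
  let ?s = "\<lambda>m x. real (Suc m) * (u (x + inverse (real (Suc m)) *\<^sub>R e) - u x)"
  have shift: "integrable lborel (\<lambda>x. u (x + t *\<^sub>R e))"
    "integral\<^sup>L lborel (\<lambda>x. u (x + t *\<^sub>R e)) = integral\<^sup>L lborel u" for t
  proof -
    have "(\<lambda>x. u (x + t *\<^sub>R e)) = (\<lambda>x. u (((+) (t *\<^sub>R e)) x))" by (simp add: add.commute)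
    moreover have "integrable (distr lborel borel ((+) (t *\<^sub>R e))) u"
      "integral\<^sup>L (distr lborel borel ((+) (t *\<^sub>R e))) u = integral\<^sup>L lborel u"
      using iu by (simp_all add: lborel_distr_plus)
    ultimately show "integrable lborel (\<lambda>x. u (x + t *\<^sub>R e))"
      "integral\<^sup>L lborel (\<lambda>x. u (x + t *\<^sub>R e)) = integral\<^sup>L lborel u"
      using u by (simp_all add: integrable_distr_eq integral_distr)
  qed
  have s0: "integral\<^sup>L lborel (?s m) = 0" for m
    by (simp add: Bochner_Integration.integral_diff[OF shift(1) iu] shift(2))
  have sm: "?s m \<in> borel_measurable lborel" for m
    using u by measurable
  have w: "integrable lborel ?w"
    using emeasure_bounded_finite[OF bounded_cball[of "0::'a" "R + norm e"]]
    by (intro integrable_mult_right integrable_real_indicator) (auto simp: less_top)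
  have dom: "norm (?s m x) \<le> ?w x" for m x
  proof (cases "x \<in> cball 0 (R + norm e)")
    case True
    have "\<bar>?s m x\<bar> = real (Suc m) * \<bar>u (x + inverse (real (Suc m)) *\<^sub>R e) - u x\<bar>"
      by (simp add: abs_mult)
    also have "\<dots> \<le> real (Suc m) * (L * inverse (real (Suc m)))"
      by (intro mult_left_mono lip) auto
    also have "\<dots> = L" by (simp add: field_simps del: of_nat_Suc)
    finally show ?thesis using True by simp
  next
    case False
    then have far: "norm x > R + norm e" by simp
    let ?y = "x + inverse (real (Suc m)) *\<^sub>R e"
    have "norm (inverse (real (Suc m)) *\<^sub>R e) \<le> norm e"
      by (simp add: divide_simps mult_le_cancel_left1 del: of_nat_Suc)
    then have "norm ?y > R"
      using far norm_diff_ineq[of x "inverse (real (Suc m)) *\<^sub>R e"] by linarith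
    then have "u ?y = 0" using supp[of ?y] by force
    moreover have "u x = 0" using supp[of x] far norm_ge_zero[of e] by force
    ultimately show ?thesis using False by simp
  qed
  have dm: "d \<in> borel_measurable lborel" using d by simp
  have dom': "AE x in lborel. norm (?s m x) \<le> ?w x" for m
    using dom by (intro AE_I2)
  have "integrable lborel d" "(\<lambda>m. integral\<^sup>L lborel (?s m)) \<longlonglongrightarrow> integral\<^sup>L lborel d"
    by (rule integrable_dominated_convergence[OF dm sm w lim dom'],
        rule integral_dominated_convergence[OF dm sm w lim dom'])
  moreover from this(2) have "integral\<^sup>L lborel d = 0"
    unfolding s0 by (simp add: LIMSEQ_const_iff)
  ultimately show ?thesis by (simp add: has_bochner_integral_iff)
qed

lemma AE_off_hyperplane: "AE x::real^'n::finite in lborel. x $ k \<noteq> 0"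
proof -
  have "{x::real^'n. x $ k = 0} = {x. axis k 1 \<bullet> x = 0}"
    by (simp add: inner_commute[of "axis k 1"] inner_axis)
  then have "negligible {x::real^'n. x $ k = 0}"
    using negligible_hyperplane[of "axis k 1 :: real^'n" 0] by (simp add: axis_eq_0_iff)
  moreover have "closed {x::real^'n. x $ k = 0}"
    by (intro closed_Collect_eq continuous_intros)
  ultimately have "{x::real^'n. x $ k = 0} \<in> null_sets lborel"
    by (simp add: negligible_iff_null_sets null_sets_completion_iff borel_closed)
  then show ?thesis by (intro AE_I'[of "{x::real^'n. x $ k = 0}"]) auto
qed

text \<open>The function is extended by zero beyond the half-space. In a direction parallel to the hyperplane
  the extension is Lipschitz because each line stays on one side; in the transversal direction it is
  Lipschitz because \<open>u\<close> vanishes where the line crosses the hyperplane.\<close>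

lemma integral_partial_derivative_half_space_eq_0:
  fixes u d :: "real^'n::finite \<Rightarrow> real"
  assumes K: "compact K" and supp: "\<And>x. x \<in> half_space k \<Longrightarrow> x \<notin> K \<Longrightarrow> u x = 0"
    and cont: "continuous_on (half_space k) u"
    and boundary: "\<And>x. i = k \<Longrightarrow> x $ k = 0 \<Longrightarrow> u x = 0"
    and deriv: "\<And>x. 0 < x $ k \<Longrightarrow> ((\<lambda>t. u (x + t *\<^sub>R axis i 1)) has_real_derivative d x) (at 0)"
    and bd: "\<And>x. 0 < x $ k \<Longrightarrow> \<bar>d x\<bar> \<le> L"
  shows "has_bochner_integral lborel (\<lambda>x. indicator {x. 0 < x $ k} x * d x) 0"
proof -
  let ?e = "axis i 1 :: real^'n"
  define v where "v = (\<lambda>x. if x \<in> half_space k then u x else 0)"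
  define D where "D = (\<lambda>x. indicator {x. 0 < x $ k} x * d x)"
  have ek: "?e $ k = (if i = k then 1 else 0)" by (simp add: axis_def)
  have closed: "closed (half_space k)"
    unfolding half_space_def by (intro closed_Collect_le continuous_intros)
  have "L \<ge> 0" using bd[of "axis k 1"] by (auto simp: axis_def)
  have v_off: "v x = 0" if "x \<notin> K" for x using that supp by (auto simp: v_def)
  have v_meas: "v \<in> borel_measurable borel"
  proof -
    have "(\<lambda>x. indicator (half_space k) x *\<^sub>R u x) \<in> borel_measurable borel"
      using closed cont by (intro borel_measurable_continuous_on_indicator) auto
    also have "(\<lambda>x. indicator (half_space k) x *\<^sub>R u x) = v"
      by (auto simp: v_def fun_eq_iff indicator_def)
    finally show ?thesis .
  qed
  have "compact (K \<inter> half_space k)" using K closed by (rule compact_Int_closed)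
  then have "bounded (u ` (K \<inter> half_space k))"
    by (intro compact_imp_bounded compact_continuous_image continuous_on_subset[OF cont]) auto
  then obtain B0 where B0: "\<And>x. x \<in> K \<inter> half_space k \<Longrightarrow> \<bar>u x\<bar> \<le> B0"
    by (auto simp: bounded_iff)
  have bound: "\<bar>v x\<bar> \<le> max B0 0" for x
    using B0[of x] supp[of x] by (cases "x \<in> K"; cases "x \<in> half_space k") (auto simp: v_def)
  obtain R where R: "\<And>x. x \<in> K \<Longrightarrow> norm x \<le> R"
    using compact_imp_bounded[OF K] by (auto simp: bounded_iff)
  have line_deriv: "((\<lambda>t. u (x + t *\<^sub>R ?e)) has_real_derivative d (x + s *\<^sub>R ?e)) (at s)"
    if "0 < (x + s *\<^sub>R ?e) $ k" for x s
  proof -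
    have "((\<lambda>t. u ((x + s *\<^sub>R ?e) + t *\<^sub>R ?e)) has_real_derivative d (x + s *\<^sub>R ?e)) (at 0)"
      using deriv[OF that] .
    then have "((\<lambda>t. (\<lambda>t. u (x + t *\<^sub>R ?e)) (t + s)) has_real_derivative d (x + s *\<^sub>R ?e)) (at 0)"
      by (simp add: algebra_simps)
    then show ?thesis using DERIV_shift[of "\<lambda>t. u (x + t *\<^sub>R ?e)" "d (x + s *\<^sub>R ?e)" 0 s] by simp
  qed
  \<comment> \<open>The mean value theorem needs derivatives only inside the segment, so the end points may lie on
    the hyperplane.\<close>
  have seg: "\<bar>u (x + b *\<^sub>R ?e) - u (x + a *\<^sub>R ?e)\<bar> \<le> L * (b - a)"
    if ab: "a \<le> b" and inside: "\<And>s. a < s \<Longrightarrow> s < b \<Longrightarrow> 0 < (x + s *\<^sub>R ?e) $ k"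
      and closed_in: "\<And>s. a \<le> s \<Longrightarrow> s \<le> b \<Longrightarrow> 0 \<le> (x + s *\<^sub>R ?e) $ k" for x a b
  proof (cases "a = b")
    case False
    then have "a < b" using ab by simp
    have "continuous_on {a..b} (\<lambda>s. u (x + s *\<^sub>R ?e))"
      by (rule continuous_on_compose2[OF cont])
        (use closed_in in \<open>auto intro!: continuous_intros simp: half_space_def\<close>)
    moreover have "((\<lambda>s. u (x + s *\<^sub>R ?e)) has_derivative (\<lambda>h. d (x + s *\<^sub>R ?e) * h)) (at s)"
      if "a < s" "s < b" for s
      using line_deriv[OF inside[OF that]] by (simp add: has_field_derivative_def)
    ultimately obtain s where s: "a < s" "s < b"
      "u (x + b *\<^sub>R ?e) - u (x + a *\<^sub>R ?e) = d (x + s *\<^sub>R ?e) * (b - a)"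
      using mvt[OF \<open>a < b\<close>, of "\<lambda>s. u (x + s *\<^sub>R ?e)" "\<lambda>s h. d (x + s *\<^sub>R ?e) * h"] by auto
    then show ?thesis
      using bd[OF inside[OF s(1,2)]] \<open>a < b\<close> by (simp add: abs_mult)
  qed simp
  have lip: "\<bar>v (x + t *\<^sub>R ?e) - v x\<bar> \<le> L * t" if t: "0 \<le> t" for x t
  proof (cases "i = k")
    case False
    then have same: "(x + s *\<^sub>R ?e) $ k = x $ k" for s by (simp add: ek)
    show ?thesis
    proof (cases "0 < x $ k")
      case True
      then show ?thesis using seg[OF t, of x] False by (simp add: v_def half_space_def ek)
    next
      case nonpos: False
      show ?thesis
      proof (cases "x $ k = 0")
        case False
        then show ?thesis using nonpos \<open>i \<noteq> k\<close> t \<open>L \<ge> 0\<close> by (simp add: v_def half_space_def ek)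
      next
        case True
        \<comment> \<open>A line inside the hyperplane is the limit of parallel lines in the open half-space.\<close>
        let ?y = "\<lambda>m::nat. x + inverse (real (Suc m)) *\<^sub>R axis k 1"
        have y: "?y \<longlonglongrightarrow> x"
          using tendsto_add[OF tendsto_const tendsto_scaleR[OF LIMSEQ_inverse_real_of_nat tendsto_const],
            of x "axis k 1"] by simp
        have yk: "(?y m + s *\<^sub>R ?e) $ k > 0" for m s
          using True False by (simp add: ek axis_def del: of_nat_Suc)
        have est: "\<bar>u (?y m + t *\<^sub>R ?e) - u (?y m + 0 *\<^sub>R ?e)\<bar> \<le> L * (t - 0)" for m
          by (rule seg[OF t]) (use yk less_imp_le in blast)+
        have "(\<lambda>m. u (?y m + s *\<^sub>R ?e)) \<longlonglongrightarrow> u (x + s *\<^sub>R ?e)" for s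
          by (rule continuous_on_tendsto_compose[OF cont tendsto_add[OF y tendsto_const]])
            (use True \<open>i \<noteq> k\<close> in \<open>auto simp: half_space_def ek intro!: always_eventually\<close>)
        then have "(\<lambda>m. \<bar>u (?y m + t *\<^sub>R ?e) - u (?y m + 0 *\<^sub>R ?e)\<bar>) \<longlonglongrightarrow> \<bar>u (x + t *\<^sub>R ?e) - u (x + 0 *\<^sub>R ?e)\<bar>"
          by (intro tendsto_intros)
        then have "\<bar>u (x + t *\<^sub>R ?e) - u (x + 0 *\<^sub>R ?e)\<bar> \<le> L * (t - 0)"
          by (rule LIMSEQ_le_const2) (use est in blast)
        then show ?thesis using True \<open>i \<noteq> k\<close> by (simp add: v_def half_space_def ek)
      qed
    qed
  next
    case True
    then have comp: "(x + s *\<^sub>R ?e) $ k = x $ k + s" for s by (simp add: ek)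
    let ?a = "max 0 (- (x $ k))"
    show ?thesis
    proof (cases "x $ k + t \<le> 0")
      case below: True
      have "v y = 0" if "y $ k \<le> 0" for y
        using boundary[OF True] that by (auto simp: v_def half_space_def)
      moreover have "(x + t *\<^sub>R ?e) $ k \<le> 0" "x $ k \<le> 0"
        using below t True by (auto simp: axis_def)
      ultimately show ?thesis using t \<open>L \<ge> 0\<close> by simp
    next
      case False
      have "\<bar>u (x + t *\<^sub>R ?e) - u (x + ?a *\<^sub>R ?e)\<bar> \<le> L * (t - ?a)"
        by (rule seg) (use False t True in \<open>auto simp: axis_def\<close>)
      also have "\<dots> \<le> L * t" using \<open>L \<ge> 0\<close> by (intro mult_left_mono) auto
      finally have "\<bar>u (x + t *\<^sub>R ?e) - u (x + ?a *\<^sub>R ?e)\<bar> \<le> L * t" .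
      moreover have "v (x + t *\<^sub>R ?e) = u (x + t *\<^sub>R ?e)"
        using False True by (simp add: v_def half_space_def axis_def)
      moreover have "v x = u (x + ?a *\<^sub>R ?e)"
        using boundary[OF True, of "x + ?a *\<^sub>R ?e"] True
        by (auto simp: v_def half_space_def max_def axis_def)
      ultimately show ?thesis by simp
    qed
  qed
  have pos_lim: "(\<lambda>m. real (Suc m) * (v (x + inverse (real (Suc m)) *\<^sub>R ?e) - v x)) \<longlonglongrightarrow> d x"
    if x: "0 < x $ k" for x
  proof -
    have "(\<lambda>h. (u (x + h *\<^sub>R ?e) - u x) / h) \<midarrow>0\<rightarrow> d x"
      using deriv[OF x] by (simp add: DERIV_def)
    then have "(\<lambda>m. (u (x + inverse (real (Suc m)) *\<^sub>R ?e) - u x) / inverse (real (Suc m))) \<longlonglongrightarrow> d x"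
      by (rule tendsto_compose_eventually[OF _ LIMSEQ_inverse_real_of_nat]) simp
    moreover have "v (x + inverse (real (Suc m)) *\<^sub>R ?e) = u (x + inverse (real (Suc m)) *\<^sub>R ?e)" "v x = u x" for m
      using x by (auto simp: v_def half_space_def ek)
    ultimately show ?thesis by (simp add: field_simps del: of_nat_Suc)
  qed
  let ?s = "\<lambda>m x. indicator {x. 0 < x $ k} x * (real (Suc m) * (v (x + inverse (real (Suc m)) *\<^sub>R ?e) - v x))"
  have D_meas: "D \<in> borel_measurable borel"
  proof (rule borel_measurable_LIMSEQ_real)
    show "(\<lambda>m. ?s m x) \<longlonglongrightarrow> D x" for x
      using pos_lim[of x] by (cases "0 < x $ k") (auto simp: D_def)
    have "open {x::real^'n. 0 < x $ k}" by (intro open_Collect_less continuous_intros)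
    then have [measurable]: "{x::real^'n. 0 < x $ k} \<in> sets borel" by simp
    show "?s m \<in> borel_measurable borel" for m
      using v_meas by measurable
  qed
  have "has_bochner_integral lborel D 0"
  proof (rule integral_directional_derivative_eq_0[OF v_meas bound _ lip D_meas])
    show "norm x \<le> R" if "v x \<noteq> 0" for x using that v_off R by blast
    show "AE x in lborel. (\<lambda>m. real (Suc m) * (v (x + inverse (real (Suc m)) *\<^sub>R ?e) - v x)) \<longlonglongrightarrow> D x"
      using AE_off_hyperplane[of k]
    proof eventually_elim
      case (elim x)
      show ?case
      proof (cases "0 < x $ k")
        case True
        then show ?thesis using pos_lim by (simp add: D_def)
      next
        case False
        then have neg: "x $ k < 0" using elim by simp
        have "\<forall>\<^sub>F m in sequentially. (x + inverse (real (Suc m)) *\<^sub>R ?e) $ k < 0"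
        proof (rule order_tendstoD)
          show "(\<lambda>m. (x + inverse (real (Suc m)) *\<^sub>R ?e) $ k) \<longlonglongrightarrow> (x + 0 *\<^sub>R ?e) $ k"
            by (intro tendsto_intros LIMSEQ_inverse_real_of_nat)
        qed (use neg in simp)
        then have "\<forall>\<^sub>F m in sequentially. real (Suc m) * (v (x + inverse (real (Suc m)) *\<^sub>R ?e) - v x) = D x"
          by eventually_elim (use neg in \<open>simp add: v_def half_space_def D_def\<close>)
        then show ?thesis by (rule tendsto_eventually)
      qed
    qed
  qed
  then show ?thesis by (simp add: D_def)
qed


section \<open>The inner product of \<open>V\<close>\<close>

lemma bounded_bilinear_ip: "bounded_bilinear (ip :: 'n::finite V \<Rightarrow> _)"
proof -
  have "bounded_bilinear (\<lambda>(x::'n V) (y::'n V). fst x \<bullet> fst y)" "bounded_bilinear (\<lambda>(x::'n V) (y::'n V). snd x \<bullet> snd y)"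
    using bounded_bilinear.comp[OF bounded_bilinear_inner bounded_linear_fst bounded_linear_fst]
      bounded_bilinear.comp[OF bounded_bilinear_inner bounded_linear_snd bounded_linear_snd] by auto
  then interpret a: bounded_bilinear "\<lambda>(x::'n V) (y::'n V). fst x \<bullet> fst y" + b: bounded_bilinear "\<lambda>(x::'n V) (y::'n V). snd x \<bullet> snd y" .
  obtain K1 where K1: "\<And>(x :: 'n V) (y :: 'n V). norm (fst x \<bullet> fst y) \<le> norm x * norm y * K1"
    using a.bounded by blast
  obtain K2 where K2: "\<And>(x :: 'n V) (y :: 'n V). norm (snd x \<bullet> snd y) \<le> norm x * norm y * K2"
    using b.bounded by blast
  show ?thesis
  proof
    show "\<exists>K. \<forall>(a :: 'n V) (b :: 'n V). norm \<langle>a, b\<rangle>\<^sub>V \<le> norm a * norm b * K"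
    proof (intro exI allI)
      fix x y :: "'n V"
      have "norm \<langle>x, y\<rangle>\<^sub>V \<le> norm (fst x \<bullet> fst y) + norm (snd x \<bullet> snd y)"
        unfolding ip_def by (rule norm_triangle_ineq4)
      then show "norm \<langle>x, y\<rangle>\<^sub>V \<le> norm x * norm y * (K1 + K2)"
        using K1[of x y] K2[of x y] by (simp add: algebra_simps)
    qed
  qed (auto simp: ip_def inner_add_left inner_add_right algebra_simps)
qed

interpretation ip: bounded_bilinear "ip :: 'n::finite V \<Rightarrow> _"
  by (rule bounded_bilinear_ip)

lemmas ip_simps = ip.add_left ip.add_right ip.diff_left ip.diff_right ip.scaleR_left ip.scaleR_right
  ip.minus_left ip.minus_right ip.zero_left ip.zero_right ip.sum_left ip.sum_right


section \<open>Charts of a spacelike hypersurface\<close>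

text \<open>A point of a relatively open subset of the half-space can be moved a little in each positive
  coordinate direction, which determines the derivative even on the bounding hyperplane.\<close>

lemma has_derivative_unique_half_space:
  fixes f :: "real^'n::finite \<Rightarrow> 'b::real_normed_vector"
  assumes S: "openin (top_of_set (half_space k)) S" and x: "x \<in> S"
    and "(f has_derivative f') (at x within S)" "(f has_derivative f'') (at x within S)"
  shows "f' = f''"
proof (rule frechet_derivative_unique_within[OF assms(3,4)])
  fix i :: "real^'n" and e :: real
  assume i: "i \<in> Basis" and e: "e > 0"
  obtain d where d: "d > 0" "\<And>y. y \<in> half_space k \<Longrightarrow> dist y x < d \<Longrightarrow> y \<in> S"
    using S x by (auto simp: openin_euclidean_subtopology_iff)
  have xk: "x \<in> half_space k" using S x by (auto simp: openin_euclidean_subtopology_iff)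
  let ?d = "min d e / 2"
  have "x + ?d *\<^sub>R i \<in> S"
  proof (rule d(2))
    show "x + ?d *\<^sub>R i \<in> half_space k"
      using i xk d(1) e by (auto simp: half_space_def Basis_vec_def axis_def)
    show "dist (x + ?d *\<^sub>R i) x < d" using i d(1) e by (simp add: dist_norm)
  qed
  then show "\<exists>d. 0 < \<bar>d\<bar> \<and> \<bar>d\<bar> < e \<and> x + d *\<^sub>R i \<in> S"
    using d(1) e by (intro exI[of _ ?d]) auto
qed

lemma frechet_derivative_half_space:
  fixes f :: "real^'n::finite \<Rightarrow> 'b::real_normed_vector"
  assumes "openin (top_of_set (half_space k)) S" "x \<in> S" "(f has_derivative f') (at x within S)"
  shows "frechet_derivative f (at x within S) = f'"
proof (rule has_derivative_unique_half_space[OF assms(1,2) _ assms(3)])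
  show "(f has_derivative frechet_derivative f (at x within S)) (at x within S)"
    using assms(3) by (auto simp: differentiable_def frechet_derivative_works[symmetric])
qed

lemma smooth_on_extension:
  fixes f :: "real^'n::finite \<Rightarrow> 'b::real_normed_vector"
  assumes "smooth_on S f" "x \<in> S"
  obtains W g where "open W" "x \<in> W" "C1_on W g"
    "\<And>v. C1_on W (\<lambda>y. frechet_derivative g (at y) v)" "\<And>y. y \<in> S \<Longrightarrow> y \<in> W \<Longrightarrow> g y = f y"
proof -
  obtain W g where g: "open W" "x \<in> W" "\<forall>r. C_k_on r g W" "\<forall>y\<in>S \<inter> W. g y = f y"
    using assms unfolding smooth_on_def by blast
  have "C1_on W g" using g(3)[rule_format, of "Suc 0"] by (simp add: C1_on_def)
  moreover have "C1_on W (\<lambda>y. frechet_derivative g (at y) v)" for v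
    using g(3)[rule_format, of "Suc (Suc 0)"] by (simp add: C1_on_def)
  ultimately show ?thesis using g that by auto
qed

lemma has_derivative_extension:
  assumes "open W" "x \<in> W" "x \<in> S" "(g has_derivative g') (at x)"
    and "\<And>y. y \<in> S \<Longrightarrow> y \<in> W \<Longrightarrow> g y = f y"
  shows "(f has_derivative g') (at x within S)"
proof (rule has_derivative_transform_eventually)
  show "(g has_derivative g') (at x within S)" using assms(4) by (rule has_derivative_at_withinI)
  show "\<forall>\<^sub>F y in at x within S. g y = f y"
    using eventually_at_in_open'[OF assms(1,2)] assms(5)
    by (auto simp: eventually_at_filter elim: eventually_mono)
qed (use assms in auto)

lemma smooth_on_has_derivative:
  fixes f :: "real^'n::finite \<Rightarrow> 'b::real_normed_vector"
  assumes S: "openin (top_of_set (half_space k)) S" and f: "smooth_on S f" and x: "x \<in> S"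
  shows "(f has_derivative frechet_derivative f (at x within S)) (at x within S)"
proof -
  obtain W g where "open W" "x \<in> W" "C1_on W g" "\<And>y. y \<in> S \<Longrightarrow> y \<in> W \<Longrightarrow> g y = f y"
    using smooth_on_extension[OF f x] by metis
  then have "(f has_derivative frechet_derivative g (at x)) (at x within S)"
    using x by (intro has_derivative_extension[of W x S g]) (auto intro: C1_on_has_derivative)
  then show ?thesis
    by (auto simp: differentiable_def frechet_derivative_works[symmetric])
qed

lemma smooth_on_continuous_derivative:
  fixes f :: "real^'n::finite \<Rightarrow> 'b::real_normed_vector"
  assumes S: "openin (top_of_set (half_space k)) S" and f: "smooth_on S f"
  shows "continuous_on S (\<lambda>x. frechet_derivative f (at x within S) v)"
  unfolding continuous_on_eq_continuous_within
proof
  fix x assume x: "x \<in> S"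
  obtain W g where g: "open W" "x \<in> W" "C1_on W g" "\<And>y. y \<in> S \<Longrightarrow> y \<in> W \<Longrightarrow> g y = f y"
    using smooth_on_extension[OF f x] by metis
  have eq: "frechet_derivative f (at y within S) = frechet_derivative g (at y)"
    if "y \<in> S" "y \<in> W" for y
    using g that by (intro frechet_derivative_half_space[OF S] has_derivative_extension[of W y S g])
      (auto intro: C1_on_has_derivative)
  have "continuous (at x) (\<lambda>y. frechet_derivative g (at y) v)"
    using g by (auto simp: C1_on_def continuous_on_eq_continuous_at)
  then have "((\<lambda>y. frechet_derivative g (at y) v) \<longlongrightarrow> frechet_derivative g (at x) v) (at x within S)"
    using continuous_at_imp_continuous_at_within continuous_within by blast
  then have "((\<lambda>y. frechet_derivative f (at y within S) v) \<longlongrightarrow> frechet_derivative g (at x) v) (at x within S)"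
  proof (rule Lim_transform_eventually)
    show "\<forall>\<^sub>F y in at x within S. frechet_derivative g (at y) v = frechet_derivative f (at y within S) v"
      using eventually_at_in_open'[OF g(1,2)] eq
      by (auto simp: eventually_at_filter elim: eventually_mono)
  qed
  then show "continuous (at x within S) (\<lambda>x. frechet_derivative f (at x within S) v)"
    using eq[OF x g(2)] by (simp add: continuous_within)
qed

locale immersed_hypersurface =
  fixes k :: "'n::finite" and M :: "'m::t2_space set" and \<A> :: "('m, 'n) chart set"
    and E :: "'n V" and F :: "'m \<Rightarrow> 'n V"
  assumes atlas: "smooth_atlas k M \<A>" and immersion: "spacelike_immersion M \<A> E F"
begin

lemma chart_facts:
  assumes "(U, \<phi>) \<in> \<A>"
  shows chart_openin: "openin (top_of_set M) U"
    and chart_image_openin: "openin (top_of_set (half_space k)) (\<phi> ` U)"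
    and chart_homeomorphism: "homeomorphism U (\<phi> ` U) \<phi> (inv_into U \<phi>)"
    and chart_subset: "U \<subseteq> M"
    and chart_smooth: "smooth_on (\<phi> ` U) (F \<circ> inv_into U \<phi>)"
  using assms atlas immersion openin_imp_subset
  by (auto simp: smooth_atlas_def is_chart_def spacelike_immersion_def smooth_map_def)

lemma chart_inv:
  assumes "(U, \<phi>) \<in> \<A>"
  shows "p \<in> U \<Longrightarrow> inv_into U \<phi> (\<phi> p) = p" "x \<in> \<phi> ` U \<Longrightarrow> \<phi> (inv_into U \<phi> x) = x"
    "x \<in> \<phi> ` U \<Longrightarrow> inv_into U \<phi> x \<in> U"
    "inj_on \<phi> U" "continuous_on U \<phi>" "continuous_on (\<phi> ` U) (inv_into U \<phi>)"
  using chart_homeomorphism[OF assms]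
  by (auto simp: homeomorphism_def f_inv_into_f inv_into_into intro: inj_on_inverseI)

lemma has_derivative_chart_deriv:
  assumes ch: "(U, \<phi>) \<in> \<A>" and p: "p \<in> U"
  shows "((F \<circ> inv_into U \<phi>) has_derivative chart_deriv F (U, \<phi>) p) (at (\<phi> p) within \<phi> ` U)"
  using smooth_on_has_derivative[OF chart_image_openin[OF ch] chart_smooth[OF ch], of "\<phi> p"] p
  by (simp add: chart_deriv_def)

lemma chart_deriv_linear:
  assumes "(U, \<phi>) \<in> \<A>" "p \<in> U"
  shows "linear (chart_deriv F (U, \<phi>) p)"
  using has_derivative_chart_deriv[OF assms] by (simp add: has_derivative_bounded_linear bounded_linear.linear)

lemma chart_deriv_expand:
  assumes "(U, \<phi>) \<in> \<A>" "p \<in> U"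
  shows "chart_deriv F (U, \<phi>) p v = (\<Sum>i\<in>UNIV. v $ i *\<^sub>R chart_deriv F (U, \<phi>) p (axis i 1))"
proof -
  have "v = (\<Sum>i\<in>UNIV. v $ i *\<^sub>R axis i 1)"
    using basis_expansion[of v] by (simp add: scalar_mult_eq_scaleR)
  then have "chart_deriv F (U, \<phi>) p v = chart_deriv F (U, \<phi>) p (\<Sum>i\<in>UNIV. v $ i *\<^sub>R axis i 1)"
    by simp
  then show ?thesis
    by (simp add: linear_sum[OF chart_deriv_linear[OF assms]] linear_cmul[OF chart_deriv_linear[OF assms]])
qed

lemma chart_deriv_positive:
  assumes "(U, \<phi>) \<in> \<A>" "p \<in> U" "v \<noteq> 0"
  shows "0 < \<langle>chart_deriv F (U, \<phi>) p v, chart_deriv F (U, \<phi>) p v\<rangle>\<^sub>V"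
  using immersion assms by (fastforce simp: spacelike_immersion_def)

lemma chart_deriv_continuous:
  assumes ch: "(U, \<phi>) \<in> \<A>"
  shows "continuous_on (\<phi> ` U) (\<lambda>x. chart_deriv F (U, \<phi>) (inv_into U \<phi> x) v)"
  using smooth_on_continuous_derivative[OF chart_image_openin[OF ch] chart_smooth[OF ch], of v]
  by (rule continuous_on_eq) (simp add: chart_deriv_def chart_inv[OF ch])

lemma metric_det_continuous:
  assumes ch: "(U, \<phi>) \<in> \<A>"
  shows "continuous_on (\<phi> ` U) (\<lambda>x. det (metric_matrix F (U, \<phi>) (inv_into U \<phi> x)))"
  unfolding det_def metric_matrix_def
  by (simp, intro continuous_intros ip.continuous_on chart_deriv_continuous[OF ch])

lemma chart_overlap_openin:
  assumes ch: "(U, \<phi>) \<in> \<A>" and ch': "(U', \<phi>') \<in> \<A>"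
  shows "openin (top_of_set (half_space k)) (\<phi> ` (U \<inter> U'))"
proof -
  have "openin (top_of_set U) (U \<inter> U')"
    using chart_openin[OF ch'] chart_subset[OF ch]
    by (metis inf.absorb_iff2 inf_commute openin_subtopology_Int2 subtopology_subtopology)
  then have "openin (top_of_set (\<phi> ` U)) (\<phi> ` (U \<inter> U'))"
    using homeomorphism_imp_open_map[OF chart_homeomorphism[OF ch]] by blast
  then show ?thesis using chart_image_openin[OF ch] by (rule openin_trans)
qed

lemma chart_transition_derivative:
  assumes ch: "(U, \<phi>) \<in> \<A>" and ch': "(U', \<phi>') \<in> \<A>" and p: "p \<in> U" "p \<in> U'"
  shows "((\<phi>' \<circ> inv_into U \<phi>) has_derivative
      frechet_derivative (\<phi>' \<circ> inv_into U \<phi>) (at (\<phi> p) within \<phi> ` (U \<inter> U')))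
      (at (\<phi> p) within \<phi> ` (U \<inter> U'))"
proof (rule smooth_on_has_derivative[OF chart_overlap_openin[OF ch ch']])
  show "smooth_on (\<phi> ` (U \<inter> U')) (\<phi>' \<circ> inv_into U \<phi>)"
    using atlas ch ch' by (fastforce simp: smooth_atlas_def)
qed (use p in auto)

lemma chart_deriv_transition:
  assumes ch: "(U, \<phi>) \<in> \<A>" and ch': "(U', \<phi>') \<in> \<A>" and p: "p \<in> U" "p \<in> U'"
  defines "\<tau> \<equiv> frechet_derivative (\<phi>' \<circ> inv_into U \<phi>) (at (\<phi> p) within \<phi> ` (U \<inter> U'))"
  shows "chart_deriv F (U, \<phi>) p v = chart_deriv F (U', \<phi>') p (\<tau> v)"
proof -
  let ?S = "\<phi> ` (U \<inter> U')"
  note i = chart_inv[OF ch] and i' = chart_inv[OF ch']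
  have 1: "((F \<circ> inv_into U \<phi>) has_derivative chart_deriv F (U, \<phi>) p) (at (\<phi> p) within ?S)"
    by (rule has_derivative_subset[OF has_derivative_chart_deriv[OF ch p(1)]]) auto
  have img: "(\<phi>' \<circ> inv_into U \<phi>) ` ?S \<subseteq> \<phi>' ` U'" by (auto simp: i)
  have eq: "(\<phi>' \<circ> inv_into U \<phi>) (\<phi> p) = \<phi>' p" by (simp add: i p)
  have "((F \<circ> inv_into U' \<phi>') has_derivative chart_deriv F (U', \<phi>') p)
      (at ((\<phi>' \<circ> inv_into U \<phi>) (\<phi> p)) within (\<phi>' \<circ> inv_into U \<phi>) ` ?S)"
    unfolding eq by (rule has_derivative_subset[OF has_derivative_chart_deriv[OF ch' p(2)] img])
  from has_derivative_in_compose[OF chart_transition_derivative[OF ch ch' p] this]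
  have "((\<lambda>x. (F \<circ> inv_into U' \<phi>') ((\<phi>' \<circ> inv_into U \<phi>) x)) has_derivative
      (\<lambda>v. chart_deriv F (U', \<phi>') p (\<tau> v))) (at (\<phi> p) within ?S)"
    unfolding \<tau>_def .
  then have 2: "((F \<circ> inv_into U \<phi>) has_derivative (\<lambda>v. chart_deriv F (U', \<phi>') p (\<tau> v)))
      (at (\<phi> p) within ?S)"
    by (rule has_derivative_transform[rotated 2]) (use p in \<open>auto simp: i i'\<close>)
  show ?thesis
    using has_derivative_unique_half_space[OF chart_overlap_openin[OF ch ch'] _ 1 2] p by auto
qed

text \<open>The two Gram matrices are congruent through the Jacobian of the change of charts.\<close>

lemma metric_det_transition:
  assumes ch: "(U, \<phi>) \<in> \<A>" and ch': "(U', \<phi>') \<in> \<A>" and p: "p \<in> U" "p \<in> U'"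
  defines "\<tau> \<equiv> frechet_derivative (\<phi>' \<circ> inv_into U \<phi>) (at (\<phi> p) within \<phi> ` (U \<inter> U'))"
  shows "det (metric_matrix F (U, \<phi>) p) = (det (matrix \<tau>))\<^sup>2 * det (metric_matrix F (U', \<phi>') p)"
proof -
  let ?J = "matrix \<tau>" and ?D = "\<lambda>i. chart_deriv F (U', \<phi>') p (axis i 1)"
  have d: "chart_deriv F (U, \<phi>) p (axis i 1) = (\<Sum>a\<in>UNIV. ?J $ a $ i *\<^sub>R ?D a)" for i
    using chart_deriv_transition[OF ch ch' p, of "axis i 1"] chart_deriv_expand[OF ch' p(2), of "\<tau> (axis i 1)"]
    by (simp add: \<tau>_def matrix_def)
  have "metric_matrix F (U, \<phi>) p $ i $ j = (transpose ?J ** metric_matrix F (U', \<phi>') p ** ?J) $ i $ j" for i j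
  proof -
    have "metric_matrix F (U, \<phi>) p $ i $ j = (\<Sum>b\<in>UNIV. \<Sum>a\<in>UNIV. ?J $ b $ j * (?J $ a $ i * \<langle>?D a, ?D b\<rangle>\<^sub>V))"
      by (simp add: metric_matrix_def d ip_simps sum_distrib_left)
    also have "\<dots> = (transpose ?J ** metric_matrix F (U', \<phi>') p ** ?J) $ i $ j"
      by (simp add: metric_matrix_def matrix_matrix_mult_def transpose_def sum_distrib_right
          sum_distrib_left mult.commute mult.left_commute)
    finally show ?thesis .
  qed
  then have "metric_matrix F (U, \<phi>) p = transpose ?J ** metric_matrix F (U', \<phi>') p ** ?J"
    by (simp add: vec_eq_iff)
  then show ?thesis by (simp add: det_mul det_transpose power2_eq_square)
qed

text \<open>The segment from the identity matrix to the metric matrix consists of positive definite, hence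
  invertible, matrices; so the determinant cannot change sign along it.\<close>

lemma metric_det_pos:
  assumes ch: "(U, \<phi>) \<in> \<A>" and p: "p \<in> U"
  shows "0 < det (metric_matrix F (U, \<phi>) p)"
proof (rule ccontr)
  let ?g = "metric_matrix F (U, \<phi>) p" and ?D = "chart_deriv F (U, \<phi>) p"
  let ?a = "\<lambda>t::real. (1 - t) *\<^sub>R mat 1 + t *\<^sub>R ?g"
  have g: "v \<bullet> (?g *v v) = \<langle>?D v, ?D v\<rangle>\<^sub>V" for v
    unfolding chart_deriv_expand[OF ch p, of v] ip.sum_left
    by (simp add: ip.sum_right ip.scaleR_left ip.scaleR_right metric_matrix_def
        matrix_vector_mult_def inner_vec_def sum_distrib_left mult.commute mult.left_commute)
  have nz: "det (?a t) \<noteq> 0" if t: "0 \<le> t" "t \<le> 1" for t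
  proof
    assume "det (?a t) = 0"
    then have "\<not> (\<exists>B. B ** ?a t = mat 1)"
      using invertible_left_inverse invertible_det_nz by blast
    then obtain v where v: "?a t *v v = 0" "v \<noteq> 0"
      using matrix_left_invertible_ker[of "?a t"] by blast
    have "0 = v \<bullet> (?a t *v v)" by (simp add: v)
    also have "\<dots> = (1 - t) * (v \<bullet> v) + t * \<langle>?D v, ?D v\<rangle>\<^sub>V"
      by (simp add: matrix_vector_mult_add_rdistrib scaleR_matrix_vector_assoc[symmetric]
          inner_add_right g)
    also have "\<dots> > 0"
    proof (cases "t = 1")
      case True
      then show ?thesis using chart_deriv_positive[OF ch p v(2)] by simp
    next
      case False
      then have "0 < (1 - t) * (v \<bullet> v)" using t v(2) by simp
      moreover have "0 \<le> t * \<langle>?D v, ?D v\<rangle>\<^sub>V" using chart_deriv_positive[OF ch p v(2)] t by simp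
      ultimately show ?thesis by simp
    qed
    finally show False by simp
  qed
  assume "\<not> 0 < det ?g"
  then have "det (?a 1) \<le> 0" "0 \<le> det (?a 0)" by auto
  moreover have "continuous_on {0..1} (\<lambda>t. det (?a t))"
    unfolding det_def by (simp, intro continuous_intros)
  ultimately obtain t where "0 \<le> t" "t \<le> 1" "det (?a t) = 0"
    using IVT2'[of "\<lambda>t. det (?a t)" 1 0 0] by auto
  then show False using nz by blast
qed

lemmas metric_det_nonneg = less_imp_le[OF metric_det_pos]

end


section \<open>The volume measure\<close>

locale compact_hypersurface = immersed_hypersurface k M \<A> E F
  for k :: "'n::finite" and M :: "'m::t2_space set" and \<A> :: "('m, 'n) chart set"
    and E :: "'n V" and F :: "'m \<Rightarrow> 'n V" +
  assumes compact: "compact M"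
begin

definition volume_density :: "'m set \<Rightarrow> ('m \<Rightarrow> real^'n) \<Rightarrow> real^'n \<Rightarrow> real"
  where "volume_density U \<phi> x = sqrt (det (metric_matrix F (U, \<phi>) (inv_into U \<phi> x)))"

definition chart_measure :: "'m set \<Rightarrow> ('m \<Rightarrow> real^'n) \<Rightarrow> (real^'n) measure"
  where "chart_measure U \<phi> = density lborel (\<lambda>x. ennreal (volume_density U \<phi> x) * indicator (\<phi> ` U) x)"

abbreviation borel_M :: "'m measure"
  where "borel_M \<equiv> restrict_space borel M"

lemma M_borel: "M \<in> sets borel"
  using compact by (simp add: compact_imp_closed)

lemma borel_M_iff: "S \<in> sets borel_M \<longleftrightarrow> S \<in> sets borel \<and> S \<subseteq> M"
  using M_borel by (auto simp: sets_restrict_space_iff)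

lemma chart_borel: "(U, \<phi>) \<in> \<A> \<Longrightarrow> U \<in> sets borel"
  using chart_openin M_borel by (force simp: openin_open)

lemma chart_image_borel: "(U, \<phi>) \<in> \<A> \<Longrightarrow> \<phi> ` U \<in> sets borel"
proof -
  assume "(U, \<phi>) \<in> \<A>"
  then obtain T where "open T" "\<phi> ` U = half_space k \<inter> T"
    using chart_image_openin by (force simp: openin_open)
  moreover have "closed (half_space k)"
    unfolding half_space_def by (intro closed_Collect_le continuous_intros)
  ultimately show ?thesis by auto
qed

lemma chart_inv_measurable:
  "(U, \<phi>) \<in> \<A> \<Longrightarrow> inv_into U \<phi> \<in> borel_measurable (restrict_space borel (\<phi> ` U))"
  by (intro borel_measurable_continuous_on_restrict chart_inv)

lemma chart_image_eq:
  assumes "(U, \<phi>) \<in> \<A>" "S \<subseteq> U"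
  shows "\<phi> ` S = inv_into U \<phi> -` S \<inter> \<phi> ` U"
  using assms(2) chart_inv[OF assms(1)] by (auto simp: image_iff)

lemma borel_chart_image:
  assumes ch: "(U, \<phi>) \<in> \<A>" and S: "S \<in> sets borel" "S \<subseteq> U"
  shows "\<phi> ` S \<in> sets borel"
proof -
  have "inv_into U \<phi> -` S \<inter> space (restrict_space borel (\<phi> ` U)) \<in> sets (restrict_space borel (\<phi> ` U))"
    by (rule measurable_sets[OF chart_inv_measurable[OF ch] S(1)])
  then show ?thesis
    using chart_image_borel[OF ch] chart_image_eq[OF ch S(2)]
    by (simp add: space_restrict_space sets_restrict_space_iff)
qed

lemma volume_density_measurable:
  assumes ch: "(U, \<phi>) \<in> \<A>"
  shows "volume_density U \<phi> \<in> borel_measurable (restrict_space borel (\<phi> ` U))"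
  unfolding volume_density_def
  by (intro borel_measurable_continuous_on_restrict continuous_on_real_sqrt metric_det_continuous[OF ch])

lemma volume_density_measurable':
  assumes ch: "(U, \<phi>) \<in> \<A>"
  shows "(\<lambda>x. ennreal (volume_density U \<phi> x) * indicator (\<phi> ` U) x) \<in> borel_measurable lborel"
proof -
  have "(\<lambda>x. indicator (\<phi> ` U) x *\<^sub>R volume_density U \<phi> x) \<in> borel_measurable borel"
    using volume_density_measurable[OF ch] chart_image_borel[OF ch]
    by (subst (asm) borel_measurable_restrict_space_iff) auto
  then have "(\<lambda>x. ennreal (indicator (\<phi> ` U) x *\<^sub>R volume_density U \<phi> x)) \<in> borel_measurable borel"
    by simp
  also have "(\<lambda>x. ennreal (indicator (\<phi> ` U) x *\<^sub>R volume_density U \<phi> x))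
      = (\<lambda>x. ennreal (volume_density U \<phi> x) * indicator (\<phi> ` U) x)"
    by (auto simp: fun_eq_iff indicator_def)
  finally show ?thesis by simp
qed

lemma emeasure_chart_measure:
  assumes ch: "(U, \<phi>) \<in> \<A>" and S: "S \<in> sets borel" "S \<subseteq> U"
  shows "emeasure (chart_measure U \<phi>) (\<phi> ` S) = (\<integral>\<^sup>+x\<in>\<phi> ` S. ennreal (volume_density U \<phi> x) \<partial>lborel)"
  unfolding chart_measure_def
  using borel_chart_image[OF assms] volume_density_measurable'[OF ch] S(2)
  by (subst emeasure_density) (auto intro!: nn_integral_cong simp: indicator_def subset_iff)

text \<open>The square root of the determinant of the metric absorbs the Jacobian of the change of charts.\<close>

lemma chart_measure_transition:
  assumes ch: "(U, \<phi>) \<in> \<A>" and ch': "(U', \<phi>') \<in> \<A>"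
    and S: "S \<in> sets borel" "S \<subseteq> U" "S \<subseteq> U'"
  shows "emeasure (chart_measure U \<phi>) (\<phi> ` S) = emeasure (chart_measure U' \<phi>') (\<phi>' ` S)"
proof -
  let ?g = "\<phi>' \<circ> inv_into U \<phi>"
  let ?g' = "\<lambda>x. frechet_derivative ?g (at x within \<phi> ` (U \<inter> U'))"
  note i = chart_inv[OF ch] and i' = chart_inv[OF ch']
  have img: "?g ` (\<phi> ` S) = \<phi>' ` S"
    using S(2) i by (auto simp: image_iff subset_iff)
  have "(\<integral>\<^sup>+x\<in>\<phi> ` S. ennreal (volume_density U \<phi> x) \<partial>lborel)
      = (\<integral>\<^sup>+y\<in>?g ` (\<phi> ` S). ennreal (volume_density U' \<phi>' y) \<partial>lborel)"
  proof (rule nn_integral_change_of_variables[where g'="?g'"])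
    show "\<phi> ` S \<in> sets borel" "?g ` (\<phi> ` S) \<in> sets borel"
      unfolding img using borel_chart_image[OF ch S(1,2)] borel_chart_image[OF ch' S(1,3)] by auto
    show "inj_on ?g (\<phi> ` S)"
      using S i i' by (auto simp: inj_on_def subset_iff) (metis)
    show "volume_density U' \<phi>' \<in> borel_measurable (restrict_space borel (?g ` (\<phi> ` S)))"
      unfolding img by (rule measurable_restrict_mono[OF volume_density_measurable[OF ch']]) (use S in auto)
    show "volume_density U \<phi> \<in> borel_measurable (restrict_space borel (\<phi> ` S))"
      by (rule measurable_restrict_mono[OF volume_density_measurable[OF ch]]) (use S in auto)
    show "0 \<le> volume_density U' \<phi>' y" if y: "y \<in> ?g ` (\<phi> ` S)" for y
    proof -
      obtain p where p: "p \<in> U'" "y = \<phi>' p" using y S(3) unfolding img by auto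
      have "0 \<le> det (metric_matrix F (U', \<phi>') p)"
        using metric_det_nonneg[OF ch' p(1)] .
      then show ?thesis by (simp add: volume_density_def p i')
    qed
    fix x assume "x \<in> \<phi> ` S"
    then obtain p where p: "p \<in> S" "p \<in> U" "p \<in> U'" "x = \<phi> p" using S by auto
    show "(?g has_derivative ?g' x) (at x within \<phi> ` S)"
      unfolding p(4) by (rule has_derivative_subset[OF chart_transition_derivative[OF ch ch' p(2,3)]])
        (use S in auto)
    show "volume_density U \<phi> x = \<bar>det (matrix (?g' x))\<bar> * volume_density U' \<phi>' (?g x)"
      using metric_det_transition[OF ch ch' p(2,3)]
      by (simp add: volume_density_def p i i' real_sqrt_mult)
  qed
  then show ?thesis
    unfolding img by (simp only: emeasure_chart_measure[OF ch S(1,2)] emeasure_chart_measure[OF ch' S(1,3)])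
qed

lemma finite_chart_cover:
  obtains n :: nat and V :: "nat \<Rightarrow> 'm set" and \<theta> :: "nat \<Rightarrow> 'm \<Rightarrow> real^'n"
  where "\<And>i. i < n \<Longrightarrow> (V i, \<theta> i) \<in> \<A>" "M = (\<Union>i<n. V i)"
proof -
  have "\<exists>\<B>\<subseteq>\<A>. finite \<B> \<and> M \<subseteq> (\<Union>ch\<in>\<B>. fst ch)"
  proof -
    have "\<exists>T. open T \<and> fst ch = M \<inter> T" if "ch \<in> \<A>" for ch
      using that chart_openin[of "fst ch" "snd ch"] by (auto simp: openin_open)
    then obtain T where T: "\<And>ch. ch \<in> \<A> \<Longrightarrow> open (T ch) \<and> fst ch = M \<inter> T ch" by metis
    have "M \<subseteq> (\<Union>ch\<in>\<A>. T ch)"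
      using atlas T by (fastforce simp: smooth_atlas_def)
    then obtain \<B> where "\<B> \<subseteq> \<A>" "finite \<B>" "M \<subseteq> (\<Union>ch\<in>\<B>. T ch)"
      using compactE_image[OF compact, of \<A> T] T by metis
    then show ?thesis using T by (intro exI[of _ \<B>]) blast
  qed
  then obtain \<B> where B: "\<B> \<subseteq> \<A>" "finite \<B>" "M \<subseteq> (\<Union>ch\<in>\<B>. fst ch)" by blast
  obtain f where f: "bij_betw f {..<card \<B>} \<B>"
    using ex_bij_betw_nat_finite[OF B(2)] by (auto simp: atLeast0LessThan)
  have "(\<Union>ch\<in>f ` {..<card \<B>}. fst ch) = (\<Union>i<card \<B>. fst (f i))" by auto
  then have "(\<Union>i<card \<B>. fst (f i)) = (\<Union>ch\<in>\<B>. fst ch)"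
    by (simp only: bij_betw_imp_surj_on[OF f])
  moreover have "(fst (f i), snd (f i)) \<in> \<A>" if "i < card \<B>" for i
    using that f B(1) by (auto simp: bij_betw_def)
  moreover have "(\<Union>ch\<in>\<B>. fst ch) \<subseteq> M"
    using B(1) chart_subset by force
  ultimately show ?thesis
    using that[of "card \<B>" "fst \<circ> f" "snd \<circ> f"] B(3) by auto
qed

text \<open>A finite chart cover is refined to a Borel partition with each piece in one chart. This forces
  the value of the measure on every Borel set, and that value serves as the definition. By
  \<open>chart_measure_transition\<close> the measure so defined has the right values in all other charts.\<close>

lemma volume_measure_unique_existence:
  "\<exists>!\<omega>. sets \<omega> = sets borel_M \<and>
    (\<forall>(U, \<phi>)\<in>\<A>. \<forall>S\<in>sets \<omega>. S \<subseteq> U \<longrightarrow> emeasure \<omega> S =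
        (\<integral>\<^sup>+ x\<in>\<phi> ` S. ennreal (sqrt (det (metric_matrix F (U, \<phi>) (inv_into U \<phi> x)))) \<partial>lborel))"
    (is "\<exists>!\<omega>. ?P \<omega>")
proof -
  have val: "emeasure m T = (\<integral>\<^sup>+ x\<in>\<phi> ` T. ennreal (sqrt (det (metric_matrix F (U, \<phi>) (inv_into U \<phi> x)))) \<partial>lborel)"
    if "?P m" "(U, \<phi>) \<in> \<A>" "T \<in> sets m" "T \<subseteq> U" for m U \<phi> T
    using bspec[OF conjunct2[OF that(1)] that(2)] that(3,4) by blast
  obtain n V \<theta> where ch: "\<And>i::nat. i < n \<Longrightarrow> (V i, \<theta> i) \<in> \<A>" and MV: "M = (\<Union>i<n. V i)"
    using finite_chart_cover by blast
  define D where "D i = V i - (\<Union>j<i. V j)" for i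
  have D_V: "D i \<subseteq> V i" for i by (auto simp: D_def)
  have D_borel: "D i \<in> sets borel" if "i < n" for i
    unfolding D_def
  proof (intro sets.Diff sets.finite_UN)
    show "V j \<in> sets borel" if "j \<in> {..<i}" for j
      using chart_borel[OF ch] \<open>i < n\<close> that by simp
  qed (use chart_borel[OF ch[OF that]] in simp_all)
  have D_disj: "D i \<inter> D j = {}" if "i \<noteq> j" for i j
    using linorder_neqE_nat[OF that] by (fastforce simp: D_def)
  have D_cover: "M = (\<Union>i<n. D i)"
  proof
    show "M \<subseteq> (\<Union>i<n. D i)"
    proof
      fix p assume "p \<in> M"
      then have ex: "\<exists>i. i < n \<and> p \<in> V i" unfolding MV by auto
      let ?i = "LEAST i. i < n \<and> p \<in> V i"
      have i: "?i < n \<and> p \<in> V ?i" by (rule LeastI_ex[OF ex])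
      have "p \<notin> V j" if "j < ?i" for j
        using not_less_Least[OF that] that i by simp
      then have "p \<in> D ?i" unfolding D_def using i by blast
      then show "p \<in> (\<Union>i<n. D i)" using i by blast
    qed
    show "(\<Union>i<n. D i) \<subseteq> M"
      unfolding MV by (rule UN_mono) (use D_V in auto)
  qed
  let ?pm = "\<lambda>i S. emeasure (chart_measure (V i) (\<theta> i)) (\<theta> i ` S)"
  define \<omega> where "\<omega> = measure_of M (sets borel_M) (\<lambda>S. \<Sum>i<n. ?pm i (S \<inter> D i))"
  have space_M: "space borel_M = M" by (simp add: space_restrict_space)
  have sets_\<omega>: "sets \<omega> = sets borel_M"
    unfolding \<omega>_def by (subst space_M[symmetric]) (rule sets.sets_measure_of_eq)
  have em: "emeasure \<omega> S = (\<Sum>i<n. ?pm i (S \<inter> D i))" if "S \<in> sets borel_M" for S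
  proof -
    have "emeasure (measure_of (space borel_M) (sets borel_M) (\<lambda>S. \<Sum>i<n. ?pm i (S \<inter> D i))) S
        = (\<Sum>i<n. ?pm i (S \<inter> D i))"
    proof (rule emeasure_measure_of_sigma)
      show "sigma_algebra (space borel_M) (sets borel_M)" by (rule sets.sigma_algebra_axioms)
      show "positive (sets borel_M) (\<lambda>S. \<Sum>i<n. ?pm i (S \<inter> D i))" by (simp add: positive_def)
      show "countably_additive (sets borel_M) (\<lambda>S. \<Sum>i<n. ?pm i (S \<inter> D i))"
      proof (rule countably_additiveI)
        fix B :: "nat \<Rightarrow> 'm set"
        assume B: "range B \<subseteq> sets borel_M" "disjoint_family B"
        have "(\<Sum>j. ?pm i (B j \<inter> D i)) = ?pm i ((\<Union>j. B j) \<inter> D i)" if i: "i < n" for i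
        proof -
          have "(\<Sum>j. emeasure (chart_measure (V i) (\<theta> i)) (\<theta> i ` (B j \<inter> D i)))
              = emeasure (chart_measure (V i) (\<theta> i)) (\<Union>j. \<theta> i ` (B j \<inter> D i))"
          proof (rule suminf_emeasure)
            have "\<theta> i ` (B j \<inter> D i) \<in> sets borel" for j
              using B(1) D_borel[OF i] D_V[of i] borel_M_iff
              by (intro borel_chart_image[OF ch[OF i]]) auto
            then show "range (\<lambda>j. \<theta> i ` (B j \<inter> D i)) \<subseteq> sets (chart_measure (V i) (\<theta> i))"
              by (auto simp: chart_measure_def)
            show "disjoint_family (\<lambda>j. \<theta> i ` (B j \<inter> D i))"
              unfolding disjoint_family_on_def
            proof (intro ballI impI)
              fix a b :: nat assume "a \<noteq> b"
              then have "B a \<inter> B b = {}" using B(2) by (auto simp: disjoint_family_on_def)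
              then show "\<theta> i ` (B a \<inter> D i) \<inter> \<theta> i ` (B b \<inter> D i) = {}"
                using D_V[of i] chart_inv(4)[OF ch[OF i]]
                by (subst inj_on_image_Int[symmetric, of _ "V i"]) auto
            qed
          qed
          also have "(\<Union>j. \<theta> i ` (B j \<inter> D i)) = \<theta> i ` ((\<Union>j. B j) \<inter> D i)" by auto
          finally show ?thesis .
        qed
        then show "(\<Sum>j. \<Sum>i<n. ?pm i (B j \<inter> D i)) = (\<Sum>i<n. ?pm i ((\<Union>j. B j) \<inter> D i))"
          by (subst suminf_sum) auto
      qed
    qed (use that in simp)
    then show ?thesis by (simp only: \<omega>_def space_M)
  qed
  have P_\<omega>: "?P \<omega>"
  proof (intro conjI sets_\<omega> ballI, clarify)
    fix U \<phi> S assume U: "(U, \<phi>) \<in> \<A>" and S: "S \<in> sets \<omega>" "S \<subseteq> U"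
    have Sb: "S \<in> sets borel_M" "S \<in> sets borel" using S sets_\<omega> borel_M_iff by auto
    have piece: "S \<inter> D i \<in> sets borel" "S \<inter> D i \<subseteq> U" "S \<inter> D i \<subseteq> V i" if "i < n" for i
      using D_borel[OF that] Sb S(2) D_V[of i] by auto
    have "emeasure \<omega> S = (\<Sum>i<n. emeasure (chart_measure U \<phi>) (\<phi> ` (S \<inter> D i)))"
      unfolding em[OF Sb(1)]
      by (intro sum.cong refl chart_measure_transition[OF ch U]) (use piece in auto)
    also have "\<dots> = emeasure (chart_measure U \<phi>) (\<Union>i<n. \<phi> ` (S \<inter> D i))"
    proof (rule sum_emeasure)
      show "(\<lambda>i. \<phi> ` (S \<inter> D i)) ` {..<n} \<subseteq> sets (chart_measure U \<phi>)"
        using borel_chart_image[OF U] piece by (auto simp: chart_measure_def)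
      show "disjoint_family_on (\<lambda>i. \<phi> ` (S \<inter> D i)) {..<n}"
        unfolding disjoint_family_on_def
      proof (intro ballI impI)
        fix a b :: nat assume "a \<noteq> b"
        then show "\<phi> ` (S \<inter> D a) \<inter> \<phi> ` (S \<inter> D b) = {}"
          using D_disj[of a b] S(2) chart_inv(4)[OF U]
          by (subst inj_on_image_Int[symmetric, of _ U]) auto
      qed
    qed simp
    also have "(\<Union>i<n. \<phi> ` (S \<inter> D i)) = \<phi> ` (S \<inter> (\<Union>i<n. D i))" by auto
    also have "S \<inter> (\<Union>i<n. D i) = S" using Sb(1) borel_M_iff D_cover by auto
    finally show "emeasure \<omega> S =
        (\<integral>\<^sup>+ x\<in>\<phi> ` S. ennreal (sqrt (det (metric_matrix F (U, \<phi>) (inv_into U \<phi> x)))) \<partial>lborel)"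
      using emeasure_chart_measure[OF U Sb(2) S(2)] by (simp add: volume_density_def)
  qed
  show ?thesis
  proof (rule ex1I[of ?P, OF P_\<omega>])
    fix \<omega>' assume P': "?P \<omega>'"
    show "\<omega>' = \<omega>"
    proof (rule measure_eqI)
      show sets_eq: "sets \<omega>' = sets \<omega>" using P' sets_\<omega> by simp
      fix S assume S: "S \<in> sets \<omega>'"
      have split: "emeasure m S = (\<Sum>i<n. emeasure m (S \<inter> D i))" if m: "sets m = sets \<omega>" for m
      proof -
        have SD: "S \<inter> D i \<in> sets m" if "i < n" for i
          using S D_borel[OF that] sets_\<omega> sets_eq borel_M_iff m by auto
        have "(\<Sum>i<n. emeasure m (S \<inter> D i)) = emeasure m (\<Union>i<n. S \<inter> D i)"
          using SD D_disj by (intro sum_emeasure) (auto simp: disjoint_family_on_def)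
        also have "(\<Union>i<n. S \<inter> D i) = S" using S D_cover sets_\<omega> sets_eq borel_M_iff by auto
        finally show ?thesis ..
      qed
      have "emeasure \<omega>' (S \<inter> D i) = emeasure \<omega> (S \<inter> D i)" if i: "i < n" for i
      proof -
        have 1: "S \<inter> D i \<in> sets \<omega>" using S D_borel[OF i] sets_\<omega> sets_eq borel_M_iff by auto
        then have 2: "S \<inter> D i \<in> sets \<omega>'" by (simp only: sets_eq)
        have 3: "S \<inter> D i \<subseteq> V i" using D_V[of i] by blast
        show ?thesis by (simp only: val[OF P' ch[OF i] 2 3] val[OF P_\<omega> ch[OF i] 1 3])
      qed
      then show "emeasure \<omega>' S = emeasure \<omega> S"
        using split[of \<omega>'] split[of \<omega>] sets_eq by simp
    qed
  qed
qed

lemma volume_measure_props: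
  shows sets_volume_measure: "sets (volume_measure M \<A> F) = sets borel_M"
    and space_volume_measure: "space (volume_measure M \<A> F) = M"
    and emeasure_volume_measure: "(U, \<phi>) \<in> \<A> \<Longrightarrow> S \<in> sets borel \<Longrightarrow> S \<subseteq> U \<Longrightarrow>
      emeasure (volume_measure M \<A> F) S = emeasure (chart_measure U \<phi>) (\<phi> ` S)"
proof -
  note P = theI'[OF volume_measure_unique_existence, folded volume_measure_def]
  show sets: "sets (volume_measure M \<A> F) = sets borel_M" using P by blast
  then show "space (volume_measure M \<A> F) = M"
    using sets_eq_imp_space_eq[OF sets] by (simp add: space_restrict_space)
  show "emeasure (volume_measure M \<A> F) S = emeasure (chart_measure U \<phi>) (\<phi> ` S)"
    if ch: "(U, \<phi>) \<in> \<A>" and S: "S \<in> sets borel" "S \<subseteq> U"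
  proof -
    have "S \<in> sets (volume_measure M \<A> F)" using S chart_subset[OF ch] by (simp add: sets borel_M_iff)
    then show ?thesis
      using bspec[OF conjunct2[OF P] ch] S(2)
      unfolding emeasure_chart_measure[OF ch S] volume_density_def by blast
  qed
qed

text \<open>A chart identifies the volume measure on its domain with the image of the measure that has
  density \<open>sqrt (det g)\<close>.\<close>

lemma has_bochner_integral_chart:
  fixes f :: "'m \<Rightarrow> real"
  assumes ch: "(U, \<phi>) \<in> \<A>" and f: "f \<in> borel_measurable borel_M"
    and off: "\<And>p. p \<in> M \<Longrightarrow> p \<notin> U \<Longrightarrow> f p = 0"
    and int: "has_bochner_integral lborel
      (\<lambda>x. indicator (\<phi> ` U) x * (volume_density U \<phi> x * f (inv_into U \<phi> x))) I"
  shows "has_bochner_integral (volume_measure M \<A> F) f I"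
proof -
  let ?\<omega> = "volume_measure M \<A> F" and ?\<psi> = "inv_into U \<phi>"
  let ?L = "restrict_space (chart_measure U \<phi>) (\<phi> ` U)"
  note i = chart_inv[OF ch]
  have UM: "U \<subseteq> M" by (rule chart_subset[OF ch])
  have U_borel: "U \<in> sets borel" by (rule chart_borel[OF ch])
  have U_sets: "U \<inter> space ?\<omega> \<in> sets ?\<omega>"
    using U_borel UM by (simp add: space_volume_measure sets_volume_measure borel_M_iff Int_absorb2)
  have im_sets: "\<phi> ` U \<inter> space (chart_measure U \<phi>) \<in> sets (chart_measure U \<phi>)"
    using chart_image_borel[OF ch] by (simp add: chart_measure_def)
  have sets_U: "sets (restrict_space ?\<omega> U) = sets (restrict_space borel U)"
    using UM sets_restrict_space_cong[OF sets_volume_measure, of U]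
    by (simp add: sets_restrict_restrict_space Int_absorb1)
  have sets_L: "sets ?L = sets (restrict_space borel (\<phi> ` U))"
    by (rule sets_restrict_space_cong) (simp add: chart_measure_def)
  have m\<psi>: "?\<psi> \<in> ?L \<rightarrow>\<^sub>M restrict_space borel U"
  proof (rule measurable_restrict_space2)
    show "?\<psi> \<in> space ?L \<rightarrow> U" using i by (auto simp: space_restrict_space)
    show "?\<psi> \<in> borel_measurable ?L"
      using chart_inv_measurable[OF ch] by (simp cong: measurable_cong_sets add: sets_L)
  qed
  have eq: "restrict_space ?\<omega> U = distr ?L (restrict_space borel U) ?\<psi>"
  proof (rule measure_eqI)
    show "sets (restrict_space ?\<omega> U) = sets (distr ?L (restrict_space borel U) ?\<psi>)"
      by (simp add: sets_U)
    fix S assume "S \<in> sets (restrict_space ?\<omega> U)"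
    then have S: "S \<in> sets (restrict_space borel U)" by (simp add: sets_U)
    then have S': "S \<in> sets borel" "S \<subseteq> U"
      using U_borel by (auto simp: sets_restrict_space_iff)
    have "emeasure (restrict_space ?\<omega> U) S = emeasure (chart_measure U \<phi>) (\<phi> ` S)"
      using emeasure_restrict_space[OF U_sets S'(2)] emeasure_volume_measure[OF ch S'] by simp
    also have "\<dots> = emeasure ?L (\<phi> ` S)"
      by (rule emeasure_restrict_space[symmetric, OF im_sets]) (use S' in auto)
    also have "\<phi> ` S = ?\<psi> -` S \<inter> space ?L"
      using chart_image_eq[OF ch S'(2)] by (simp add: space_restrict_space chart_measure_def)
    also have "emeasure ?L \<dots> = emeasure (distr ?L (restrict_space borel U) ?\<psi>) S"
      by (rule emeasure_distr[symmetric, OF m\<psi> S])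
    finally show "emeasure (restrict_space ?\<omega> U) S = emeasure (distr ?L (restrict_space borel U) ?\<psi>) S" .
  qed
  have fU: "f \<in> borel_measurable (restrict_space borel U)"
    by (rule measurable_restrict_mono[OF f UM])
  have density: "has_bochner_integral (chart_measure U \<phi>) (\<lambda>x. indicator (\<phi> ` U) x *\<^sub>R f (?\<psi> x)) I"
  proof -
    have nn: "0 \<le> volume_density U \<phi> x * indicator (\<phi> ` U) x" for x
      using metric_det_nonneg[OF ch] i by (auto simp: volume_density_def indicator_def)
    have cm: "chart_measure U \<phi> = density lborel (\<lambda>x. ennreal (volume_density U \<phi> x * indicator (\<phi> ` U) x))"
      unfolding chart_measure_def by (rule arg_cong[where f="density lborel"]) (auto simp: fun_eq_iff indicator_def)
    have m1: "(\<lambda>x. volume_density U \<phi> x * indicator (\<phi> ` U) x) \<in> borel_measurable lborel"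
      using volume_density_measurable[OF ch] chart_image_borel[OF ch]
      by (subst (asm) borel_measurable_restrict_space_iff) (auto simp: mult.commute)
    have "(\<lambda>x. f (?\<psi> x)) \<in> borel_measurable ?L"
      by (rule measurable_compose[OF m\<psi> fU])
    then have "(\<lambda>x. f (?\<psi> x)) \<in> borel_measurable (restrict_space borel (\<phi> ` U))"
      by (simp cong: measurable_cong_sets add: sets_L)
    then have m2: "(\<lambda>x. indicator (\<phi> ` U) x *\<^sub>R f (?\<psi> x)) \<in> borel_measurable lborel"
      using chart_image_borel[OF ch] by (subst (asm) borel_measurable_restrict_space_iff) auto
    show ?thesis unfolding cm
    proof (rule has_bochner_integral_density[OF m2 m1])
      show "AE x in lborel. 0 \<le> volume_density U \<phi> x * indicator (\<phi> ` U) x" using nn by simp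
      show "has_bochner_integral lborel (\<lambda>x. (volume_density U \<phi> x * indicator (\<phi> ` U) x) *\<^sub>R
          (indicator (\<phi> ` U) x *\<^sub>R f (?\<psi> x))) I"
        by (rule has_bochner_integral_cong[THEN iffD1, OF refl _ refl int]) (auto simp: indicator_def)
    qed
  qed
  have "has_bochner_integral ?L (\<lambda>x. f (?\<psi> x)) I"
    using density unfolding has_bochner_integral_iff
    by (simp add: integrable_restrict_space[OF im_sets] integral_restrict_space[OF im_sets])
  then have "has_bochner_integral (restrict_space ?\<omega> U) f I"
    unfolding eq has_bochner_integral_iff
    by (simp add: integrable_distr_eq[OF m\<psi> fU] integral_distr[OF m\<psi> fU])
  then have "has_bochner_integral ?\<omega> (\<lambda>p. indicator U p *\<^sub>R f p) I"
    unfolding has_bochner_integral_iff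
    by (simp add: integrable_restrict_space[OF U_sets] integral_restrict_space[OF U_sets])
  then show ?thesis
    by (rule has_bochner_integral_cong[THEN iffD1, rotated 3])
      (auto simp: space_volume_measure off indicator_def)
qed

end


section \<open>The flux field and its divergence\<close>

text \<open>The field whose divergence is the integrand. Since \<open>\<langle>\<nu>, \<nu>\<rangle> = - 1\<close>, the
  second summand removes the normal component of \<open>T\<close>; the normal components of the two terms in the
  last summand cancel.\<close>

definition flux_field :: "real \<Rightarrow> 'n::finite V \<Rightarrow> 'n V \<Rightarrow> 'n V \<Rightarrow> real \<Rightarrow> 'n V \<Rightarrow> 'n V \<Rightarrow> 'n V"
  where "flux_field c E A B \<kappa> \<xi> \<nu> = T_field c E A B \<xi> + \<langle>T_field c E A B \<xi>, \<nu>\<rangle>\<^sub>V *\<^sub>R \<nu>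
    + \<kappa> *\<^sub>R (\<langle>X_field c E B \<xi>, \<nu>\<rangle>\<^sub>V *\<^sub>R X_field c E A \<xi> - \<langle>X_field c E A \<xi>, \<nu>\<rangle>\<^sub>V *\<^sub>R X_field c E B \<xi>)"

lemma X_field_tangent:
  assumes "\<xi> \<in> space_form E" "\<langle>E, E\<rangle>\<^sub>V = - c"
  shows "\<langle>X_field c E A \<xi>, \<xi>\<rangle>\<^sub>V = 0" "\<langle>X_field c E A \<xi>, E\<rangle>\<^sub>V = 0"
  using assms ip_commute[of E \<xi>]
  by (simp_all add: X_field_def rho_fun_def m_const_def s_fun_def space_form_def ip_simps)

lemma flux_field_tangent:
  assumes "\<xi> \<in> space_form E" "\<langle>E, E\<rangle>\<^sub>V = - c"
    and "\<nu> \<in> tangent_space_form E \<xi>" "\<langle>\<nu>, \<nu>\<rangle>\<^sub>V = - 1"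
  shows "\<langle>flux_field c E A B \<kappa> \<xi> \<nu>, \<xi>\<rangle>\<^sub>V = 0" "\<langle>flux_field c E A B \<kappa> \<xi> \<nu>, E\<rangle>\<^sub>V = 0"
    "\<langle>flux_field c E A B \<kappa> \<xi> \<nu>, \<nu>\<rangle>\<^sub>V = 0"
  using assms(3,4) X_field_tangent[OF assms(1,2)]
  by (simp_all add: flux_field_def T_field_def tangent_space_form_def ip_simps)

text \<open>On the support, \<open>X\<^sub>A\<close> is a combination of \<open>\<nu>\<close> and \<open>\<mu>\<close>. Computing \<open>\<langle>X\<^sub>A, X\<^sub>B\<rangle>\<close> once from this
  combination and once from the definitions expresses the coefficient \<open>\<langle>A, B\<rangle> - m\<^sub>A s\<^sub>B\<close> of \<open>X\<^sub>A\<close> in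
  \<open>T\<close> by \<open>\<langle>X\<^sub>B, \<nu>\<rangle>\<close> and \<open>\<langle>X\<^sub>B, \<mu>\<rangle>\<close>.\<close>

lemma flux_field_boundary:
  assumes \<xi>: "\<xi> \<in> support_hypersurface E A" and E: "\<langle>E, E\<rangle>\<^sub>V = - c" and A: "\<langle>A, A\<rangle>\<^sub>V < 0"
    and \<nu>: "\<nu> \<in> tangent_space_form E \<xi>" "\<langle>\<nu>, \<nu>\<rangle>\<^sub>V = - 1"
    and \<mu>: "\<langle>\<mu>, \<mu>\<rangle>\<^sub>V = 1" "\<langle>\<nu>, \<mu>\<rangle>\<^sub>V = 0"
    and N: "support_normal c E A \<xi> = cosh \<gamma> *\<^sub>R \<nu> - sinh \<gamma> *\<^sub>R \<mu>"
  shows "\<langle>flux_field c E A B (lambda_const A * cosh \<gamma>) \<xi> \<nu>, \<mu>\<rangle>\<^sub>V = 0"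
proof -
  let ?l = "lambda_const A" and ?XA = "X_field c E A \<xi>" and ?XB = "X_field c E B \<xi>"
  have l: "?l > 0" "?l * ?l = - \<langle>A, A\<rangle>\<^sub>V" using A by (simp_all add: lambda_const_def)
  have sf: "\<xi> \<in> space_form E" and s0: "s_fun A \<xi> = 0"
    using \<xi> by (simp_all add: support_hypersurface_def)
  have "?XA = - (?l *\<^sub>R support_normal c E A \<xi>)"
    using l by (simp add: support_normal_def)
  then have XA: "?XA = (- ?l * cosh \<gamma>) *\<^sub>R \<nu> + (?l * sinh \<gamma>) *\<^sub>R \<mu>"
    by (simp add: N algebra_simps)
  have XA\<nu>: "\<langle>?XA, \<nu>\<rangle>\<^sub>V = ?l * cosh \<gamma>" and XA\<mu>: "\<langle>?XA, \<mu>\<rangle>\<^sub>V = ?l * sinh \<gamma>"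
    using \<nu>(2) \<mu> ip_commute[of \<mu> \<nu>] by (simp_all add: XA ip_simps)
  have "\<langle>?XA, ?XB\<rangle>\<^sub>V = \<langle>A, B\<rangle>\<^sub>V - m_const E A * s_fun B \<xi>"
    using X_field_tangent[OF sf E, of B] s0 ip_commute[of \<xi> B] ip_commute[of E B] ip_commute[of B ?XB]
      ip_commute[of \<xi> ?XB] ip_commute[of E ?XB] sf E ip_commute[of A \<xi>]
    by (simp add: X_field_def[of c E A] X_field_def[of c E B] ip_simps rho_fun_def m_const_def s_fun_def
        space_form_def ip_commute[of E \<xi>] algebra_simps)
  moreover have "\<langle>?XA, ?XB\<rangle>\<^sub>V = - ?l * cosh \<gamma> * \<langle>?XB, \<nu>\<rangle>\<^sub>V + ?l * sinh \<gamma> * \<langle>?XB, \<mu>\<rangle>\<^sub>V"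
    unfolding XA by (simp add: ip_simps ip_commute[of \<nu> ?XB] ip_commute[of \<mu> ?XB])
  ultimately have AB: "\<langle>A, B\<rangle>\<^sub>V - m_const E A * s_fun B \<xi>
      = - ?l * cosh \<gamma> * \<langle>?XB, \<nu>\<rangle>\<^sub>V + ?l * sinh \<gamma> * \<langle>?XB, \<mu>\<rangle>\<^sub>V" by simp
  have "\<langle>flux_field c E A B (?l * cosh \<gamma>) \<xi> \<nu>, \<mu>\<rangle>\<^sub>V
      = (\<langle>A, B\<rangle>\<^sub>V - m_const E A * s_fun B \<xi>) * (?l * sinh \<gamma>) + (?l * ?l) * \<langle>?XB, \<mu>\<rangle>\<^sub>V
        + ?l * cosh \<gamma> * (\<langle>?XB, \<nu>\<rangle>\<^sub>V * (?l * sinh \<gamma>) - ?l * cosh \<gamma> * \<langle>?XB, \<mu>\<rangle>\<^sub>V)"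
    unfolding l(2) by (simp add: flux_field_def T_field_def ip_simps XA\<nu> XA\<mu> \<mu> s0 algebra_simps)
  also have "\<dots> = ?l * ?l * \<langle>?XB, \<mu>\<rangle>\<^sub>V * ((sinh \<gamma>)\<^sup>2 + 1 - (cosh \<gamma>)\<^sup>2)"
    unfolding AB by (simp add: algebra_simps power2_eq_square)
  also have "\<dots> = 0" by (simp add: cosh_square_eq)
  finally show ?thesis .
qed

text \<open>The \<open>n\<close> tangent vectors, \<open>\<nu>\<close>, \<open>\<xi>\<close> and \<open>E\<close> are \<open>n + 3\<close> vectors, as many as the dimension of \<open>V\<close>.
  They are linearly independent: products with \<open>\<xi>\<close>, \<open>E\<close> and \<open>\<nu>\<close> isolate the last three coefficients,
  and the remaining vectors span a positive definite subspace.\<close>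

lemma moving_frame_spans:
  fixes F1 :: "'n::finite \<Rightarrow> 'n V"
  assumes \<xi>: "\<xi> \<in> space_form E"
    and \<nu>: "\<nu> \<in> tangent_space_form E \<xi>" "\<langle>\<nu>, \<nu>\<rangle>\<^sub>V = - 1"
    and F1: "\<And>i. F1 i \<in> tangent_space_form E \<xi>" "\<And>i. \<langle>\<nu>, F1 i\<rangle>\<^sub>V = 0"
    and pos: "\<And>v. v \<noteq> 0 \<Longrightarrow> 0 < \<langle>\<Sum>i\<in>UNIV. v $ i *\<^sub>R F1 i, \<Sum>i\<in>UNIV. v $ i *\<^sub>R F1 i\<rangle>\<^sub>V"
  obtains x r s t where "w = (\<Sum>i\<in>UNIV. x $ i *\<^sub>R F1 i) + r *\<^sub>R \<nu> + s *\<^sub>R \<xi> + t *\<^sub>R E"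
proof -
  define L where "L = (\<lambda>y :: 'n V. (\<Sum>i\<in>UNIV. fst (fst y) $ i *\<^sub>R F1 i) + snd (fst y) *\<^sub>R \<nu>
    + fst (snd y) *\<^sub>R \<xi> + snd (snd y) *\<^sub>R E)"
  have lin: "linear L"
    by (rule linearI) (auto simp: L_def algebra_simps sum.distrib scaleR_right.sum scaleR_scaleR)
  have "inj L"
    unfolding linear_injective_0[OF lin]
  proof (intro allI impI)
    fix y assume Ly: "L y = 0"
    obtain x r s t where y: "y = ((x, r), (s, t))" by (metis prod.exhaust)
    let ?u = "\<Sum>i\<in>UNIV. x $ i *\<^sub>R F1 i"
    have z: "?u + r *\<^sub>R \<nu> + s *\<^sub>R \<xi> + t *\<^sub>R E = 0" using Ly by (simp add: L_def y)
    have u: "\<langle>?u, \<xi>\<rangle>\<^sub>V = 0" "\<langle>?u, E\<rangle>\<^sub>V = 0" "\<langle>?u, \<nu>\<rangle>\<^sub>V = 0" "\<langle>\<nu>, ?u\<rangle>\<^sub>V = 0"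
      using F1 ip_commute[of "F1 _" \<nu>] by (simp_all add: ip_simps tangent_space_form_def)
    have n: "\<langle>\<nu>, \<xi>\<rangle>\<^sub>V = 0" "\<langle>\<nu>, E\<rangle>\<^sub>V = 0" "\<langle>\<xi>, \<nu>\<rangle>\<^sub>V = 0" "\<langle>E, \<nu>\<rangle>\<^sub>V = 0"
      using \<nu>(1) ip_commute[of \<xi> \<nu>] ip_commute[of E \<nu>] by (simp_all add: tangent_space_form_def)
    have x: "\<langle>\<xi>, \<xi>\<rangle>\<^sub>V = 0" "\<langle>\<xi>, E\<rangle>\<^sub>V = 1" "\<langle>E, \<xi>\<rangle>\<^sub>V = 1"
      using \<xi> ip_commute[of E \<xi>] by (simp_all add: space_form_def)
    have "t = 0" using arg_cong[OF z, of "\<lambda>w. \<langle>w, \<xi>\<rangle>\<^sub>V"] by (simp add: ip.add_left ip.scaleR_left ip.zero_left u n x)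
    moreover have "s + t * \<langle>E, E\<rangle>\<^sub>V = 0"
      using arg_cong[OF z, of "\<lambda>w. \<langle>w, E\<rangle>\<^sub>V"] by (simp add: ip.add_left ip.scaleR_left ip.zero_left u n x)
    ultimately have "t = 0" "s = 0" by auto
    moreover have "r = 0"
      using arg_cong[OF z, of "\<lambda>w. \<langle>w, \<nu>\<rangle>\<^sub>V"] by (simp add: ip.add_left ip.scaleR_left ip.zero_left u n x \<nu>(2))
    ultimately have "?u = 0" using z by simp
    then have "x = 0" using pos[of x] by (force simp: ip.zero_left)
    with \<open>t = 0\<close> \<open>s = 0\<close> \<open>r = 0\<close> show "y = 0" by (simp add: y zero_prod_def)
  qed
  then have "surj L" using lin linear_injective_imp_surjective by blast
  then obtain y where "w = L y" by (meson surjD)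
  then show ?thesis by (intro that[of "fst (fst y)" "snd (fst y)" "fst (snd y)" "snd (snd y)"]) (simp add: L_def)
qed

text \<open>The flat derivative of \<open>X\<^sub>A\<close> in direction \<open>v\<close>. The multiples of \<open>\<xi>\<close> and \<open>E\<close> are orthogonal to the
  space form, so its covariant derivative is \<open>- \<rho>\<^sub>A v\<close>.\<close>

definition X_deriv :: "real \<Rightarrow> 'n::finite V \<Rightarrow> 'n V \<Rightarrow> 'n V \<Rightarrow> 'n V \<Rightarrow> 'n V"
  where "X_deriv c E A \<xi> v = - (rho_fun c E A \<xi> *\<^sub>R v) - \<langle>A, v\<rangle>\<^sub>V *\<^sub>R (c *\<^sub>R \<xi> + E)"

definition T_deriv :: "real \<Rightarrow> 'n::finite V \<Rightarrow> 'n V \<Rightarrow> 'n V \<Rightarrow> 'n V \<Rightarrow> 'n V \<Rightarrow> 'n V"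
  where "T_deriv c E A B \<xi> v =
    \<langle>A, B\<rangle>\<^sub>V *\<^sub>R X_deriv c E A \<xi> v - \<langle>A, A\<rangle>\<^sub>V *\<^sub>R X_deriv c E B \<xi> v
    + m_const E A *\<^sub>R ((\<langle>A, v\<rangle>\<^sub>V *\<^sub>R X_field c E B \<xi> + s_fun A \<xi> *\<^sub>R X_deriv c E B \<xi> v)
      - (\<langle>B, v\<rangle>\<^sub>V *\<^sub>R X_field c E A \<xi> + s_fun B \<xi> *\<^sub>R X_deriv c E A \<xi> v))"

text \<open>The derivative of the flux field when the point moves with velocity \<open>v\<close> and the normal with
  velocity \<open>w\<close>.\<close>

definition flux_deriv :: "real \<Rightarrow> 'n::finite V \<Rightarrow> 'n V \<Rightarrow> 'n V \<Rightarrow> real \<Rightarrow> 'n V \<Rightarrow> 'n V \<Rightarrow> 'n V \<Rightarrow> 'n V \<Rightarrow> 'n V"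
  where "flux_deriv c E A B \<kappa> \<xi> \<nu> v w = T_deriv c E A B \<xi> v
    + ((\<langle>T_deriv c E A B \<xi> v, \<nu>\<rangle>\<^sub>V + \<langle>T_field c E A B \<xi>, w\<rangle>\<^sub>V) *\<^sub>R \<nu> + \<langle>T_field c E A B \<xi>, \<nu>\<rangle>\<^sub>V *\<^sub>R w)
    + \<kappa> *\<^sub>R (((\<langle>X_deriv c E B \<xi> v, \<nu>\<rangle>\<^sub>V + \<langle>X_field c E B \<xi>, w\<rangle>\<^sub>V) *\<^sub>R X_field c E A \<xi>
        + \<langle>X_field c E B \<xi>, \<nu>\<rangle>\<^sub>V *\<^sub>R X_deriv c E A \<xi> v)
      - ((\<langle>X_deriv c E A \<xi> v, \<nu>\<rangle>\<^sub>V + \<langle>X_field c E A \<xi>, w\<rangle>\<^sub>V) *\<^sub>R X_field c E B \<xi>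
        + \<langle>X_field c E A \<xi>, \<nu>\<rangle>\<^sub>V *\<^sub>R X_deriv c E B \<xi> v))"

lemma has_derivative_s_fun:
  "(G has_derivative G') (at x) \<Longrightarrow> ((\<lambda>x. s_fun A (G x)) has_derivative (\<lambda>v. \<langle>A, G' v\<rangle>\<^sub>V)) (at x)"
  unfolding s_fun_def by (rule bounded_linear.has_derivative[OF ip.bounded_linear_right])

lemma has_derivative_X_field:
  assumes "(G has_derivative G') (at x)"
  shows "((\<lambda>x. X_field c E A (G x)) has_derivative (\<lambda>v. X_deriv c E A (G x) (G' v))) (at x)"
proof -
  have "((\<lambda>x. A - (m_const E A + c * s_fun A (G x)) *\<^sub>R G x - s_fun A (G x) *\<^sub>R E) has_derivative
      (\<lambda>v. 0 - ((m_const E A + c * s_fun A (G x)) *\<^sub>R G' v + (0 + c * \<langle>A, G' v\<rangle>\<^sub>V) *\<^sub>R G x)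
        - \<langle>A, G' v\<rangle>\<^sub>V *\<^sub>R E)) (at x)"
    by (intro has_derivative_diff has_derivative_const has_derivative_scaleR has_derivative_add
        has_derivative_mult_right has_derivative_s_fun has_derivative_scaleR_left assms)
  then show ?thesis
    by (simp add: X_field_def X_deriv_def rho_fun_def algebra_simps)
qed

lemma has_derivative_T_field:
  assumes "(G has_derivative G') (at x)"
  shows "((\<lambda>x. T_field c E A B (G x)) has_derivative (\<lambda>v. T_deriv c E A B (G x) (G' v))) (at x)"
proof -
  have "((\<lambda>x. s_fun A (G x) *\<^sub>R X_field c E B (G x)) has_derivative
      (\<lambda>v. s_fun A (G x) *\<^sub>R X_deriv c E B (G x) (G' v) + \<langle>A, G' v\<rangle>\<^sub>V *\<^sub>R X_field c E B (G x))) (at x)"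
    for A B
    by (intro has_derivative_scaleR has_derivative_s_fun has_derivative_X_field assms)
  note this[of A B] this[of B A]
  then show ?thesis
    unfolding T_field_def T_deriv_def
    by (subst (1 2) add.commute[of "\<langle>_, _\<rangle>\<^sub>V *\<^sub>R X_field c E _ _"])
      (intro has_derivative_add has_derivative_diff has_derivative_scaleR_right has_derivative_X_field assms)
qed

lemma has_derivative_ip:
  assumes "(f has_derivative f') (at x)" "(g has_derivative g') (at x)"
  shows "((\<lambda>x. \<langle>f x, g x\<rangle>\<^sub>V) has_derivative (\<lambda>v. \<langle>f' v, g x\<rangle>\<^sub>V + \<langle>f x, g' v\<rangle>\<^sub>V)) (at x)"
  using ip.FDERIV[OF assms] by (simp add: add.commute)

lemma has_derivative_scaleR':
  assumes "(f has_derivative f') (at x)" "(g has_derivative g') (at x)"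
  shows "((\<lambda>x. f x *\<^sub>R g x) has_derivative (\<lambda>v. f' v *\<^sub>R g x + f x *\<^sub>R g' v)) (at x)"
  using has_derivative_scaleR[OF assms] by (simp add: add.commute)

lemma has_derivative_flux_field:
  assumes "(G has_derivative G') (at x)" "(N has_derivative N') (at x)"
  shows "((\<lambda>x. flux_field c E A B \<kappa> (G x) (N x)) has_derivative
    (\<lambda>v. flux_deriv c E A B \<kappa> (G x) (N x) (G' v) (N' v))) (at x)"
  unfolding flux_field_def flux_deriv_def
  by (intro has_derivative_add has_derivative_diff has_derivative_scaleR_right has_derivative_scaleR'
      has_derivative_ip has_derivative_X_field has_derivative_T_field assms)

lemma sum_symmetric_antisymmetric:
  fixes P :: "'n::finite \<Rightarrow> 'n \<Rightarrow> real"
  assumes "\<And>i j. P i j = P j i"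
  shows "(\<Sum>i\<in>UNIV. \<Sum>j\<in>UNIV. P i j * (a i * b j)) = (\<Sum>i\<in>UNIV. \<Sum>j\<in>UNIV. P i j * (b i * a j))"
  by (subst sum.swap) (simp add: assms mult.commute[of "b _"])

text \<open>The divergence of the flux field. Here \<open>F1 i\<close> is a frame of the tangent space of the hypersurface,
  \<open>N1 i\<close> the derivative of the normal along it and \<open>P\<close> the inverse of the metric matrix. Terms that
  are skew in the two indices disappear against the symmetric \<open>P\<close>.\<close>

lemma trace_flux_deriv:
  fixes F1 N1 :: "'n::finite \<Rightarrow> 'n V" and P :: "'n \<Rightarrow> 'n \<Rightarrow> real"
  assumes \<xi>: "\<xi> \<in> space_form E" and E: "\<langle>E, E\<rangle>\<^sub>V = - c"
    and \<nu>: "\<nu> \<in> tangent_space_form E \<xi>" "\<langle>\<nu>, \<nu>\<rangle>\<^sub>V = - 1"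
    and F1: "\<And>i. F1 i \<in> tangent_space_form E \<xi>" "\<And>i. \<langle>\<nu>, F1 i\<rangle>\<^sub>V = 0"
    and pos: "\<And>v. v \<noteq> 0 \<Longrightarrow> 0 < \<langle>\<Sum>i\<in>UNIV. v $ i *\<^sub>R F1 i, \<Sum>i\<in>UNIV. v $ i *\<^sub>R F1 i\<rangle>\<^sub>V"
    and N1: "\<And>i. \<langle>\<nu>, N1 i\<rangle>\<^sub>V = 0" "\<And>i. \<langle>\<xi>, N1 i\<rangle>\<^sub>V = 0" "\<And>i. \<langle>E, N1 i\<rangle>\<^sub>V = 0"
    and sym: "\<And>i j. \<langle>N1 i, F1 j\<rangle>\<^sub>V = \<langle>N1 j, F1 i\<rangle>\<^sub>V"
    and P: "\<And>i j. P i j = P j i" "\<And>i k. (\<Sum>j\<in>UNIV. P i j * \<langle>F1 j, F1 k\<rangle>\<^sub>V) = (if i = k then 1 else 0)"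
  shows "(\<Sum>i\<in>UNIV. \<Sum>j\<in>UNIV. P i j * \<langle>flux_deriv c E A B \<kappa> \<xi> \<nu> (F1 i) (N1 i), F1 j\<rangle>\<^sub>V)
    = real CARD('n) * psi_fun c E A B \<xi>
      + (\<Sum>i\<in>UNIV. \<Sum>j\<in>UNIV. P i j * \<langle>N1 i, F1 j\<rangle>\<^sub>V) * \<langle>T_field c E A B \<xi>, \<nu>\<rangle>\<^sub>V
      - real CARD('n) * \<kappa> * \<langle>K_field c E A B \<xi>, \<nu>\<rangle>\<^sub>V"
proof -
  let ?X = "\<lambda>A. X_field c E A \<xi>" and ?\<rho> = "\<lambda>A. rho_fun c E A \<xi>"
  let ?g = "\<lambda>i j. \<langle>F1 i, F1 j\<rangle>\<^sub>V" and ?h = "\<lambda>i j. \<langle>N1 i, F1 j\<rangle>\<^sub>V"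
  let ?m = "m_const E A" and ?t = "\<langle>T_field c E A B \<xi>, \<nu>\<rangle>\<^sub>V"
  have orth: "\<langle>\<xi>, F1 j\<rangle>\<^sub>V = 0" "\<langle>E, F1 j\<rangle>\<^sub>V = 0" "\<langle>F1 j, \<nu>\<rangle>\<^sub>V = 0" "\<langle>\<xi>, \<nu>\<rangle>\<^sub>V = 0" "\<langle>E, \<nu>\<rangle>\<^sub>V = 0" for j
    using F1(1)[of j] F1(2)[of j] \<nu>(1) ip_commute[of \<xi> "F1 j"] ip_commute[of E "F1 j"]
      ip_commute[of "F1 j" \<nu>] ip_commute[of \<xi> \<nu>] ip_commute[of E \<nu>]
    by (simp_all add: tangent_space_form_def)
  have XF: "\<langle>?X C, F1 j\<rangle>\<^sub>V = \<langle>C, F1 j\<rangle>\<^sub>V" for C j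
    by (simp add: X_field_def ip_simps orth)
  have dX: "\<langle>X_deriv c E C \<xi> (F1 i), F1 j\<rangle>\<^sub>V = - ?\<rho> C * ?g i j"
    "\<langle>X_deriv c E C \<xi> (F1 i), \<nu>\<rangle>\<^sub>V = 0" for C i j
    by (simp_all add: X_deriv_def ip_simps orth)
  have dT: "\<langle>T_deriv c E A B \<xi> (F1 i), F1 j\<rangle>\<^sub>V = psi_fun c E A B \<xi> * ?g i j
      + ?m * (\<langle>A, F1 i\<rangle>\<^sub>V * \<langle>B, F1 j\<rangle>\<^sub>V - \<langle>B, F1 i\<rangle>\<^sub>V * \<langle>A, F1 j\<rangle>\<^sub>V)" for i j
    by (simp add: T_deriv_def psi_fun_def ip_simps XF dX algebra_simps)
  have K: "\<langle>K_field c E A B \<xi>, \<nu>\<rangle>\<^sub>V = ?\<rho> A * \<langle>?X B, \<nu>\<rangle>\<^sub>V - ?\<rho> B * \<langle>?X A, \<nu>\<rangle>\<^sub>V"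
    by (simp add: K_field_def ip_simps)
  have dY: "\<langle>flux_deriv c E A B \<kappa> \<xi> \<nu> (F1 i) (N1 i), F1 j\<rangle>\<^sub>V
      = (psi_fun c E A B \<xi> - \<kappa> * \<langle>K_field c E A B \<xi>, \<nu>\<rangle>\<^sub>V) * ?g i j
        + ?m * (\<langle>A, F1 i\<rangle>\<^sub>V * \<langle>B, F1 j\<rangle>\<^sub>V - \<langle>B, F1 i\<rangle>\<^sub>V * \<langle>A, F1 j\<rangle>\<^sub>V) + ?t * ?h i j
        + \<kappa> * (\<langle>?X B, N1 i\<rangle>\<^sub>V * \<langle>A, F1 j\<rangle>\<^sub>V - \<langle>?X A, N1 i\<rangle>\<^sub>V * \<langle>B, F1 j\<rangle>\<^sub>V)" for i j
    unfolding K by (simp add: flux_deriv_def ip_simps dT dX XF F1(2) algebra_simps)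
  \<comment> \<open>Both sides are the second fundamental form of the tangential parts of \<open>X\<^sub>A\<close> and \<open>X\<^sub>B\<close>, which is
    symmetric.\<close>
  have shape: "(\<Sum>i\<in>UNIV. \<Sum>j\<in>UNIV. P i j * (\<langle>?X B, N1 i\<rangle>\<^sub>V * \<langle>A, F1 j\<rangle>\<^sub>V))
      = (\<Sum>i\<in>UNIV. \<Sum>j\<in>UNIV. P i j * (\<langle>?X A, N1 i\<rangle>\<^sub>V * \<langle>B, F1 j\<rangle>\<^sub>V))"
  proof -
    have dec: "\<exists>x. (\<forall>i. \<langle>?X C, N1 i\<rangle>\<^sub>V = (\<Sum>l\<in>UNIV. x $ l * ?h i l)) \<and>
        (\<forall>i. (\<Sum>j\<in>UNIV. P i j * \<langle>C, F1 j\<rangle>\<^sub>V) = x $ i)" for C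
    proof -
      obtain x r s t where x: "?X C = (\<Sum>i\<in>UNIV. x $ i *\<^sub>R F1 i) + r *\<^sub>R \<nu> + s *\<^sub>R \<xi> + t *\<^sub>R E"
        using moving_frame_spans[OF \<xi> \<nu> F1 pos] .
      have "\<langle>?X C, N1 i\<rangle>\<^sub>V = (\<Sum>l\<in>UNIV. x $ l * ?h i l)" for i
        by (simp add: x ip_simps N1 ip_commute[of "F1 _" "N1 i"])
      moreover have "(\<Sum>j\<in>UNIV. P i j * \<langle>C, F1 j\<rangle>\<^sub>V) = x $ i" for i
      proof -
        have "\<langle>C, F1 j\<rangle>\<^sub>V = (\<Sum>l\<in>UNIV. x $ l * ?g j l)" for j
          using XF[of C j] by (simp add: x ip_simps orth F1(2) ip_commute[of "F1 j"])
        then have "(\<Sum>j\<in>UNIV. P i j * \<langle>C, F1 j\<rangle>\<^sub>V) = (\<Sum>j\<in>UNIV. \<Sum>l\<in>UNIV. x $ l * (P i j * ?g j l))"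
          by (simp add: sum_distrib_left mult.left_commute)
        also have "\<dots> = (\<Sum>l\<in>UNIV. x $ l * (\<Sum>j\<in>UNIV. P i j * ?g j l))"
          by (subst sum.swap) (simp add: sum_distrib_left)
        also have "\<dots> = x $ i" by (simp add: P(2) if_distrib[of "\<lambda>y. _ * y"] cong: if_cong)
        finally show ?thesis .
      qed
      ultimately show ?thesis by blast
    qed
    obtain x where x: "\<And>i. \<langle>?X B, N1 i\<rangle>\<^sub>V = (\<Sum>l\<in>UNIV. x $ l * ?h i l)"
      "\<And>i. (\<Sum>j\<in>UNIV. P i j * \<langle>B, F1 j\<rangle>\<^sub>V) = x $ i" using dec[of B] by auto
    obtain y where y: "\<And>i. \<langle>?X A, N1 i\<rangle>\<^sub>V = (\<Sum>l\<in>UNIV. y $ l * ?h i l)"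
      "\<And>i. (\<Sum>j\<in>UNIV. P i j * \<langle>A, F1 j\<rangle>\<^sub>V) = y $ i" using dec[of A] by auto
    have "(\<Sum>i\<in>UNIV. \<Sum>j\<in>UNIV. P i j * (\<langle>?X B, N1 i\<rangle>\<^sub>V * \<langle>A, F1 j\<rangle>\<^sub>V))
        = (\<Sum>i\<in>UNIV. \<langle>?X B, N1 i\<rangle>\<^sub>V * y $ i)"
      by (simp add: y(2)[symmetric] sum_distrib_left mult.left_commute)
    also have "\<dots> = (\<Sum>i\<in>UNIV. \<Sum>l\<in>UNIV. ?h i l * (y $ i * x $ l))"
      by (simp add: x(1) sum_distrib_left sum_distrib_right mult_ac)
    also have "\<dots> = (\<Sum>i\<in>UNIV. \<Sum>l\<in>UNIV. ?h i l * (x $ i * y $ l))"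
      by (rule sum_symmetric_antisymmetric[OF sym])
    also have "\<dots> = (\<Sum>i\<in>UNIV. \<langle>?X A, N1 i\<rangle>\<^sub>V * x $ i)"
      by (simp add: y(1) sum_distrib_left sum_distrib_right mult_ac)
    also have "\<dots> = (\<Sum>i\<in>UNIV. \<Sum>j\<in>UNIV. P i j * (\<langle>?X A, N1 i\<rangle>\<^sub>V * \<langle>B, F1 j\<rangle>\<^sub>V))"
      by (simp add: x(2)[symmetric] sum_distrib_left mult.left_commute)
    finally show ?thesis .
  qed
  have n: "(\<Sum>i\<in>UNIV. \<Sum>j\<in>UNIV. P i j * ?g i j) = real CARD('n)"
  proof -
    have "(\<Sum>i\<in>UNIV. \<Sum>j\<in>UNIV. P i j * ?g i j) = (\<Sum>i\<in>UNIV. \<Sum>j\<in>UNIV. P i j * ?g j i)"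
      by (intro sum.cong refl arg_cong2[where f="(*)"] ip_commute)
    then show ?thesis by (simp add: P(2))
  qed
  have alt: "(\<Sum>i\<in>UNIV. \<Sum>j\<in>UNIV. P i j * (\<langle>A, F1 i\<rangle>\<^sub>V * \<langle>B, F1 j\<rangle>\<^sub>V))
      = (\<Sum>i\<in>UNIV. \<Sum>j\<in>UNIV. P i j * (\<langle>B, F1 i\<rangle>\<^sub>V * \<langle>A, F1 j\<rangle>\<^sub>V))"
    by (rule sum_symmetric_antisymmetric[OF P(1)])
  let ?S = "\<lambda>f. \<Sum>i\<in>UNIV. \<Sum>j\<in>UNIV. P i j * f i j"
  have S_add: "?S (\<lambda>i j. f i j + f' i j) = ?S f + ?S f'" for f f'
    by (simp add: distrib_left sum.distrib)
  have S_diff: "?S (\<lambda>i j. f i j - f' i j) = ?S f - ?S f'" for f f'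
    by (simp add: right_diff_distrib sum_subtractf)
  have S_mult: "?S (\<lambda>i j. k * f i j) = k * ?S f" for k f
    by (simp add: sum_distrib_left mult.left_commute)
  show ?thesis
    unfolding dY S_add S_diff S_mult n alt shape by (simp add: algebra_simps)
qed

text \<open>The formula \<open>div Y = \<Sum>\<^sub>i \<partial>\<^sub>i (R y\<^sub>i) / R\<close> with \<open>R = sqrt (det g)\<close>, at a single point: the hypothesis
  on \<open>dR\<close> is Jacobi's formula for \<open>R\<close>, and \<open>F2 i j\<close> is the derivative of the frame vector \<open>F1 j\<close> in
  direction \<open>i\<close>. Its symmetry makes the Christoffel terms on both sides agree.\<close>

lemma divergence_in_coordinates:
  fixes F1 :: "'n::finite \<Rightarrow> 'n V" and F2 :: "'n \<Rightarrow> 'n \<Rightarrow> 'n V" and P :: "'n \<Rightarrow> 'n \<Rightarrow> real"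
  assumes P: "\<And>i j. P i j = P j i" "\<And>i k. (\<Sum>j\<in>UNIV. P i j * \<langle>F1 j, F1 k\<rangle>\<^sub>V) = (if i = k then 1 else 0)"
    and F2: "\<And>i j. F2 i j = F2 j i"
    and dR: "\<And>i. dR i = R / 2 * (\<Sum>j\<in>UNIV. \<Sum>l\<in>UNIV. P j l * (\<langle>F2 i l, F1 j\<rangle>\<^sub>V + \<langle>F1 l, F2 i j\<rangle>\<^sub>V))"
    and dY: "\<And>i. dY i = (\<Sum>j\<in>UNIV. dy i j *\<^sub>R F1 j + y j *\<^sub>R F2 i j)"
  shows "(\<Sum>i\<in>UNIV. dR i * y i + R * dy i i) = R * (\<Sum>i\<in>UNIV. \<Sum>j\<in>UNIV. P i j * \<langle>dY i, F1 j\<rangle>\<^sub>V)"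
proof -
  have swap: "(\<Sum>j\<in>UNIV. \<Sum>l\<in>UNIV. P j l * \<langle>F2 i l, F1 j\<rangle>\<^sub>V) = (\<Sum>j\<in>UNIV. \<Sum>l\<in>UNIV. P j l * \<langle>F2 i j, F1 l\<rangle>\<^sub>V)" for i
    by (subst sum.swap) (simp add: P(1))
  have dR': "dR i = R * (\<Sum>j\<in>UNIV. \<Sum>l\<in>UNIV. P j l * \<langle>F2 i j, F1 l\<rangle>\<^sub>V)" for i
    unfolding dR
    by (simp add: distrib_left sum.distrib swap ip_commute[of "F1 _" "F2 _ _"])
  have "(\<Sum>i\<in>UNIV. \<Sum>j\<in>UNIV. P i j * \<langle>dY i, F1 j\<rangle>\<^sub>V)
      = (\<Sum>i\<in>UNIV. \<Sum>j\<in>UNIV. \<Sum>l\<in>UNIV. dy i l * (P i j * \<langle>F1 j, F1 l\<rangle>\<^sub>V))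
        + (\<Sum>i\<in>UNIV. \<Sum>j\<in>UNIV. \<Sum>l\<in>UNIV. y l * (P i j * \<langle>F2 i l, F1 j\<rangle>\<^sub>V))"
    by (simp add: dY ip_simps sum.distrib sum_distrib_left distrib_left mult_ac ip_commute[of "F1 _" "F1 _"])
  also have "(\<Sum>i\<in>UNIV. \<Sum>j\<in>UNIV. \<Sum>l\<in>UNIV. dy i l * (P i j * \<langle>F1 j, F1 l\<rangle>\<^sub>V)) = (\<Sum>i\<in>UNIV. dy i i)"
  proof (rule sum.cong[OF refl])
    fix i
    have "(\<Sum>j\<in>UNIV. \<Sum>l\<in>UNIV. dy i l * (P i j * \<langle>F1 j, F1 l\<rangle>\<^sub>V))
        = (\<Sum>l\<in>UNIV. dy i l * (\<Sum>j\<in>UNIV. P i j * \<langle>F1 j, F1 l\<rangle>\<^sub>V))"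
      by (subst sum.swap) (simp add: sum_distrib_left)
    also have "\<dots> = dy i i" by (simp add: P(2) if_distrib[of "\<lambda>y. _ * y"] cong: if_cong)
    finally show "(\<Sum>j\<in>UNIV. \<Sum>l\<in>UNIV. dy i l * (P i j * \<langle>F1 j, F1 l\<rangle>\<^sub>V)) = dy i i" .
  qed
  also have "(\<Sum>i\<in>UNIV. \<Sum>j\<in>UNIV. \<Sum>l\<in>UNIV. y l * (P i j * \<langle>F2 i l, F1 j\<rangle>\<^sub>V))
      = (\<Sum>l\<in>UNIV. y l * (\<Sum>i\<in>UNIV. \<Sum>j\<in>UNIV. P i j * \<langle>F2 l i, F1 j\<rangle>\<^sub>V))"
  proof -
    have "(\<Sum>i\<in>UNIV. \<Sum>j\<in>UNIV. \<Sum>l\<in>UNIV. y l * (P i j * \<langle>F2 i l, F1 j\<rangle>\<^sub>V))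
        = (\<Sum>i\<in>UNIV. \<Sum>l\<in>UNIV. \<Sum>j\<in>UNIV. y l * (P i j * \<langle>F2 l i, F1 j\<rangle>\<^sub>V))"
    proof (rule sum.cong[OF refl])
      fix i
      show "(\<Sum>j\<in>UNIV. \<Sum>l\<in>UNIV. y l * (P i j * \<langle>F2 i l, F1 j\<rangle>\<^sub>V))
          = (\<Sum>l\<in>UNIV. \<Sum>j\<in>UNIV. y l * (P i j * \<langle>F2 l i, F1 j\<rangle>\<^sub>V))"
        by (subst sum.swap, intro sum.cong refl, subst F2, rule refl)
    qed
    also have "\<dots> = (\<Sum>l\<in>UNIV. \<Sum>i\<in>UNIV. \<Sum>j\<in>UNIV. y l * (P i j * \<langle>F2 l i, F1 j\<rangle>\<^sub>V))"
      by (rule sum.swap)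
    finally show ?thesis by (simp add: sum_distrib_left)
  qed
  finally show ?thesis
    by (simp add: dR' sum.distrib sum_distrib_left distrib_left mult_ac)
qed


section \<open>The flux field in a chart\<close>

lemma C1_on_ip: "C1_on W f \<Longrightarrow> C1_on W g \<Longrightarrow> C1_on W (\<lambda>x. \<langle>f x, g x\<rangle>\<^sub>V)"
  by (rule C1_on_bilinear[OF bounded_bilinear_ip])

lemma C1_on_flux_field:
  assumes "C1_on W G" "C1_on W N"
  shows "C1_on W (\<lambda>x. flux_field c E A B \<kappa> (G x) (N x))"
  unfolding flux_field_def T_field_def X_field_def rho_fun_def s_fun_def
  by (intro C1_on_add C1_on_diff C1_on_scaleR C1_on_ip C1_on_mult C1_on_const assms)

lemma has_derivative_locally_constant:
  assumes "(u has_derivative u') (at x)" "open Q" "x \<in> Q" "\<And>y. y \<in> Q \<Longrightarrow> u y = a"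
  shows "u' v = 0"
proof -
  have "(u has_derivative (\<lambda>v. 0)) (at x)"
    by (rule has_derivative_transform_within_open[OF has_derivative_const assms(2,3)])
      (use assms(4) in auto)
  then show ?thesis using has_derivative_unique[OF assms(1)] by simp
qed

lemma frechet_derivative_apply:
  "(f has_derivative f') (at x) \<Longrightarrow> frechet_derivative f (at x) v = f' v"
  by (simp flip: frechet_derivative_at)

context immersed_hypersurface
begin

lemma F_space_form: "p \<in> M \<Longrightarrow> F p \<in> space_form E"
  using immersion by (auto simp: spacelike_immersion_def)

text \<open>The equations of the space form are differentiated within the chart image, which covers boundary
  points as well.\<close>

lemma chart_deriv_tangent:
  assumes ch: "(U, \<phi>) \<in> \<A>" and p: "p \<in> U"
  shows "chart_deriv F (U, \<phi>) p v \<in> tangent_space_form E (F p)"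
proof -
  let ?f = "F \<circ> inv_into U \<phi>"
  note i = chart_inv[OF ch]
  have D: "(?f has_derivative chart_deriv F (U, \<phi>) p) (at (\<phi> p) within \<phi> ` U)"
    by (rule has_derivative_chart_deriv[OF ch p])
  have sf: "?f x \<in> space_form E" if "x \<in> \<phi> ` U" for x
    using F_space_form i(3)[OF that] chart_subset[OF ch] by auto
  have fp: "?f (\<phi> p) = F p" using i p by simp
  have const: "f' = (\<lambda>v. 0)"
    if "(f has_derivative f') (at (\<phi> p) within \<phi> ` U)" "\<And>x. x \<in> \<phi> ` U \<Longrightarrow> f x = a"
    for f f' and a :: real
  proof (rule has_derivative_unique_half_space[OF chart_image_openin[OF ch] _ that(1)])
    show "(f has_derivative (\<lambda>v. 0)) (at (\<phi> p) within \<phi> ` U)"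
      by (rule has_derivative_transform[OF _ _ has_derivative_const[of a]]) (use that(2) p in auto)
  qed (use p in auto)
  have "(\<lambda>v. \<langle>F p, chart_deriv F (U, \<phi>) p v\<rangle>\<^sub>V + \<langle>chart_deriv F (U, \<phi>) p v, F p\<rangle>\<^sub>V) = (\<lambda>v. 0)"
    by (rule const[OF ip.FDERIV[OF D D, unfolded fp], of 0]) (use sf in \<open>auto simp: space_form_def\<close>)
  then have "\<langle>chart_deriv F (U, \<phi>) p v, F p\<rangle>\<^sub>V = 0"
    using ip_commute[of "F p"] by (auto dest: fun_cong[of _ _ v])
  moreover have "(\<lambda>v. \<langle>chart_deriv F (U, \<phi>) p v, E\<rangle>\<^sub>V) = (\<lambda>v. 0)"
    by (rule const[OF bounded_linear.has_derivative[OF ip.bounded_linear_left D], of E 1])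
      (use sf in \<open>auto simp: space_form_def\<close>)
  ultimately show ?thesis by (auto simp: tangent_space_form_def dest: fun_cong[of _ _ v])
qed

lemma continuous_on_M_chartwise:
  fixes f :: "'m \<Rightarrow> 'b::topological_space"
  assumes "\<And>U \<phi>. (U, \<phi>) \<in> \<A> \<Longrightarrow> continuous_on (\<phi> ` U) (f \<circ> inv_into U \<phi>)"
  shows "continuous_on M f"
  unfolding continuous_on_eq_continuous_within
proof
  fix p assume "p \<in> M"
  then obtain U \<phi> where ch: "(U, \<phi>) \<in> \<A>" and p: "p \<in> U"
    using atlas by (auto simp: smooth_atlas_def)
  have "continuous_on U ((f \<circ> inv_into U \<phi>) \<circ> \<phi>)"
    by (rule continuous_on_compose[OF chart_inv(5)[OF ch] assms[OF ch]])
  then have "continuous_on U f"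
    by (rule continuous_on_eq) (simp add: chart_inv[OF ch])
  then have "continuous (at p within U) f" using p by (simp add: continuous_on_eq_continuous_within)
  moreover have "at p within U = at p within M"
  proof -
    obtain T where T: "open T" "U = M \<inter> T" using chart_openin[OF ch] by (auto simp: openin_open)
    show ?thesis unfolding T(2)
      by (rule at_within_nhd[OF _ T(1)]) (use p T in auto)
  qed
  ultimately show "continuous (at p within M) f" by simp
qed

lemma smooth_map_continuous:
  fixes f :: "'m \<Rightarrow> 'b::real_normed_vector"
  assumes "smooth_map \<A> f"
  shows "continuous_on M f"
proof (rule continuous_on_M_chartwise)
  fix U \<phi> assume ch: "(U, \<phi>) \<in> \<A>"
  then have "smooth_on (\<phi> ` U) (f \<circ> inv_into U \<phi>)" using assms by (auto simp: smooth_map_def)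
  then show "continuous_on (\<phi> ` U) (f \<circ> inv_into U \<phi>)"
    unfolding continuous_on_eq_continuous_within
    using smooth_on_has_derivative[OF chart_image_openin[OF ch]] has_derivative_continuous by blast
qed

lemma F_continuous: "continuous_on M F"
  using immersion by (intro smooth_map_continuous) (simp add: spacelike_immersion_def)

text \<open>A function whose differential is \<open>v \<mapsto> e \<bullet> dF v\<close> for a field \<open>e\<close> with values in \<open>V\<close>. The field
  \<open>e\<close> represents the differential in all charts at once.\<close>

definition has_V_gradient :: "('m \<Rightarrow> real) \<Rightarrow> ('m \<Rightarrow> 'n V) \<Rightarrow> bool"
  where "has_V_gradient f e \<longleftrightarrow> continuous_on M f \<and> continuous_on M e \<and>
    (\<forall>(U, \<phi>)\<in>\<A>. \<forall>p\<in>U. ((f \<circ> inv_into U \<phi>) has_derivative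
      (\<lambda>v. e p \<bullet> chart_deriv F (U, \<phi>) p v)) (at (\<phi> p) within \<phi> ` U))"

end

locale capillary_hypersurface = compact_hypersurface k M \<A> E F
  for k :: "'n::finite" and M :: "'m::t2_space set" and \<A> :: "('m, 'n) chart set"
    and E :: "'n V" and F :: "'m \<Rightarrow> 'n V" +
  fixes c H \<gamma> :: real and A B :: "'n V" and \<nu> \<mu> :: "'m \<Rightarrow> 'n V"
  assumes E: "\<langle>E, E\<rangle>\<^sub>V = - c" and A: "\<langle>A, A\<rangle>\<^sub>V < 0"
    and normal: "unit_timelike_normal M \<A> E F \<nu>"
    and conormal: "outward_unit_conormal k \<A> F \<mu>"
    and capillary: "capillary c E A k \<A> F \<nu> \<mu> H \<gamma>"
begin

abbreviation \<kappa> :: real where "\<kappa> \<equiv> lambda_const A * cosh \<gamma>"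

definition flux :: "'m \<Rightarrow> 'n V"
  where "flux p = flux_field c E A B \<kappa> (F p) (\<nu> p)"

lemma normal_facts:
  assumes "p \<in> M"
  shows normal_tangent: "\<nu> p \<in> tangent_space_form E (F p)" and normal_unit: "\<langle>\<nu> p, \<nu> p\<rangle>\<^sub>V = - 1"
  using assms normal by (auto simp: unit_timelike_normal_def)

lemma normal_orthogonal: "(U, \<phi>) \<in> \<A> \<Longrightarrow> p \<in> U \<Longrightarrow> \<langle>\<nu> p, chart_deriv F (U, \<phi>) p v\<rangle>\<^sub>V = 0"
  using normal by (fastforce simp: unit_timelike_normal_def)

lemma normal_smooth: "(U, \<phi>) \<in> \<A> \<Longrightarrow> smooth_on (\<phi> ` U) (\<nu> \<circ> inv_into U \<phi>)"
  using normal by (auto simp: unit_timelike_normal_def smooth_map_def)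

lemma normal_continuous: "continuous_on M \<nu>"
  using normal by (intro smooth_map_continuous) (simp add: unit_timelike_normal_def)

lemma flux_continuous: "continuous_on M flux"
  unfolding flux_def flux_field_def T_field_def X_field_def rho_fun_def s_fun_def
  by (intro continuous_intros ip.continuous_on F_continuous normal_continuous)

lemma phi_fun_continuous: "continuous_on M (phi_fun c E A B H \<gamma> F \<nu>)"
  unfolding phi_fun_def psi_fun_def K_field_def T_field_def X_field_def rho_fun_def s_fun_def
  by (intro continuous_intros ip.continuous_on F_continuous normal_continuous)

lemma flux_coordinates:
  assumes ch: "(U, \<phi>) \<in> \<A>" and p: "p \<in> U"
  obtains y where "flux p = chart_deriv F (U, \<phi>) p y"
proof -
  let ?F1 = "\<lambda>i. chart_deriv F (U, \<phi>) p (axis i 1)"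
  have pM: "p \<in> M" using chart_subset[OF ch] p by auto
  note sf = F_space_form[OF pM] and nt = normal_tangent[OF pM] and nu = normal_unit[OF pM]
  obtain x r s t where w: "flux p = (\<Sum>i\<in>UNIV. x $ i *\<^sub>R ?F1 i) + r *\<^sub>R \<nu> p + s *\<^sub>R F p + t *\<^sub>R E"
  proof (rule moving_frame_spans[OF sf nt nu])
    show "?F1 i \<in> tangent_space_form E (F p)" "\<langle>\<nu> p, ?F1 i\<rangle>\<^sub>V = 0" for i
      by (rule chart_deriv_tangent[OF ch p], rule normal_orthogonal[OF ch p])
    show "0 < \<langle>\<Sum>i\<in>UNIV. v $ i *\<^sub>R ?F1 i, \<Sum>i\<in>UNIV. v $ i *\<^sub>R ?F1 i\<rangle>\<^sub>V" if "v \<noteq> 0" for v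
      using chart_deriv_positive[OF ch p that] by (simp add: chart_deriv_expand[OF ch p, of v])
  qed
  then have w: "flux p = chart_deriv F (U, \<phi>) p x + r *\<^sub>R \<nu> p + s *\<^sub>R F p + t *\<^sub>R E"
    by (simp add: chart_deriv_expand[OF ch p, of x])
  have o1: "\<langle>chart_deriv F (U, \<phi>) p x, F p\<rangle>\<^sub>V = 0" "\<langle>chart_deriv F (U, \<phi>) p x, E\<rangle>\<^sub>V = 0"
    using chart_deriv_tangent[OF ch p, of x] by (auto simp: tangent_space_form_def)
  have o2: "\<langle>chart_deriv F (U, \<phi>) p x, \<nu> p\<rangle>\<^sub>V = 0"
    using normal_orthogonal[OF ch p, of x] ip_commute by metis
  have o3: "\<langle>\<nu> p, F p\<rangle>\<^sub>V = 0" "\<langle>\<nu> p, E\<rangle>\<^sub>V = 0" "\<langle>F p, \<nu> p\<rangle>\<^sub>V = 0" "\<langle>E, \<nu> p\<rangle>\<^sub>V = 0"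
    using nt ip_commute[of "F p" "\<nu> p"] ip_commute[of E "\<nu> p"] by (auto simp: tangent_space_form_def)
  have o4: "\<langle>F p, F p\<rangle>\<^sub>V = 0" "\<langle>F p, E\<rangle>\<^sub>V = 1" "\<langle>E, F p\<rangle>\<^sub>V = 1"
    using sf ip_commute[of E "F p"] by (auto simp: space_form_def)
  note ft = flux_field_tangent[OF sf E nt nu, of A B \<kappa>, folded flux_def]
  have "r = 0" using ft(3) by (simp add: w ip_simps o2 o3 nu)
  moreover have t: "t = 0" using ft(1) by (simp add: w ip_simps o1 o3 o4)
  moreover have "s = 0" using ft(2) by (simp add: w ip_simps o1 o3 o4 t)
  ultimately show ?thesis using w that by simp
qed

text \<open>In a chart the conormal is transversal to the boundary and orthogonal to its directions. Hence a
  tangent vector orthogonal to the conormal has no transversal component.\<close>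

lemma flux_boundary:
  assumes ch: "(U, \<phi>) \<in> \<A>" and p: "p \<in> U" "\<phi> p $ k = 0" and y: "flux p = chart_deriv F (U, \<phi>) p y"
  shows "y $ k = 0"
proof -
  have pM: "p \<in> M" using chart_subset[OF ch] p by auto
  have bd: "p \<in> manifold_boundary k \<A>" using ch p by (auto simp: manifold_boundary_def)
  have "F p \<in> support_hypersurface E A"
    and N: "support_normal c E A (F p) = cosh \<gamma> *\<^sub>R \<nu> p - sinh \<gamma> *\<^sub>R \<mu> p"
    using capillary bd by (auto simp: capillary_def)
  moreover obtain v where v: "\<mu> p = chart_deriv F (U, \<phi>) p v" "v $ k < 0"
    and orth: "\<And>w. w $ k = 0 \<Longrightarrow> \<langle>\<mu> p, chart_deriv F (U, \<phi>) p w\<rangle>\<^sub>V = 0" and unit: "\<langle>\<mu> p, \<mu> p\<rangle>\<^sub>V = 1"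
    using conormal bd ch p(1) unfolding outward_unit_conormal_def by fastforce
  ultimately have zero: "\<langle>flux p, \<mu> p\<rangle>\<^sub>V = 0"
    using normal_orthogonal[OF ch p(1), of v] E A normal_tangent[OF pM] normal_unit[OF pM]
    unfolding flux_def by (intro flux_field_boundary) auto
  \<comment> \<open>The part of \<open>y\<close> beyond \<open>a v\<close> is a boundary direction.\<close>
  define a where "a = y $ k / v $ k"
  define w where "w = y - a *\<^sub>R v"
  have w: "w $ k = 0" using v(2) by (simp add: w_def a_def)
  note lin = chart_deriv_linear[OF ch p(1)]
  have "flux p = chart_deriv F (U, \<phi>) p (a *\<^sub>R v + w)" by (simp add: y w_def)
  also have "\<dots> = a *\<^sub>R \<mu> p + chart_deriv F (U, \<phi>) p w"
    by (simp add: linear_add[OF lin] linear_cmul[OF lin] v(1))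
  finally have fl: "flux p = a *\<^sub>R \<mu> p + chart_deriv F (U, \<phi>) p w" .
  have "\<langle>flux p, \<mu> p\<rangle>\<^sub>V = a"
    using orth[OF w] unit ip_commute[of "chart_deriv F (U, \<phi>) p w" "\<mu> p"] by (simp add: fl ip_simps)
  then show ?thesis using zero v(2) by (simp add: a_def)
qed

end

text \<open>The immersion and its normal field have differentiable extensions to an open set \<open>W\<close> of \<open>\<real>\<^sup>n\<close>, so
  that ordinary derivatives are available at boundary points too. The geometric identities hold on
  \<open>S\<close>, the part of \<open>W\<close> inside the chart image; they can be differentiated where \<open>x\<^sub>k > 0\<close>.\<close>

locale local_extension = capillary_hypersurface k M \<A> E F c H \<gamma> A B \<nu> \<mu>
  for k :: "'n::finite" and M :: "'m::t2_space set" and \<A> :: "('m, 'n) chart set"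
    and E :: "'n V" and F :: "'m \<Rightarrow> 'n V" and c H \<gamma> :: real and A B :: "'n V"
    and \<nu> \<mu> :: "'m \<Rightarrow> 'n V" +
  fixes U :: "'m set" and \<phi> :: "'m \<Rightarrow> real^'n" and W :: "(real^'n) set" and G N :: "real^'n \<Rightarrow> 'n V"
  assumes ch: "(U, \<phi>) \<in> \<A>" and W: "open W"
    and G: "C1_on W G" "\<And>v. C1_on W (\<lambda>x. frechet_derivative G (at x) v)"
    and N: "C1_on W N"
    and G_eq: "\<And>x. x \<in> \<phi> ` U \<Longrightarrow> x \<in> W \<Longrightarrow> G x = F (inv_into U \<phi> x)"
    and N_eq: "\<And>x. x \<in> \<phi> ` U \<Longrightarrow> x \<in> W \<Longrightarrow> N x = \<nu> (inv_into U \<phi> x)"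
begin

abbreviation \<psi> :: "real^'n \<Rightarrow> 'm" where "\<psi> \<equiv> inv_into U \<phi>"

definition S :: "(real^'n) set" where "S = \<phi> ` U \<inter> W"

definition F1 :: "'n \<Rightarrow> real^'n \<Rightarrow> 'n V" where "F1 i x = frechet_derivative G (at x) (axis i 1)"
definition F2 :: "'n \<Rightarrow> 'n \<Rightarrow> real^'n \<Rightarrow> 'n V"
  where "F2 i j x = frechet_derivative (F1 j) (at x) (axis i 1)"
definition N1 :: "'n \<Rightarrow> real^'n \<Rightarrow> 'n V" where "N1 i x = frechet_derivative N (at x) (axis i 1)"
definition g :: "real^'n \<Rightarrow> real^'n^'n" where "g x = (\<chi> i j. \<langle>F1 i x, F1 j x\<rangle>\<^sub>V)"
definition Y :: "real^'n \<Rightarrow> 'n V" where "Y x = flux_field c E A B \<kappa> (G x) (N x)"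
text \<open>The components of the flux field in the frame \<open>F1\<close>, written by Cramer's rule so that they are
  visibly differentiable.\<close>

definition y :: "'n \<Rightarrow> real^'n \<Rightarrow> real"
  where "y i x = det (\<chi> a j. if j = i then \<langle>Y x, F1 a x\<rangle>\<^sub>V else g x $ a $ j) * inverse (det (g x))"

text \<open>Outside of the chart image the extended metric may degenerate.\<close>

definition W' :: "(real^'n) set" where "W' = {x\<in>W. 0 < det (g x)}"
definition z :: "'n \<Rightarrow> real^'n \<Rightarrow> real" where "z i x = sqrt (det (g x)) * y i x"

lemma C1_F1: "C1_on W (F1 i)"
  unfolding F1_def by (rule G(2))

lemma C1_g: "C1_on W (\<lambda>x. g x $ i $ j)"
  unfolding g_def by (simp, intro C1_on_ip C1_F1)

lemma C1_det_g: "C1_on W (\<lambda>x. det (g x))"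
  by (intro C1_on_det C1_g)

lemma C1_Y: "C1_on W Y"
  unfolding Y_def by (rule C1_on_flux_field[OF G(1) N])

lemma C1_y: "C1_on W' (y i)"
  unfolding y_def
proof (intro C1_on_mult C1_on_det C1_on_inverse)
  have WW': "W' \<subseteq> W" by (auto simp: W'_def)
  show "C1_on W' (\<lambda>x. (\<chi> a j. if j = i then \<langle>Y x, F1 a x\<rangle>\<^sub>V else g x $ a $ j) $ b $ j)" for b j
    using C1_on_subset[OF C1_on_ip[OF C1_Y C1_F1] WW'] C1_on_subset[OF C1_g WW'] by (cases "j = i") auto
  show "C1_on W' (\<lambda>x. g x $ b $ j)" for b j using C1_on_subset[OF C1_g WW'] .
qed (auto simp: W'_def)

lemma C1_sqrt_det: "C1_on W' (\<lambda>x. sqrt (det (g x)))"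
  by (rule C1_on_sqrt) (auto simp: W'_def intro: C1_on_subset[OF C1_det_g])

lemma C1_z: "C1_on W' (z i)"
  unfolding z_def by (intro C1_on_mult C1_sqrt_det C1_y)

lemma S_point:
  assumes "x \<in> S"
  shows "\<psi> x \<in> U" "\<phi> (\<psi> x) = x" "\<psi> x \<in> M" "x \<in> \<phi> ` U" "x \<in> W"
    "G x = F (\<psi> x)" "N x = \<nu> (\<psi> x)" "Y x = flux (\<psi> x)"
  using assms chart_inv[OF ch] chart_subset[OF ch] G_eq N_eq
  by (auto simp: S_def Y_def flux_def)

lemma chart_deriv_extension:
  assumes x: "x \<in> S"
  shows chart_deriv_F1: "chart_deriv F (U, \<phi>) (\<psi> x) (axis i 1) = F1 i x"
    and chart_deriv_F1_sum: "chart_deriv F (U, \<phi>) (\<psi> x) v = (\<Sum>i\<in>UNIV. v $ i *\<^sub>R F1 i x)"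
proof -
  note xs = S_point[OF x]
  have "((F \<circ> \<psi>) has_derivative frechet_derivative G (at x)) (at x within \<phi> ` U)"
    by (rule has_derivative_extension[OF W xs(5,4) C1_on_has_derivative[OF G(1) xs(5)]]) (simp add: G_eq)
  then show 1: "chart_deriv F (U, \<phi>) (\<psi> x) (axis i 1) = F1 i x" for i
    by (simp add: frechet_derivative_half_space[OF chart_image_openin[OF ch] xs(4)]
        chart_deriv_def xs(2) F1_def)
  show "chart_deriv F (U, \<phi>) (\<psi> x) v = (\<Sum>i\<in>UNIV. v $ i *\<^sub>R F1 i x)"
    using chart_deriv_expand[OF ch xs(1), of v] by (simp add: 1)
qed

lemma chart_deriv_N1:
  assumes x: "x \<in> S"
  shows "chart_deriv \<nu> (U, \<phi>) (\<psi> x) (axis i 1) = N1 i x"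
proof -
  note xs = S_point[OF x]
  have "((\<nu> \<circ> \<psi>) has_derivative frechet_derivative N (at x)) (at x within \<phi> ` U)"
    by (rule has_derivative_extension[OF W xs(5,4) C1_on_has_derivative[OF N xs(5)]]) (simp add: N_eq)
  then show ?thesis
    by (simp add: frechet_derivative_half_space[OF chart_image_openin[OF ch] xs(4)]
        chart_deriv_def xs(2) N1_def)
qed

lemma g_metric: "x \<in> S \<Longrightarrow> g x = metric_matrix F (U, \<phi>) (\<psi> x)"
  by (simp add: g_def metric_matrix_def chart_deriv_F1)

lemma det_g_pos: "x \<in> S \<Longrightarrow> 0 < det (g x)"
  using metric_det_pos[OF ch] S_point(1) by (simp add: g_metric)

lemma S_W': "S \<subseteq> W'"
  using det_g_pos by (auto simp: W'_def S_def)

lemma F1_tangent: "x \<in> S \<Longrightarrow> F1 i x \<in> tangent_space_form E (G x)"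
  using chart_deriv_tangent[OF ch S_point(1), of x "axis i 1"] by (simp add: chart_deriv_F1 S_point)

lemma F1_normal: "x \<in> S \<Longrightarrow> \<langle>N x, F1 i x\<rangle>\<^sub>V = 0"
  using normal_orthogonal[OF ch S_point(1), of x "axis i 1"] by (simp add: chart_deriv_F1 S_point)

lemma Y_coordinates:
  assumes x: "x \<in> S"
  shows "Y x = (\<Sum>i\<in>UNIV. y i x *\<^sub>R F1 i x)" "flux (\<psi> x) = chart_deriv F (U, \<phi>) (\<psi> x) (\<chi> i. y i x)"
proof -
  obtain w where w: "flux (\<psi> x) = chart_deriv F (U, \<phi>) (\<psi> x) w"
    using flux_coordinates[OF ch S_point(1)[OF x]] .
  then have Yw: "Y x = (\<Sum>i\<in>UNIV. w $ i *\<^sub>R F1 i x)"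
    using S_point(8)[OF x] chart_deriv_F1_sum[OF x] by simp
  have "g x *v w = (\<chi> a. \<langle>Y x, F1 a x\<rangle>\<^sub>V)"
    by (simp add: Yw matrix_vector_mult_def vec_eq_iff g_def ip_simps ip_commute[of "F1 _ x" "F1 _ x"] mult.commute)
  then have "w = (\<chi> i. det (\<chi> a j. if j = i then (\<chi> a. \<langle>Y x, F1 a x\<rangle>\<^sub>V) $ a else g x $ a $ j) / det (g x))"
    using cramer[of "g x" w] det_g_pos[OF x] by simp
  then have wy: "w $ i = y i x" for i
    by (subst (asm) vec_eq_iff) (simp add: y_def divide_inverse cong: if_cong)
  then show "Y x = (\<Sum>i\<in>UNIV. y i x *\<^sub>R F1 i x)" using Yw by simp
  have "w = (\<chi> i. y i x)" by (simp add: vec_eq_iff wy)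
  then show "flux (\<psi> x) = chart_deriv F (U, \<phi>) (\<psi> x) (\<chi> i. y i x)" using w by simp
qed

lemma inside_interior:
  assumes x: "x \<in> S" "0 < x $ k"
  obtains Q where "open Q" "x \<in> Q" "Q \<subseteq> S" "\<And>y. y \<in> Q \<Longrightarrow> 0 < y $ k"
proof -
  obtain T where T: "open T" "\<phi> ` U = half_space k \<inter> T"
    using chart_image_openin[OF ch] by (auto simp: openin_open)
  have "open (T \<inter> W \<inter> {y. 0 < y $ k})"
    by (intro open_Int T W open_Collect_less continuous_intros)
  moreover have "x \<in> T \<inter> W \<inter> {y. 0 < y $ k}"
    using x unfolding S_def T(2) by simp
  moreover have "T \<inter> W \<inter> {y. 0 < y $ k} \<subseteq> S"
    unfolding S_def T(2) half_space_def by (rule subsetI) simp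
  ultimately show ?thesis using that by blast
qed

lemma inverse_metric:
  assumes x: "x \<in> S"
  defines "P \<equiv> \<lambda>i j. matrix_inv (g x) $ i $ j"
  shows "P i j = P j i" "(\<Sum>j\<in>UNIV. P i j * \<langle>F1 j x, F1 l x\<rangle>\<^sub>V) = (if i = l then 1 else 0)"
proof -
  let ?P = "matrix_inv (g x)"
  have inv: "invertible (g x)" using det_g_pos[OF x] by (simp add: invertible_det_nz)
  have sym: "transpose (g x) = g x"
    by (simp add: transpose_def g_def vec_eq_iff ip_commute[of "F1 _ x" "F1 _ x"])
  have "transpose ?P ** g x = mat 1"
    using arg_cong[OF matrix_inv_invertible(1)[OF inv], of transpose]
    by (simp add: matrix_transpose_mul sym transpose_mat)
  then have "transpose ?P ** (g x ** ?P) = ?P"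
    by (simp add: matrix_mul_assoc)
  then have "transpose ?P = ?P"
    by (simp add: matrix_inv_invertible(1)[OF inv])
  then have "transpose ?P $ j $ i = ?P $ j $ i" by simp
  then show "P i j = P j i" by (simp add: P_def transpose_def)
  have "(?P ** g x) $ i $ l = mat 1 $ i $ l" by (simp add: matrix_inv_invertible(2)[OF inv])
  then show "(\<Sum>j\<in>UNIV. P i j * \<langle>F1 j x, F1 l x\<rangle>\<^sub>V) = (if i = l then 1 else 0)"
    by (simp add: P_def matrix_matrix_mult_def g_def mat_def)
qed

text \<open>Derivatives of the identities \<open>\<langle>\<nu>, \<nu>\<rangle> = - 1\<close>, \<open>\<langle>\<nu>, \<xi>\<rangle> = 0\<close>, \<open>\<langle>\<nu>, E\<rangle> = 0\<close> and \<open>\<langle>\<nu>, dF\<rangle> = 0\<close>.\<close>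

lemma N1_facts:
  assumes x: "x \<in> S" "0 < x $ k"
  shows "\<langle>N x, N1 i x\<rangle>\<^sub>V = 0" "\<langle>G x, N1 i x\<rangle>\<^sub>V = 0" "\<langle>E, N1 i x\<rangle>\<^sub>V = 0"
    "\<langle>N1 i x, F1 j x\<rangle>\<^sub>V = - \<langle>N x, F2 i j x\<rangle>\<^sub>V"
proof -
  obtain Q where Q: "open Q" "x \<in> Q" "Q \<subseteq> S" using inside_interior[OF x] by metis
  have xW: "x \<in> W" using S_point(5)[OF x(1)] .
  note dN = C1_on_has_derivative[OF N xW] and dG = C1_on_has_derivative[OF G(1) xW]
    and dF = C1_on_has_derivative[OF C1_F1 xW]
  have nt: "N w \<in> tangent_space_form E (G w)" "\<langle>N w, N w\<rangle>\<^sub>V = - 1" if "w \<in> Q" for w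
    using that Q(3) normal_tangent normal_unit S_point[of w] by auto
  have "\<langle>N x, N1 i x\<rangle>\<^sub>V + \<langle>N1 i x, N x\<rangle>\<^sub>V = 0"
    unfolding N1_def using nt(2)
    by (intro has_derivative_locally_constant[OF ip.FDERIV[OF dN dN] Q(1,2)]) auto
  then show "\<langle>N x, N1 i x\<rangle>\<^sub>V = 0" using ip_commute[of "N x" "N1 i x"] by simp
  have "\<langle>N x, F1 i x\<rangle>\<^sub>V + \<langle>N1 i x, G x\<rangle>\<^sub>V = 0"
    unfolding N1_def F1_def using nt(1)
    by (intro has_derivative_locally_constant[OF ip.FDERIV[OF dN dG] Q(1,2)]) (auto simp: tangent_space_form_def)
  then show "\<langle>G x, N1 i x\<rangle>\<^sub>V = 0" using F1_normal[OF x(1)] ip_commute[of "G x" "N1 i x"] by simp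
  have "\<langle>N1 i x, E\<rangle>\<^sub>V = 0"
    unfolding N1_def using nt(1)
    by (intro has_derivative_locally_constant[OF bounded_linear.has_derivative[OF ip.bounded_linear_left dN] Q(1,2)])
      (auto simp: tangent_space_form_def)
  then show "\<langle>E, N1 i x\<rangle>\<^sub>V = 0" using ip_commute[of E "N1 i x"] by simp
  have "\<langle>N x, F2 i j x\<rangle>\<^sub>V + \<langle>N1 i x, F1 j x\<rangle>\<^sub>V = 0"
    unfolding N1_def F2_def using F1_normal Q(3)
    by (intro has_derivative_locally_constant[OF ip.FDERIV[OF dN dF] Q(1,2)]) auto
  then show "\<langle>N1 i x, F1 j x\<rangle>\<^sub>V = - \<langle>N x, F2 i j x\<rangle>\<^sub>V" by simp
qed

lemma F2_symmetric: "x \<in> W \<Longrightarrow> F2 i j x = F2 j i x"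
  unfolding F2_def F1_def by (rule second_derivative_symmetric[OF W _ G])

lemma mean_curvature_trace:
  assumes x: "x \<in> S" "0 < x $ k"
  shows "(\<Sum>i\<in>UNIV. \<Sum>j\<in>UNIV. matrix_inv (g x) $ i $ j * \<langle>N1 i x, F1 j x\<rangle>\<^sub>V) = H"
proof -
  have t: "\<langle>tangent_proj c E (F (\<psi> x)) w, F1 j x\<rangle>\<^sub>V = \<langle>w, F1 j x\<rangle>\<^sub>V" for w j
    using tangent_proj_orthogonal[of "F1 j x" E "F (\<psi> x)" w c] F1_tangent[OF x(1), of j] S_point(6)[OF x(1)]
    by (simp add: ip_simps)
  have "mean_curvature c E F \<nu> (U, \<phi>) (\<psi> x) = H"
    using capillary ch S_point(1)[OF x(1)] by (force simp: capillary_def)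
  then have "H = (\<Sum>i\<in>UNIV. \<Sum>j\<in>UNIV. matrix_inv (g x) $ i $ j * \<langle>N1 j x, F1 i x\<rangle>\<^sub>V)"
    by (simp add: mean_curvature_def trace_def matrix_matrix_mult_def second_fundamental_matrix_def
        g_metric[OF x(1)] chart_deriv_F1[OF x(1)] chart_deriv_N1[OF x(1)] t)
  moreover have "\<langle>N1 j x, F1 i x\<rangle>\<^sub>V = \<langle>N1 i x, F1 j x\<rangle>\<^sub>V" for i j
    using N1_facts(4)[OF x] F2_symmetric[OF S_point(5)[OF x(1)], of i j] by simp
  ultimately show ?thesis by simp
qed

text \<open>The functions \<open>z i = sqrt (det g) y i\<close> are the weighted components of the flux field. Differentiating
  \<open>Y = \<Sum>\<^sub>i y\<^sub>i F1 i\<close> once in the frame and once by the explicit formula for \<open>Y\<close> links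
  \<open>divergence_in_coordinates\<close> with \<open>trace_flux_deriv\<close>.\<close>

lemma divergence_z:
  assumes x: "x \<in> S" "0 < x $ k"
  shows "(\<Sum>i\<in>UNIV. frechet_derivative (z i) (at x) (axis i 1))
    = sqrt (det (g x)) * phi_fun c E A B H \<gamma> F \<nu> (\<psi> x)"
proof -
  let ?P = "\<lambda>i j. matrix_inv (g x) $ i $ j" and ?R = "sqrt (det (g x))"
  let ?dR = "\<lambda>i. frechet_derivative (\<lambda>x. sqrt (det (g x))) (at x) (axis i 1)"
  let ?dy = "\<lambda>i j. frechet_derivative (y j) (at x) (axis i 1)"
  let ?dY = "\<lambda>i. flux_deriv c E A B \<kappa> (G x) (N x) (F1 i x) (N1 i x)"
  obtain Q where Q: "open Q" "x \<in> Q" "Q \<subseteq> S" using inside_interior[OF x] by metis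
  have xW: "x \<in> W" "x \<in> W'" using S_point(5)[OF x(1)] S_W' x(1) by auto
  have pos: "0 < det (g x)" using det_g_pos[OF x(1)] .
  have pM: "\<psi> x \<in> M" using S_point(3)[OF x(1)] .
  note P = inverse_metric[OF x(1)]
  note dF = C1_on_has_derivative[OF C1_F1 xW(1)]
  have dz: "frechet_derivative (z i) (at x) (axis i 1) = ?dR i * y i x + ?R * ?dy i i" for i
  proof -
    have "(z i has_derivative (\<lambda>v. ?R * frechet_derivative (y i) (at x) v
        + frechet_derivative (\<lambda>x. sqrt (det (g x))) (at x) v * y i x)) (at x)"
      unfolding z_def[abs_def] by (intro has_derivative_mult C1_on_has_derivative[OF C1_sqrt_det xW(2)]
        C1_on_has_derivative[OF C1_y xW(2)])
    from frechet_derivative_apply[OF this, of "axis i 1"] show ?thesis by (simp only: add.commute)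
  qed
  have dg: "((\<lambda>x. g x $ i $ j) has_derivative (\<lambda>v. \<langle>F1 i x, frechet_derivative (F1 j) (at x) v\<rangle>\<^sub>V
      + \<langle>frechet_derivative (F1 i) (at x) v, F1 j x\<rangle>\<^sub>V)) (at x)" for i j
    using ip.FDERIV[OF dF dF] by (simp add: g_def)
  have dR: "?dR i = ?R / 2 * (\<Sum>j\<in>UNIV. \<Sum>l\<in>UNIV. ?P j l * (\<langle>F2 i l x, F1 j x\<rangle>\<^sub>V + \<langle>F1 l x, F2 i j x\<rangle>\<^sub>V))" for i
  proof -
    let ?D = "\<lambda>v. det (g x) * (\<Sum>j\<in>UNIV. \<Sum>l\<in>UNIV. ?P j l * (\<langle>F1 l x, frechet_derivative (F1 j) (at x) v\<rangle>\<^sub>V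
      + \<langle>frechet_derivative (F1 l) (at x) v, F1 j x\<rangle>\<^sub>V))"
    have D: "((\<lambda>x. det (g x)) has_derivative ?D) (at x)"
      by (rule has_derivative_det[OF dg]) (use pos in simp)
    have "(sqrt has_derivative (\<lambda>h. h * (inverse ?R / 2))) (at (det (g x)))"
      using DERIV_real_sqrt[OF pos] unfolding has_field_derivative_def
      by (rule has_derivative_eq_rhs) (simp add: fun_eq_iff)
    from has_derivative_compose[where f="\<lambda>x. det (g x)" and g=sqrt, OF D this]
    have "((\<lambda>x. sqrt (det (g x))) has_derivative (\<lambda>v. ?D v * (inverse ?R / 2))) (at x)" .
    from frechet_derivative_apply[OF this, of "axis i 1"]
    have "?dR i = ?D (axis i 1) * (inverse ?R / 2)" .
    also have "\<dots> = (det (g x) * inverse ?R) / 2 * (\<Sum>j\<in>UNIV. \<Sum>l\<in>UNIV. ?P j l * (\<langle>F2 i l x, F1 j x\<rangle>\<^sub>V + \<langle>F1 l x, F2 i j x\<rangle>\<^sub>V))"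
      by (simp add: F2_def add.commute)
    also have "det (g x) * inverse ?R = ?R"
      using pos by (simp add: real_div_sqrt flip: divide_inverse)
    finally show ?thesis .
  qed
  have dY: "?dY i = (\<Sum>j\<in>UNIV. ?dy i j *\<^sub>R F1 j x + y j x *\<^sub>R F2 i j x)" for i
  proof -
    have 1: "(Y has_derivative (\<lambda>v. flux_deriv c E A B \<kappa> (G x) (N x)
        (frechet_derivative G (at x) v) (frechet_derivative N (at x) v))) (at x)"
      unfolding Y_def[abs_def] by (intro has_derivative_flux_field C1_on_has_derivative[OF G(1) xW(1)]
        C1_on_has_derivative[OF N xW(1)])
    have 2: "(Y has_derivative (\<lambda>v. \<Sum>j\<in>UNIV. frechet_derivative (y j) (at x) v *\<^sub>R F1 j x
        + y j x *\<^sub>R frechet_derivative (F1 j) (at x) v)) (at x)"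
    proof (rule has_derivative_transform_within_open[OF _ Q(1,2)])
      show "((\<lambda>w. \<Sum>j\<in>UNIV. y j w *\<^sub>R F1 j w) has_derivative
        (\<lambda>v. \<Sum>j\<in>UNIV. frechet_derivative (y j) (at x) v *\<^sub>R F1 j x
        + y j x *\<^sub>R frechet_derivative (F1 j) (at x) v)) (at x)"
        by (intro has_derivative_sum has_derivative_scaleR' dF C1_on_has_derivative[OF C1_y xW(2)])
      show "(\<Sum>j\<in>UNIV. y j w *\<^sub>R F1 j w) = Y w" if "w \<in> Q" for w
        using Y_coordinates(1)[of w] that Q(3) by auto
    qed
    show ?thesis
      using fun_cong[OF has_derivative_unique[OF 1 2], of "axis i 1"] by (simp only: F1_def F2_def N1_def)
  qed
  have "(\<Sum>i\<in>UNIV. frechet_derivative (z i) (at x) (axis i 1))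
      = ?R * (\<Sum>i\<in>UNIV. \<Sum>j\<in>UNIV. ?P i j * \<langle>?dY i, F1 j x\<rangle>\<^sub>V)"
    unfolding dz
    by (rule divergence_in_coordinates[where ?F1.0="\<lambda>i. F1 i x" and ?F2.0="\<lambda>i j. F2 i j x", OF P F2_symmetric[OF xW(1)] dR dY])
  also have "(\<Sum>i\<in>UNIV. \<Sum>j\<in>UNIV. ?P i j * \<langle>?dY i, F1 j x\<rangle>\<^sub>V) = real CARD('n) * psi_fun c E A B (G x)
      + (\<Sum>i\<in>UNIV. \<Sum>j\<in>UNIV. ?P i j * \<langle>N1 i x, F1 j x\<rangle>\<^sub>V) * \<langle>T_field c E A B (G x), N x\<rangle>\<^sub>V
      - real CARD('n) * \<kappa> * \<langle>K_field c E A B (G x), N x\<rangle>\<^sub>V"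
  proof (rule trace_flux_deriv)
    show "G x \<in> space_form E" using F_space_form[OF pM] S_point(6)[OF x(1)] by simp
    show "N x \<in> tangent_space_form E (G x)" "\<langle>N x, N x\<rangle>\<^sub>V = - 1"
      using normal_tangent[OF pM] normal_unit[OF pM] S_point[OF x(1)] by auto
    show "0 < \<langle>\<Sum>i\<in>UNIV. v $ i *\<^sub>R F1 i x, \<Sum>i\<in>UNIV. v $ i *\<^sub>R F1 i x\<rangle>\<^sub>V" if "v \<noteq> 0" for v
      using chart_deriv_positive[OF ch S_point(1)[OF x(1)] that] by (simp add: chart_deriv_F1_sum[OF x(1)])
    show "\<langle>N1 i x, F1 j x\<rangle>\<^sub>V = \<langle>N1 j x, F1 i x\<rangle>\<^sub>V" for i j
      using N1_facts(4)[OF x] F2_symmetric[OF xW(1), of i j] by simp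
  qed (rule E F1_tangent[OF x(1)] F1_normal[OF x(1)] N1_facts[OF x] P)+
  also have "\<dots> = phi_fun c E A B H \<gamma> F \<nu> (\<psi> x)"
    unfolding mean_curvature_trace[OF x] by (simp add: phi_fun_def S_point[OF x(1)])
  finally show ?thesis .
qed

end


section \<open>The local divergence theorem\<close>

lemma has_derivative_along_line:
  fixes u :: "'a::real_normed_vector \<Rightarrow> real"
  assumes "(u has_derivative D) (at x)"
  shows "((\<lambda>t. u (x + t *\<^sub>R e)) has_real_derivative D e) (at 0)"
proof -
  have 1: "((\<lambda>t::real. x + t *\<^sub>R e) has_derivative (\<lambda>h. h *\<^sub>R e)) (at 0)"
    by (auto intro!: derivative_eq_intros)
  have "(u has_derivative D) (at (x + (0::real) *\<^sub>R e))" using assms by simp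
  from has_derivative_compose[OF 1 this]
  have 2: "((\<lambda>t. u (x + t *\<^sub>R e)) has_derivative (\<lambda>h. D (h *\<^sub>R e))) (at 0)" .
  show ?thesis
    unfolding has_field_derivative_def
    by (rule has_derivative_eq_rhs[OF 2])
      (simp add: fun_eq_iff linear_cmul[OF has_derivative_linear[OF assms]] mult.commute)
qed

context local_extension
begin

text \<open>The divergence of \<open>f Y\<close> is \<open>f\<close> times the integrand plus the derivative of \<open>f\<close> in direction \<open>Y\<close>.
  In coordinates it becomes a sum of partial derivatives of functions with compact support, the
  \<open>k\<close>-th of which vanishes on the hyperplane.\<close>

lemma local_divergence_theorem:
  assumes grad: "has_V_gradient f e" and K: "compact K" "K \<subseteq> S"
    and off: "\<And>p. p \<in> M \<Longrightarrow> p \<notin> \<psi> ` K \<Longrightarrow> f p = 0 \<and> e p = 0"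
  shows "has_bochner_integral (volume_measure M \<A> F)
    (\<lambda>p. f p * phi_fun c E A B H \<gamma> F \<nu> p + e p \<bullet> flux p) 0"
proof -
  let ?q = "\<lambda>p. f p * phi_fun c E A B H \<gamma> F \<nu> p + e p \<bullet> flux p"
  have cf: "continuous_on M f" and ce: "continuous_on M e" using grad by (auto simp: has_V_gradient_def)
  have cq: "continuous_on M ?q"
    by (intro continuous_intros cf ce phi_fun_continuous flux_continuous)
  have c\<psi>: "continuous_on (\<phi> ` U) \<psi>" by (rule chart_inv(6)[OF ch])
  have SU: "S \<subseteq> \<phi> ` U" by (auto simp: S_def)
  have \<psi>S: "\<psi> ` S \<subseteq> M" using S_point(3) by auto
  have SW: "S \<subseteq> W" by (auto simp: S_def)
  define u where "u i x = (if x \<in> S then f (\<psi> x) * z i x else 0)" for i x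
  define d where "d i x = (if x \<in> S then (e (\<psi> x) \<bullet> F1 i x) * z i x
    + f (\<psi> x) * frechet_derivative (z i) (at x) (axis i 1) else 0)" for i x
  have offK: "f (\<psi> x) = 0" "e (\<psi> x) = 0" if "x \<in> S" "x \<notin> K" for x
  proof -
    have "\<psi> x \<notin> \<psi> ` K"
    proof
      assume "\<psi> x \<in> \<psi> ` K"
      then obtain w where w: "w \<in> K" "\<psi> x = \<psi> w" by auto
      then have "x = w" using S_point(2)[OF that(1)] S_point(2)[of w] w K(2) by auto
      then show False using w that by simp
    qed
    then show "f (\<psi> x) = 0" "e (\<psi> x) = 0" using off[OF S_point(3)[OF that(1)]] by auto
  qed
  have closedK: "closed K" using K(1) by (rule compact_imp_closed)
  have S_half: "S \<subseteq> half_space k" using chart_image_openin[OF ch] SU openin_imp_subset by blast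
  have cu: "continuous_on (half_space k) (u i)" for i
  proof -
    have oS: "openin (top_of_set (half_space k)) S"
      unfolding S_def by (intro openin_Int_open chart_image_openin[OF ch] W)
    have oK: "openin (top_of_set (half_space k)) (half_space k - K)"
      unfolding Diff_eq by (intro openin_open_Int open_Compl closedK)
    have split: "half_space k = S \<union> (half_space k - K)" using K(2) S_half by auto
    show ?thesis
    proof (subst split, rule continuous_on_Un_local_open)
      show "openin (top_of_set (S \<union> (half_space k - K))) S"
        by (subst split[symmetric]) (rule oS)
      show "openin (top_of_set (S \<union> (half_space k - K))) (half_space k - K)"
        by (subst split[symmetric]) (rule oK)
      have "continuous_on S (\<lambda>x. f (\<psi> x) * z i x)"
        by (intro continuous_on_mult continuous_on_compose2[OF cf continuous_on_subset[OF c\<psi> SU] \<psi>S]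
            C1_on_continuous C1_on_subset[OF C1_z S_W'])
      then show "continuous_on S (u i)" by (rule continuous_on_eq) (simp add: u_def)
      show "continuous_on (half_space k - K) (u i)"
        by (rule continuous_on_eq[OF continuous_on_const[of _ 0]]) (use offK in \<open>auto simp: u_def\<close>)
    qed
  qed
  have u0: "u i x = 0" if "x \<notin> K" for i x using offK that by (auto simp: u_def)
  have d0: "d i x = 0" if "x \<notin> K" for i x using offK that by (auto simp: d_def)
  have bdry: "u i x = 0" if "i = k" "x $ k = 0" for i x
  proof (cases "x \<in> S")
    case True
    have "(\<chi> i. y i x) $ k = 0"
      by (rule flux_boundary[OF ch S_point(1)[OF True] _ Y_coordinates(2)[OF True]])
        (simp add: S_point(2)[OF True] that)
    then show ?thesis by (simp add: u_def z_def that)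
  qed (simp add: u_def)
  have du: "((\<lambda>t. u i (x + t *\<^sub>R axis i 1)) has_real_derivative d i x) (at 0)" if pos: "0 < x $ k" for i x
  proof (cases "x \<in> S")
    case True
    obtain Q where Q: "open Q" "x \<in> Q" "Q \<subseteq> S" using inside_interior[OF True pos] by metis
    have at: "at x within \<phi> ` U = at x"
      by (rule at_within_interior) (use Q SU in \<open>auto simp: interior_def\<close>)
    have "((f \<circ> \<psi>) has_derivative (\<lambda>v. e (\<psi> x) \<bullet> chart_deriv F (U, \<phi>) (\<psi> x) v))
        (at (\<phi> (\<psi> x)) within \<phi> ` U)"
      using grad ch S_point(1)[OF True] unfolding has_V_gradient_def by blast
    then have df: "((\<lambda>x. f (\<psi> x)) has_derivative (\<lambda>v. e (\<psi> x) \<bullet> chart_deriv F (U, \<phi>) (\<psi> x) v)) (at x)"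
      by (simp add: S_point(2)[OF True] at o_def)
    have "x \<in> W'" using True S_W' by auto
    from has_derivative_mult[OF df C1_on_has_derivative[OF C1_z this]]
    have "(u i has_derivative (\<lambda>v. f (\<psi> x) * frechet_derivative (z i) (at x) v
        + (e (\<psi> x) \<bullet> chart_deriv F (U, \<phi>) (\<psi> x) v) * z i x)) (at x)"
      by (rule has_derivative_transform_within_open[OF _ Q(1,2)]) (use Q(3) in \<open>auto simp: u_def\<close>)
    from has_derivative_along_line[OF this, of "axis i 1"] show ?thesis
      by (simp add: d_def True chart_deriv_F1[OF True] add.commute)
  next
    case False
    then have xK: "x \<in> - K" using K(2) by auto
    have "(u i has_derivative (\<lambda>v. 0)) (at x)"
      by (rule has_derivative_transform_within_open[OF has_derivative_const _ xK])
        (use closedK u0 in auto)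
    from has_derivative_along_line[OF this, of "axis i 1"] show ?thesis by (simp add: d_def False)
  qed
  have "\<exists>L. \<forall>x. \<bar>d i x\<bar> \<le> L" for i
  proof -
    have "continuous_on S (\<lambda>x. (e (\<psi> x) \<bullet> F1 i x) * z i x
        + f (\<psi> x) * frechet_derivative (z i) (at x) (axis i 1))"
      using C1_z[of i] continuous_on_subset[OF _ S_W']
      by (intro continuous_intros continuous_on_compose2[OF cf continuous_on_subset[OF c\<psi> SU] \<psi>S]
          continuous_on_compose2[OF ce continuous_on_subset[OF c\<psi> SU] \<psi>S]
          C1_on_continuous[OF C1_on_subset[OF C1_z S_W']] C1_on_continuous[OF C1_on_subset[OF C1_F1 SW]])
        (auto simp: C1_on_def)
    then have "continuous_on S (d i)" by (rule continuous_on_eq) (simp add: d_def)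
    then have "bounded (d i ` K)"
      using K by (intro compact_imp_bounded compact_continuous_image) (auto intro: continuous_on_subset)
    then obtain L where L: "\<And>x. x \<in> K \<Longrightarrow> \<bar>d i x\<bar> \<le> L" by (auto simp: bounded_iff)
    have "\<bar>d i x\<bar> \<le> max L 0" for x using L[of x] d0[of x i] by (cases "x \<in> K") auto
    then show ?thesis by blast
  qed
  then obtain L where L: "\<And>i x. \<bar>d i x\<bar> \<le> L i" by metis
  have "has_bochner_integral lborel (\<lambda>x. indicator {x. 0 < x $ k} x * d i x) 0" for i
    by (rule integral_partial_derivative_half_space_eq_0[OF K(1) _ cu _ du]) (use u0 bdry L in auto)
  then have "has_bochner_integral lborel (\<lambda>x. \<Sum>i\<in>UNIV. indicator {x. 0 < x $ k} x * d i x)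
      (\<Sum>i\<in>(UNIV::'n set). 0)"
    by (intro has_bochner_integral_sum)
  then have sum0: "has_bochner_integral lborel (\<lambda>x. \<Sum>i\<in>UNIV. indicator {x. 0 < x $ k} x * d i x) 0"
    by (simp only: sum.neutral_const)
  \<comment> \<open>The hyperplane is excluded because \<open>divergence_z\<close> holds only in the open half-space; it is a
    null set.\<close>
  have pointwise: "(\<Sum>i\<in>UNIV. indicator {x. 0 < x $ k} x * d i x)
      = indicator (\<phi> ` U) x * (volume_density U \<phi> x * ?q (\<psi> x))" if xk: "x $ k \<noteq> 0" for x
  proof (cases "x \<in> S")
    case True
    then have pos: "0 < x $ k" using S_half xk by (force simp: half_space_def)
    have R: "volume_density U \<phi> x = sqrt (det (g x))"
      by (simp add: volume_density_def g_metric[OF True])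
    have "(\<Sum>i\<in>UNIV. d i x) = sqrt (det (g x)) * (e (\<psi> x) \<bullet> (\<Sum>i\<in>UNIV. y i x *\<^sub>R F1 i x))
        + f (\<psi> x) * (\<Sum>i\<in>UNIV. frechet_derivative (z i) (at x) (axis i 1))"
      by (simp add: d_def True z_def sum.distrib sum_distrib_left inner_sum_right mult_ac)
    also have "\<dots> = volume_density U \<phi> x * ?q (\<psi> x)"
      unfolding divergence_z[OF True pos] Y_coordinates(1)[OF True, symmetric] S_point(8)[OF True] R
      by (simp add: algebra_simps)
    finally show ?thesis using pos True SU by (simp add: subset_iff)
  next
    case False
    have "f (\<psi> x) = 0 \<and> e (\<psi> x) = 0" if "x \<in> \<phi> ` U"
    proof (rule off)
      have "\<psi> x \<in> U" "\<phi> (\<psi> x) = x" using chart_inv(2,3)[OF ch that] by auto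
      then show "\<psi> x \<in> M" using chart_subset[OF ch] by auto
      show "\<psi> x \<notin> \<psi> ` K"
      proof
        assume "\<psi> x \<in> \<psi> ` K"
        then obtain w where w: "w \<in> K" "\<psi> x = \<psi> w" by auto
        then have "x = w" using \<open>\<phi> (\<psi> x) = x\<close> S_point(2)[of w] w K(2) by auto
        then show False using w K(2) False by auto
      qed
    qed
    then show ?thesis using False by (auto simp: d_def indicator_def)
  qed
  show ?thesis
  proof (rule has_bochner_integral_chart[OF ch])
    show "?q \<in> borel_measurable borel_M" by (rule borel_measurable_continuous_on_restrict[OF cq])
    show "?q p = 0" if "p \<in> M" "p \<notin> U" for p
      using off[OF that(1)] that(2) K(2) S_point(1) by force
    show "has_bochner_integral lborel (\<lambda>x. indicator (\<phi> ` U) x * (volume_density U \<phi> x * ?q (\<psi> x))) 0"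
    proof (rule has_bochner_integral_cong_AE[THEN iffD1, OF _ _ _ sum0])
      show "(\<lambda>x. \<Sum>i\<in>UNIV. indicator {x. 0 < x $ k} x * d i x) \<in> borel_measurable lborel"
        by (rule borel_measurable_has_bochner_integral[OF sum0])
      have "\<psi> ` \<phi> ` U \<subseteq> M" using chart_inv(3)[OF ch] chart_subset[OF ch] by auto
      from continuous_on_compose2[OF cq c\<psi> this]
      have "(\<lambda>x. ?q (\<psi> x)) \<in> borel_measurable (restrict_space borel (\<phi> ` U))"
        by (rule borel_measurable_continuous_on_restrict)
      then have "(\<lambda>x. volume_density U \<phi> x * ?q (\<psi> x)) \<in> borel_measurable (restrict_space borel (\<phi> ` U))"
        by (intro borel_measurable_times volume_density_measurable[OF ch])
      then show "(\<lambda>x. indicator (\<phi> ` U) x * (volume_density U \<phi> x * ?q (\<psi> x))) \<in> borel_measurable lborel"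
        using chart_image_borel[OF ch] by (subst (asm) borel_measurable_restrict_space_iff) auto
      show "AE x in lborel. (\<Sum>i\<in>UNIV. indicator {x. 0 < x $ k} x * d i x)
          = indicator (\<phi> ` U) x * (volume_density U \<phi> x * ?q (\<psi> x))"
        using AE_off_hyperplane[of k] by eventually_elim (rule pointwise)
    qed
  qed
qed

end


section \<open>Partition of unity\<close>

lemma has_real_derivative_max_0_square:
  "((\<lambda>t::real. (max 0 t)\<^sup>2) has_real_derivative 2 * max 0 t) (at t)"
proof -
  consider "t < 0" | "t = 0" | "0 < t" by linarith
  then show ?thesis
  proof cases
    case 1
    have "((\<lambda>t::real. 0) has_real_derivative 0) (at t)" by simp
    then show ?thesis
      by (rule has_field_derivative_transform_within_open[where S="{..<0}", THEN DERIV_cong])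
        (use 1 in auto)
  next
    case 2
    have "(\<lambda>h::real. (max 0 h)\<^sup>2 / h) \<midarrow>0\<rightarrow> 0"
    proof (rule Lim_null_comparison)
      show "\<forall>\<^sub>F h::real in at 0. norm ((max 0 h)\<^sup>2 / h) \<le> \<bar>h\<bar>"
        by (rule always_eventually) (auto simp: max_def power2_eq_square)
      show "(\<lambda>h::real. \<bar>h\<bar>) \<midarrow>0\<rightarrow> 0" by (intro tendsto_eq_intros | simp)+
    qed
    then show ?thesis by (simp add: 2 DERIV_def)
  next
    case 3
    have "((\<lambda>t::real. t\<^sup>2) has_real_derivative 2 * t) (at t)"
      by (auto intro!: derivative_eq_intros)
    then show ?thesis
      by (rule has_field_derivative_transform_within_open[where S="{0<..}", THEN DERIV_cong])
        (use 3 in auto)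
  qed
qed

lemma has_derivative_injective_locally_injective:
  fixes f :: "'a::euclidean_space \<Rightarrow> 'b::euclidean_space"
  assumes f: "(f has_derivative D) (at x within S)" and inj: "inj D"
  obtains d where "d > 0" "\<And>y. y \<in> S \<Longrightarrow> norm (y - x) < d \<Longrightarrow> f y = f x \<Longrightarrow> y = x"
proof -
  have lin: "linear D" using f by (rule has_derivative_linear)
  obtain m where m: "m > 0" "\<And>v. m * norm v \<le> norm (D v)"
    using linear_inj_bounded_below_pos[OF lin inj] by (metis mult.commute)
  have "m / 2 > 0" using m by simp
  then obtain d where d: "d > 0"
    "\<And>y. y \<in> S \<Longrightarrow> norm (y - x) < d \<Longrightarrow> norm (f y - f x - D (y - x)) \<le> m / 2 * norm (y - x)"
    using f unfolding has_derivative_within_alt by meson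
  have "y = x" if y: "y \<in> S" "norm (y - x) < d" "f y = f x" for y
  proof -
    have "m * norm (y - x) \<le> m / 2 * norm (y - x)"
      using d(2)[OF y(1,2)] m(2)[of "y - x"] y(3) by simp
    then show "y = x" using m(1) by (simp add: mult_le_cancel_right)
  qed
  then show ?thesis using that d(1) by blast
qed

context immersed_hypersurface
begin

lemma eventually_in_chart:
  assumes ch: "(U, \<phi>) \<in> \<A>" and p: "p \<in> U" "p \<in> Q" and Q: "openin (top_of_set M) Q"
  shows "\<forall>\<^sub>F x in at (\<phi> p) within \<phi> ` U. inv_into U \<phi> x \<in> Q"
proof -
  note i = chart_inv[OF ch]
  obtain T where T: "open T" "Q = M \<inter> T" using Q by (auto simp: openin_open)
  have "(inv_into U \<phi> \<longlongrightarrow> inv_into U \<phi> (\<phi> p)) (at (\<phi> p) within \<phi> ` U)"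
    using i(6) p(1) by (auto simp: continuous_on_def)
  then have "\<forall>\<^sub>F x in at (\<phi> p) within \<phi> ` U. inv_into U \<phi> x \<in> T"
    by (rule topological_tendstoD) (use T p i(1) in auto)
  moreover have "\<forall>\<^sub>F x in at (\<phi> p) within \<phi> ` U. x \<in> \<phi> ` U"
    by (simp add: eventually_at_filter)
  ultimately show ?thesis
    by eventually_elim (use i(3) chart_subset[OF ch] T(2) in auto)
qed

lemma has_V_gradient_derivative:
  "has_V_gradient f e \<Longrightarrow> (U, \<phi>) \<in> \<A> \<Longrightarrow> p \<in> U \<Longrightarrow> ((f \<circ> inv_into U \<phi>) has_derivative
    (\<lambda>v. e p \<bullet> chart_deriv F (U, \<phi>) p v)) (at (\<phi> p) within \<phi> ` U)"
  unfolding has_V_gradient_def by blast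

lemma has_V_gradient_sum:
  assumes "finite T" "\<And>t. t \<in> T \<Longrightarrow> has_V_gradient (f t) (e t)"
  shows "has_V_gradient (\<lambda>p. \<Sum>t\<in>T. f t p) (\<lambda>p. \<Sum>t\<in>T. e t p)"
  unfolding has_V_gradient_def
proof (intro conjI ballI)
  show "continuous_on M (\<lambda>p. \<Sum>t\<in>T. f t p)" "continuous_on M (\<lambda>p. \<Sum>t\<in>T. e t p)"
    using assms by (auto intro!: continuous_on_sum simp: has_V_gradient_def)
next
  fix ch assume "ch \<in> \<A>"
  then obtain U \<phi> where ch: "ch = (U, \<phi>)" "(U, \<phi>) \<in> \<A>" by (cases ch) auto
  have "(((\<lambda>p. \<Sum>t\<in>T. f t p) \<circ> inv_into U \<phi>) has_derivative
      (\<lambda>v. (\<Sum>t\<in>T. e t p) \<bullet> chart_deriv F (U, \<phi>) p v)) (at (\<phi> p) within \<phi> ` U)" if "p \<in> U" for p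
    unfolding o_def inner_sum_left
    by (intro has_derivative_sum has_V_gradient_derivative[unfolded o_def] assms ch that)
  then show "case ch of (U, \<phi>) \<Rightarrow> \<forall>p\<in>U. (((\<lambda>p. \<Sum>t\<in>T. f t p) \<circ> inv_into U \<phi>) has_derivative
      (\<lambda>v. (\<Sum>t\<in>T. e t p) \<bullet> chart_deriv F (U, \<phi>) p v)) (at (\<phi> p) within \<phi> ` U)"
    by (simp add: ch)
qed

lemma has_V_gradient_divide:
  assumes f: "has_V_gradient f e" and s: "has_V_gradient s es" and pos: "\<And>p. p \<in> M \<Longrightarrow> s p \<noteq> 0"
  shows "has_V_gradient (\<lambda>p. f p / s p) (\<lambda>p. (1 / s p) *\<^sub>R e p - (f p / (s p * s p)) *\<^sub>R es p)"
  unfolding has_V_gradient_def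
proof (intro conjI ballI)
  have c: "continuous_on M f" "continuous_on M e" "continuous_on M s" "continuous_on M es"
    using f s by (auto simp: has_V_gradient_def)
  show "continuous_on M (\<lambda>p. f p / s p)"
    "continuous_on M (\<lambda>p. (1 / s p) *\<^sub>R e p - (f p / (s p * s p)) *\<^sub>R es p)"
    using pos by (auto intro!: continuous_intros c)
next
  fix ch assume "ch \<in> \<A>"
  then obtain U \<phi> where ch: "ch = (U, \<phi>)" "(U, \<phi>) \<in> \<A>" by (cases ch) auto
  have "(((\<lambda>p. f p / s p) \<circ> inv_into U \<phi>) has_derivative
      (\<lambda>v. ((1 / s p) *\<^sub>R e p - (f p / (s p * s p)) *\<^sub>R es p) \<bullet> chart_deriv F (U, \<phi>) p v))
      (at (\<phi> p) within \<phi> ` U)" if p: "p \<in> U" for p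
  proof -
    have sp: "s p \<noteq> 0" using pos chart_subset[OF ch(2)] p by auto
    have i: "inv_into U \<phi> (\<phi> p) = p" by (rule chart_inv(1)[OF ch(2) p])
    have df: "((\<lambda>x. f (inv_into U \<phi> x)) has_derivative (\<lambda>v. e p \<bullet> chart_deriv F (U, \<phi>) p v)) (at (\<phi> p) within \<phi> ` U)"
      and ds: "((\<lambda>x. s (inv_into U \<phi> x)) has_derivative (\<lambda>v. es p \<bullet> chart_deriv F (U, \<phi>) p v)) (at (\<phi> p) within \<phi> ` U)"
      using has_V_gradient_derivative[OF f ch(2) p] has_V_gradient_derivative[OF s ch(2) p] by (simp_all add: o_def)
    show ?thesis unfolding o_def
      by (rule has_derivative_eq_rhs[OF has_derivative_divide'[OF df ds]])
        (use sp in \<open>auto simp: i fun_eq_iff inner_diff_left inner_scaleR_left field_simps\<close>)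
  qed
  then show "case ch of (U, \<phi>) \<Rightarrow> \<forall>p\<in>U. (((\<lambda>p. f p / s p) \<circ> inv_into U \<phi>) has_derivative
      (\<lambda>v. ((1 / s p) *\<^sub>R e p - (f p / (s p * s p)) *\<^sub>R es p) \<bullet> chart_deriv F (U, \<phi>) p v))
      (at (\<phi> p) within \<phi> ` U)"
    by (simp add: ch)
qed

text \<open>Near \<open>p\<close> the immersion takes the value \<open>F p\<close> only at \<open>p\<close>. So there is a coordinate ball such that,
  on the part of its sphere in the half-space, \<open>F\<close> keeps a distance of at least \<open>2 \<epsilon>\<close> from \<open>F p\<close>. A function of \<open>|F q - F p|\<close> that
  vanishes from distance \<open>\<epsilon>\<close> on is zero near the sphere, and may be cut off outside of the ball.\<close>

lemma bump_function:
  assumes ch: "(U, \<phi>) \<in> \<A>" and p: "p \<in> U" and D: "open D" "\<phi> p \<in> D"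
  obtains C f e where "compact C" "C \<subseteq> \<phi> ` U \<inter> D" "has_V_gradient f e" "0 < f p"
    "\<And>q. 0 \<le> f q" "\<And>q. f q = 0 \<Longrightarrow> e q = 0" "\<And>q. q \<notin> inv_into U \<phi> ` C \<Longrightarrow> f q = 0"
proof -
  let ?\<psi> = "inv_into U \<phi>" and ?h = "half_space k"
  note i = chart_inv[OF ch] and UM = chart_subset[OF ch]
  have pM: "p \<in> M" using p UM by auto
  obtain T where T: "open T" "\<phi> ` U = ?h \<inter> T"
    using chart_image_openin[OF ch] by (auto simp: openin_open)
  have "inj (chart_deriv F (U, \<phi>) p)"
    unfolding linear_injective_0[OF chart_deriv_linear[OF ch p]]
    using chart_deriv_positive[OF ch p] by (force simp: ip.zero_left)
  from has_derivative_injective_locally_injective[OF has_derivative_chart_deriv[OF ch p] this]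
  obtain d where d: "d > 0" "\<And>x. x \<in> \<phi> ` U \<Longrightarrow> norm (x - \<phi> p) < d \<Longrightarrow> F (?\<psi> x) = F p \<Longrightarrow> x = \<phi> p"
    by (auto simp: i p)
  have "\<phi> p \<in> T" using T(2) p by auto
  then obtain r0 where r0: "r0 > 0" "cball (\<phi> p) r0 \<subseteq> T \<inter> D"
    using D T(1) by (metis IntI open_Int open_contains_cball)
  \<comment> \<open>The half keeps the closed ball inside the region of injectivity.\<close>
  define r where "r = min r0 (d / 2)"
  have r: "r > 0" "r < d" "cball (\<phi> p) r \<subseteq> T \<inter> D" using r0 d(1) by (auto simp: r_def subset_iff)
  define C where "C = cball (\<phi> p) r \<inter> ?h"
  have closed_h: "closed ?h"
    unfolding half_space_def by (intro closed_Collect_le continuous_intros)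
  have C: "compact C" "C \<subseteq> \<phi> ` U \<inter> D"
    using r(3) closed_h unfolding C_def T(2) by (auto intro: compact_Int_closed)
  have CU: "C \<subseteq> \<phi> ` U" using C(2) by auto
  have cF\<psi>: "continuous_on (\<phi> ` U) (\<lambda>x. F (?\<psi> x))"
    by (rule continuous_on_compose2[OF F_continuous i(6)]) (use i(3) UM in auto)
  have "\<exists>\<epsilon>>0. \<forall>x\<in>sphere (\<phi> p) r \<inter> ?h. 2 * \<epsilon> \<le> norm (F (?\<psi> x) - F p)"
  proof (cases "sphere (\<phi> p) r \<inter> ?h = {}")
    case False
    have sub: "sphere (\<phi> p) r \<inter> ?h \<subseteq> C" by (auto simp: C_def)
    have cpt: "compact (sphere (\<phi> p) r \<inter> ?h)" by (intro compact_Int_closed closed_h compact_sphere)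
    have cont: "continuous_on (sphere (\<phi> p) r \<inter> ?h) (\<lambda>x. norm (F (?\<psi> x) - F p))"
      by (intro continuous_intros continuous_on_subset[OF cF\<psi>]) (use sub CU in auto)
    obtain x where x: "x \<in> sphere (\<phi> p) r \<inter> ?h"
      "\<forall>y\<in>sphere (\<phi> p) r \<inter> ?h. norm (F (?\<psi> x) - F p) \<le> norm (F (?\<psi> y) - F p)"
      using continuous_attains_inf[OF cpt False cont] by (rule bexE)
    have ne: "x \<noteq> \<phi> p" using x(1) r(1) by auto
    have near: "norm (x - \<phi> p) < d" using x(1) r(2) by (simp add: dist_norm norm_minus_commute)
    have xU: "x \<in> \<phi> ` U" by (rule subsetD[OF CU subsetD[OF sub x(1)]])
    have "F (?\<psi> x) \<noteq> F p" using d(2)[OF xU near] ne by (rule contrapos_nn[rotated])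
    then show ?thesis using x(2) by (intro exI[of _ "norm (F (?\<psi> x) - F p) / 2"]) auto
  qed (auto intro: exI[of _ 1])
  then obtain \<epsilon> where \<epsilon>: "\<epsilon> > 0" "\<And>x. x \<in> sphere (\<phi> p) r \<Longrightarrow> x \<in> ?h \<Longrightarrow> 2 * \<epsilon> \<le> norm (F (?\<psi> x) - F p)"
    by auto
  define w where "w q = F q - F p" for q
  define \<delta> where "\<delta> q = max 0 (\<epsilon>\<^sup>2 - w q \<bullet> w q)" for q
  define f where "f q = (if q \<in> ?\<psi> ` C then (\<delta> q)\<^sup>2 else 0)" for q
  define e where "e q = (if q \<in> ?\<psi> ` C then (- 4 * \<delta> q) *\<^sub>R w q else 0)" for q
  have compC: "compact (?\<psi> ` C)"
    by (rule compact_continuous_image[OF continuous_on_subset[OF i(6) CU] C(1)])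
  have \<psi>CM: "?\<psi> ` C \<subseteq> M" using CU i(3) UM by auto
  have cw: "continuous_on M w" unfolding w_def by (intro continuous_intros F_continuous)
  have c\<delta>: "continuous_on M \<delta>" unfolding \<delta>_def by (intro continuous_intros cw)
  \<comment> \<open>On the open set \<open>I\<close> the function is smooth in \<open>F\<close>, on the open set \<open>J\<close> it vanishes; the choice of
    \<open>\<epsilon>\<close> makes them cover \<open>M\<close>.\<close>
  define I where "I = U \<inter> \<phi> -` ball (\<phi> p) r"
  define Z where "Z = ?\<psi> ` C \<inter> (\<lambda>q. norm (w q)) -` {..\<epsilon>}"
  define J where "J = M - Z"
  have oI: "openin (top_of_set M) I"
  proof (rule openin_trans[OF _ chart_openin[OF ch]])
    show "openin (top_of_set U) I"
      unfolding I_def by (rule continuous_openin_preimage_gen[OF i(5)]) simp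
  qed
  have "continuous_on (?\<psi> ` C) (\<lambda>q. norm (w q))"
    by (intro continuous_on_norm continuous_on_subset[OF cw \<psi>CM])
  then have "closed Z"
    unfolding Z_def by (rule continuous_closed_preimage[OF _ compact_imp_closed[OF compC] closed_atMost])
  then have oJ: "openin (top_of_set M) J"
    unfolding J_def Diff_eq by (intro openin_open_Int open_Compl)
  have I_C: "q \<in> ?\<psi> ` C" if "q \<in> I" for q
  proof -
    have q: "q \<in> U" "\<phi> q \<in> ball (\<phi> p) r" using that by (auto simp: I_def)
    have "\<phi> q \<in> \<phi> ` U" using q(1) by (rule imageI)
    then have "\<phi> q \<in> ?h" unfolding T(2) by (rule IntD1)
    then have "\<phi> q \<in> C" using q(2) by (simp add: C_def)
    then have "?\<psi> (\<phi> q) \<in> ?\<psi> ` C" by (rule imageI)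
    then show ?thesis unfolding i(1)[OF q(1)] .
  qed
  have onI: "f q = (\<delta> q)\<^sup>2" "e q = (- 4 * \<delta> q) *\<^sub>R w q" if "q \<in> I" for q
    using I_C[OF that] by (auto simp: f_def e_def)
  have onJ: "f q = 0 \<and> e q = 0" if "q \<in> J" for q
  proof (cases "q \<in> ?\<psi> ` C")
    case True
    then have "\<epsilon> < norm (w q)" using that by (auto simp: J_def Z_def)
    then have "\<epsilon>\<^sup>2 \<le> (norm (w q))\<^sup>2" using \<epsilon>(1) by (intro power_mono) auto
    then have "\<delta> q = 0" by (simp add: \<delta>_def power2_norm_eq_inner)
    then show ?thesis by (simp add: f_def e_def)
  qed (auto simp: f_def e_def)
  have IJ: "M = I \<union> J"
  proof
    show "M \<subseteq> I \<union> J"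
    proof
      fix q assume qM: "q \<in> M"
      show "q \<in> I \<union> J"
      proof (cases "q \<in> Z")
        case True
        then obtain x where x: "x \<in> C" "q = ?\<psi> x" "norm (w q) \<le> \<epsilon>" by (auto simp: Z_def)
        have "x \<in> \<phi> ` U" by (rule subsetD[OF CU x(1)])
        from i(3)[OF this] i(2)[OF this] have q: "q \<in> U" "\<phi> q = x" unfolding x(2) .
        have "x \<notin> sphere (\<phi> p) r"
        proof
          assume "x \<in> sphere (\<phi> p) r"
          then have "2 * \<epsilon> \<le> norm (F (?\<psi> x) - F p)" using \<epsilon>(2) x(1) by (simp add: C_def)
          then show False using x(2,3) \<epsilon>(1) by (simp add: w_def)
        qed
        then have "q \<in> I" using x(1) q by (auto simp: I_def C_def)
        then show ?thesis by simp
      qed (use qM in \<open>simp add: J_def\<close>)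
    qed
  qed (use UM in \<open>auto simp: I_def J_def\<close>)
  have IM: "I \<subseteq> M" and JM: "J \<subseteq> M" by (auto simp: IJ)
  have "has_V_gradient f e"
    unfolding has_V_gradient_def
  proof (intro conjI ballI)
    show "continuous_on M f"
    proof (subst IJ, rule continuous_on_Un_local_open)
      have "continuous_on I (\<lambda>q. (\<delta> q)\<^sup>2)"
        by (intro continuous_intros continuous_on_subset[OF c\<delta> IM])
      then show "continuous_on I f" by (rule continuous_on_eq) (simp add: onI)
      show "continuous_on J f" by (rule continuous_on_eq[OF continuous_on_const[of _ 0]]) (simp add: onJ)
    qed (use oI oJ IJ in auto)
    show "continuous_on M e"
    proof (subst IJ, rule continuous_on_Un_local_open)
      have "continuous_on I (\<lambda>q. (- 4 * \<delta> q) *\<^sub>R w q)"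
        by (intro continuous_intros continuous_on_subset[OF c\<delta> IM] continuous_on_subset[OF cw IM])
      then show "continuous_on I e" by (rule continuous_on_eq) (simp add: onI)
      show "continuous_on J e" by (rule continuous_on_eq[OF continuous_on_const[of _ 0]]) (simp add: onJ)
    qed (use oI oJ IJ in auto)
  next
    fix ch' assume "ch' \<in> \<A>"
    then obtain U' \<phi>' where ch': "ch' = (U', \<phi>')" "(U', \<phi>') \<in> \<A>" by (cases ch') auto
    have "((f \<circ> inv_into U' \<phi>') has_derivative (\<lambda>v. e q \<bullet> chart_deriv F (U', \<phi>') q v))
        (at (\<phi>' q) within \<phi>' ` U')" if q: "q \<in> U'" for q
    proof -
      let ?\<psi>' = "inv_into U' \<phi>'"
      have i': "?\<psi>' (\<phi>' q) = q" by (rule chart_inv(1)[OF ch'(2) q])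
      have qM: "q \<in> M" using q chart_subset[OF ch'(2)] by auto
      show ?thesis
      proof (cases "q \<in> I")
        case True
        have "((\<lambda>x. F (?\<psi>' x)) has_derivative chart_deriv F (U', \<phi>') q) (at (\<phi>' q) within \<phi>' ` U')"
          using has_derivative_chart_deriv[OF ch'(2) q] by (simp add: o_def)
        then have dw: "((\<lambda>x. w (?\<psi>' x)) has_derivative chart_deriv F (U', \<phi>') q) (at (\<phi>' q) within \<phi>' ` U')"
          using has_derivative_diff[OF _ has_derivative_const[of "F p"]] by (fastforce simp: w_def)
        have "((\<lambda>x. \<epsilon>\<^sup>2 - w (?\<psi>' x) \<bullet> w (?\<psi>' x)) has_derivative
            (\<lambda>v. 0 - (w q \<bullet> chart_deriv F (U', \<phi>') q v + chart_deriv F (U', \<phi>') q v \<bullet> w q)))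
            (at (\<phi>' q) within \<phi>' ` U')"
          by (intro has_derivative_diff has_derivative_const has_derivative_inner[OF dw dw, unfolded i'])
        from has_derivative_compose[OF this has_real_derivative_max_0_square[unfolded has_field_derivative_def]]
        have "((\<lambda>x. (\<delta> (?\<psi>' x))\<^sup>2) has_derivative (\<lambda>v. e q \<bullet> chart_deriv F (U', \<phi>') q v))
            (at (\<phi>' q) within \<phi>' ` U')"
          unfolding \<delta>_def[symmetric]
          by (rule has_derivative_eq_rhs)
            (simp add: fun_eq_iff onI[OF True] i' \<delta>_def inner_commute)
        then show ?thesis
        proof (rule has_derivative_transform_eventually)
          show "\<forall>\<^sub>F x in at (\<phi>' q) within \<phi>' ` U'. (\<delta> (?\<psi>' x))\<^sup>2 = (f \<circ> ?\<psi>') x"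
            using eventually_in_chart[OF ch'(2) q True oI] by eventually_elim (simp add: onI)
        qed (use q in \<open>auto simp: i' onI[OF True]\<close>)
      next
        case False
        then have qJ: "q \<in> J" using qM IJ by auto
        have "((\<lambda>x. 0::real) has_derivative (\<lambda>v. e q \<bullet> chart_deriv F (U', \<phi>') q v))
            (at (\<phi>' q) within \<phi>' ` U')"
          using onJ[OF qJ] by simp
        then show ?thesis
        proof (rule has_derivative_transform_eventually)
          show "\<forall>\<^sub>F x in at (\<phi>' q) within \<phi>' ` U'. 0 = (f \<circ> ?\<psi>') x"
            using eventually_in_chart[OF ch'(2) q qJ oJ] by eventually_elim (simp add: onJ)
        qed (use q in \<open>auto simp: i' onJ[OF qJ]\<close>)
      qed
    qed
    then show "case ch' of (U, \<phi>) \<Rightarrow> \<forall>p\<in>U. ((f \<circ> inv_into U \<phi>) has_derivative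
        (\<lambda>v. e p \<bullet> chart_deriv F (U, \<phi>) p v)) (at (\<phi> p) within \<phi> ` U)"
      by (simp add: ch')
  qed
  moreover have "0 < f p"
  proof -
    have "p \<in> I" using p r(1) by (simp add: I_def)
    then show ?thesis using \<epsilon>(1) by (simp add: onI \<delta>_def w_def)
  qed
  moreover have "0 \<le> f q" "f q = 0 \<Longrightarrow> e q = 0" "q \<notin> ?\<psi> ` C \<Longrightarrow> f q = 0" for q
    by (auto simp: f_def e_def)
  ultimately show ?thesis using that[OF C] by blast
qed

end

context capillary_hypersurface
begin

text \<open>The function \<open>f\<close> is positive at \<open>p\<close> and has such a small support that the divergence theorem holds
  for each \<open>f' Y\<close> with \<open>f'\<close> supported there. Quantifying over \<open>f'\<close> allows for the normalisation of the
  partition of unity.\<close>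

definition localizing :: "'m \<Rightarrow> ('m \<Rightarrow> real) \<Rightarrow> ('m \<Rightarrow> 'n V) \<Rightarrow> bool"
  where "localizing p f e \<longleftrightarrow> has_V_gradient f e \<and> 0 < f p \<and> (\<forall>q. 0 \<le> f q) \<and> (\<forall>q. f q = 0 \<longrightarrow> e q = 0) \<and>
    (\<forall>f' e'. has_V_gradient f' e' \<longrightarrow> (\<forall>q\<in>M. f q = 0 \<longrightarrow> f' q = 0 \<and> e' q = 0) \<longrightarrow>
      has_bochner_integral (volume_measure M \<A> F)
        (\<lambda>q. f' q * phi_fun c E A B H \<gamma> F \<nu> q + e' q \<bullet> flux q) 0)"

lemma localizing_exists:
  assumes "p \<in> M"
  shows "\<exists>f e. localizing p f e"
proof -
  obtain U \<phi> where ch: "(U, \<phi>) \<in> \<A>" and p: "p \<in> U"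
    using atlas assms by (auto simp: smooth_atlas_def)
  obtain W1 G where G: "open W1" "\<phi> p \<in> W1" "C1_on W1 G" "\<And>v. C1_on W1 (\<lambda>y. frechet_derivative G (at y) v)"
    "\<And>y. y \<in> \<phi> ` U \<Longrightarrow> y \<in> W1 \<Longrightarrow> G y = (F \<circ> inv_into U \<phi>) y"
    using smooth_on_extension[OF chart_smooth[OF ch] imageI[OF p]] by blast
  obtain W2 N where N: "open W2" "\<phi> p \<in> W2" "C1_on W2 N" "\<And>v. C1_on W2 (\<lambda>y. frechet_derivative N (at y) v)"
    "\<And>y. y \<in> \<phi> ` U \<Longrightarrow> y \<in> W2 \<Longrightarrow> N y = (\<nu> \<circ> inv_into U \<phi>) y"
    using smooth_on_extension[OF normal_smooth[OF ch] imageI[OF p]] by blast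
  interpret L: local_extension k M \<A> E F c H \<gamma> A B \<nu> \<mu> U \<phi> "W1 \<inter> W2" G N
  proof
    show "open (W1 \<inter> W2)" using G(1) N(1) by (rule open_Int)
    show "C1_on (W1 \<inter> W2) G" "C1_on (W1 \<inter> W2) (\<lambda>x. frechet_derivative G (at x) v)" "C1_on (W1 \<inter> W2) N" for v
      by (rule C1_on_subset[OF G(3) Int_lower1], rule C1_on_subset[OF G(4) Int_lower1],
          rule C1_on_subset[OF N(3) Int_lower2])
  qed (use ch G(5) N(5) in simp_all)
  obtain C f e where C: "compact C" "C \<subseteq> \<phi> ` U \<inter> (W1 \<inter> W2)"
    and f: "has_V_gradient f e" "0 < f p" "\<And>q. 0 \<le> f q" "\<And>q. f q = 0 \<Longrightarrow> e q = 0"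
    "\<And>q. q \<notin> inv_into U \<phi> ` C \<Longrightarrow> f q = 0"
    using bump_function[OF ch p open_Int[OF G(1) N(1)] IntI[OF G(2) N(2)]] by blast
  have "localizing p f e"
    unfolding localizing_def
  proof (intro conjI allI impI f(1-4))
    fix f' e' assume grad: "has_V_gradient f' e'"
      and off: "\<forall>q\<in>M. f q = 0 \<longrightarrow> f' q = 0 \<and> e' q = 0"
    show "has_bochner_integral (volume_measure M \<A> F)
        (\<lambda>q. f' q * phi_fun c E A B H \<gamma> F \<nu> q + e' q \<bullet> flux q) 0"
      by (rule L.local_divergence_theorem[OF grad C(1) C(2)[folded L.S_def]]) (simp add: off f(5))
  qed
  then show ?thesis by blast
qed

text \<open>For a partition of unity the gradients add up to zero, so that the local identities add up to the
  global one.\<close>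

theorem integral_phi_eq_0: "has_bochner_integral (volume_measure M \<A> F) (phi_fun c E A B H \<gamma> F \<nu>) 0"
proof -
  let ?\<Phi> = "phi_fun c E A B H \<gamma> F \<nu>" and ?\<omega> = "volume_measure M \<A> F"
  obtain f e where loc: "\<And>p. p \<in> M \<Longrightarrow> localizing p (f p) (e p)"
    using localizing_exists by metis
  have grad: "has_V_gradient (f p) (e p)" and pos: "0 < f p p" and nonneg: "0 \<le> f p q"
    and zero: "f p q = 0 \<Longrightarrow> e p q = 0" if "p \<in> M" for p q
    using loc[OF that] by (simp_all add: localizing_def)
  have int: "has_bochner_integral ?\<omega> (\<lambda>q. f' q * ?\<Phi> q + e' q \<bullet> flux q) 0"
    if "p \<in> M" "has_V_gradient f' e'" "\<forall>q\<in>M. f p q = 0 \<longrightarrow> f' q = 0 \<and> e' q = 0" for p f' e'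
    using loc[OF that(1)] that(2,3) unfolding localizing_def by blast
  have "\<exists>O'. open O' \<and> M \<inter> O' = {q \<in> M. 0 < f p q}" if "p \<in> M" for p
  proof -
    have "openin (top_of_set M) (M \<inter> f p -` {0<..})"
      using grad[OF that] by (intro continuous_openin_preimage_gen) (auto simp: has_V_gradient_def)
    then show ?thesis by (auto simp: openin_open)
  qed
  then obtain O' where O': "\<And>p. p \<in> M \<Longrightarrow> open (O' p) \<and> M \<inter> O' p = {q \<in> M. 0 < f p q}" by metis
  have "M \<subseteq> (\<Union>p\<in>M. O' p)" using O' pos by blast
  then obtain T where T: "T \<subseteq> M" "finite T" "M \<subseteq> (\<Union>p\<in>T. O' p)"
    using compactE_image[OF compact, of M O'] O' by metis
  define s where "s q = (\<Sum>t\<in>T. f t q)" for q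
  define es where "es q = (\<Sum>t\<in>T. e t q)" for q
  have s_grad: "has_V_gradient s es"
    unfolding s_def[abs_def] es_def[abs_def] using T grad by (intro has_V_gradient_sum) auto
  have s_pos: "s q > 0" if q: "q \<in> M" for q
  proof -
    obtain t where t: "t \<in> T" "q \<in> O' t" using T(3) q by auto
    then have "0 < f t q" using O'[of t] T(1) q by auto
    then show ?thesis unfolding s_def using T nonneg t(1) by (intro sum_pos2[of T t]) auto
  qed
  define f' where "f' t q = f t q / s q" for t q
  define e' where "e' t q = (1 / s q) *\<^sub>R e t q - (f t q / (s q * s q)) *\<^sub>R es q" for t q
  have "has_bochner_integral ?\<omega> (\<lambda>q. f' t q * ?\<Phi> q + e' t q \<bullet> flux q) 0" if t: "t \<in> T" for t
  proof (rule int)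
    show "t \<in> M" using t T(1) by auto
    then show "has_V_gradient (f' t) (e' t)"
      unfolding f'_def[abs_def] e'_def[abs_def] using s_pos
      by (intro has_V_gradient_divide grad s_grad) (auto simp: less_imp_neq[symmetric])
    show "\<forall>q\<in>M. f t q = 0 \<longrightarrow> f' t q = 0 \<and> e' t q = 0"
      using zero[OF \<open>t \<in> M\<close>] by (simp add: f'_def e'_def)
  qed
  then have "has_bochner_integral ?\<omega> (\<lambda>q. \<Sum>t\<in>T. f' t q * ?\<Phi> q + e' t q \<bullet> flux q) (\<Sum>t\<in>T. 0)"
    by (rule has_bochner_integral_sum)
  then have sum: "has_bochner_integral ?\<omega> (\<lambda>q. \<Sum>t\<in>T. f' t q * ?\<Phi> q + e' t q \<bullet> flux q) 0"
    by (simp only: sum.neutral_const)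
  have "(\<Sum>t\<in>T. f' t q * ?\<Phi> q + e' t q \<bullet> flux q) = ?\<Phi> q" if q: "q \<in> M" for q
  proof -
    have sq: "s q \<noteq> 0" using s_pos[OF q] by simp
    have "(\<Sum>t\<in>T. f' t q) = 1"
      using sq by (simp add: f'_def sum_divide_distrib[symmetric] s_def[symmetric])
    moreover have "(\<Sum>t\<in>T. e' t q) = 0"
    proof -
      have "(\<Sum>t\<in>T. e' t q) = (1 / s q) *\<^sub>R es q - ((\<Sum>t\<in>T. f t q) / (s q * s q)) *\<^sub>R es q"
        by (simp add: e'_def sum_subtractf es_def scaleR_sum_right[symmetric] scaleR_sum_left[symmetric]
            sum_divide_distrib)
      then show ?thesis using sq by (simp add: s_def[symmetric])
    qed
    ultimately show ?thesis
      by (simp add: sum.distrib sum_distrib_right[symmetric] inner_sum_left[symmetric])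
  qed
  then show ?thesis
    using has_bochner_integral_cong[of ?\<omega> ?\<omega> "\<lambda>q. \<Sum>t\<in>T. f' t q * ?\<Phi> q + e' t q \<bullet> flux q" ?\<Phi> 0 0] sum
    by (simp add: space_volume_measure)
qed

end


section \<open>The integral identity\<close>

theorem theorem3p3:
  fixes c H \<gamma> :: real
    and E A B :: "'n::finite V"
    and k :: 'n
    and M :: "'m::t2_space set"
    and \<A> :: "('m, 'n) chart set"
    and F \<nu> \<mu> :: "'m \<Rightarrow> 'n V"
  assumes "c \<in> {1, 0, - 1}" and "E \<noteq> 0" and "\<langle>E, E\<rangle>\<^sub>V = - c"
    and "\<langle>A, A\<rangle>\<^sub>V < 0" and "A \<noteq> E" and "independent {A, E}"
    and "compact M" and "smooth_atlas k M \<A>"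
    and "spacelike_immersion M \<A> E F"
    and "unit_timelike_normal M \<A> E F \<nu>"
    and "outward_unit_conormal k \<A> F \<mu>"
    and "\<gamma> > 0" and "capillary c E A k \<A> F \<nu> \<mu> H \<gamma>"
  shows "has_bochner_integral (volume_measure M \<A> F) (phi_fun c E A B H \<gamma> F \<nu>) 0"
proof -
  interpret capillary_hypersurface k M \<A> E F c H \<gamma> A B \<nu> \<mu>
    by unfold_locales (use assms in auto)
  show ?thesis by (rule integral_phi_eq_0)
qed

end
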